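(* Let $k,k_1,k_2\in\mathcal K_{pol}(\mathbb R^n)$. Suppose that there is $C>0$ such that $$\frac1{k_1^2}*\frac1{k_2^2}\le\frac{C^2}{k^2}.$$ If $1\le p,p_1,p_2\le\infty$ and $\frac1{p_1}+\frac1{p_2}=\frac1p$, then $$\mathcal B_{k_1}^{p_1}(\mathbb R^n)\cdot\mathcal B_{k_2}^{p_2}(\mathbb R^n)\subset\mathcal B_k^p(\mathbb R^n).$$
   Context: Notation: $\langle\xi\rangle=(1+|\xi|^2)^{1/2}$; $\widehat u(\xi)=\int e^{-i\langle x,\xi\rangle}u(x)\,dx$, extended to $\mathcal S'(\mathbb R^n)$; $\tau_y\chi=\chi(\cdot-y)$. $\mathcal K_{pol}(\mathbb R^n)$ is the set of positive measurable functions $k$ on $\mathbb R^n$ for which there are constants $C,N>0$ with $k(\xi+\eta)\le C\langle\xi\rangle^Nk(\eta)$ for all $\xi,\eta\in\mathbb R^n$. $\mathcal B_k(\mathbb R^n)$ is the set of $u\in\mathcal S'(\mathbb R^n)$ such that $\widehat u$ is a function and $k\widehat u\in L^2$, with norm $\|u\|_{\mathcal B_k}=\|k\widehat u\|_{L^2}$ ($=+\infty$ if $u\notin\mathcal B_k$). For $1\le p\le\infty$, $\mathcal B_k^p(\mathbb R^n)$ is the set of $u\in\mathcal D'(\mathbb R^n)$ for which there is $\chi\in\mathcal C_0^\infty(\mathbb R^n)\setminus\{0\}$ such that $y\mapsto\|u\,\tau_y\chi\|_{\mathcal B_k}$ belongs to $L^p(\mathbb R^n)$; this does not depend on the choice of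 $\chi$. Product: under the convolution hypothesis, for $v_j\in\mathcal B_{k_j}$ the product $v_1v_2\in\mathcal B_k$ is the continuous extension of the product on $\mathcal S\times\mathcal S$, i.e. $\widehat{v_1v_2}=(2\pi)^{-n}\widehat v_1*\widehat v_2$. For $u_j\in\mathcal B_{k_j}^{p_j}$ the product $u_1u_2\in\mathcal D'(\mathbb R^n)$ is defined locally: $\langle u_1u_2,\varphi\rangle=\langle(\psi u_1)(\psi u_2),\varphi\rangle$ for $\varphi\in\mathcal C_0^\infty$ and any $\psi\in\mathcal C_0^\infty$ equal to $1$ near $\operatorname{supp}\varphi$. *)

theory Defs
  imports "HOL-Analysis.Analysis" "HOL-Probability.Essential_Supremum"
begin

section \<open>Test functions, Schwartz functions and (tempered) distributions\<close>

definition partial_deriv :: "'n::finite \<Rightarrow> (real^'n \<Rightarrow> complex) \<Rightarrow> real^'n \<Rightarrow> complex" where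
  "partial_deriv i \<phi> x = frechet_derivative \<phi> (at x) (axis i 1)"

text \<open>Derivatives of higher order are indexed by the list of directions in which one differentiates,
  instead of by a multi-index; for smooth functions the order of the list is irrelevant.\<close>

definition iter_partial :: "'n::finite list \<Rightarrow> (real^'n \<Rightarrow> complex) \<Rightarrow> real^'n \<Rightarrow> complex" where
  "iter_partial \<alpha> \<phi> = foldr partial_deriv \<alpha> \<phi>"

definition smooth :: "(real^'n::finite \<Rightarrow> complex) \<Rightarrow> bool" where
  "smooth \<phi> \<longleftrightarrow> (\<forall>\<alpha> x. iter_partial \<alpha> \<phi> differentiable (at x))"

definition supp :: "(real^'n::finite \<Rightarrow> complex) \<Rightarrow> (real^'n) set" where
  "supp \<phi> = closure {x. \<phi> x \<noteq> 0}"

definition test_functions :: "(real^'n::finite \<Rightarrow> complex) set" where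
  "test_functions = {\<phi>. smooth \<phi> \<and> compact (supp \<phi>)}"

definition bracket :: "real^'n::finite \<Rightarrow> real" where
  "bracket \<xi> = sqrt (1 + (norm \<xi>)\<^sup>2)"

definition schwartz :: "(real^'n::finite \<Rightarrow> complex) set" where
  "schwartz = {\<phi>. smooth \<phi> \<and>
     (\<forall>\<alpha> (m::nat). bounded (range (\<lambda>x. bracket x ^ m * norm (iter_partial \<alpha> \<phi> x))))}"

definition linear_functional_on ::
    "(real^'n::finite \<Rightarrow> complex) set \<Rightarrow> ((real^'n \<Rightarrow> complex) \<Rightarrow> complex) \<Rightarrow> bool" where
  "linear_functional_on F u \<longleftrightarrow>
     (\<forall>\<phi>\<in>F. \<forall>\<psi>\<in>F. \<forall>a b. u (\<lambda>x. a * \<phi> x + b * \<psi> x) = a * u \<phi> + b * u \<psi>)"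

text \<open>Functionals are \<^const>\<open>extensional\<close>, so that equality in HOL is equality of functionals on the
  space of test (resp. Schwartz) functions.  Continuity is expressed through the seminorms that
  define the topology.\<close>

definition distributions :: "((real^'n::finite \<Rightarrow> complex) \<Rightarrow> complex) set" where
  "distributions = {u \<in> extensional test_functions.
     linear_functional_on test_functions u \<and>
     (\<forall>K. compact K \<longrightarrow> (\<exists>C m. \<forall>\<phi>\<in>test_functions. supp \<phi> \<subseteq> K \<longrightarrow>
        norm (u \<phi>) \<le> C * (\<Sum>\<alpha> | length \<alpha> \<le> m. SUP x. norm (iter_partial \<alpha> \<phi> x))))}"

definition tempered :: "((real^'n::finite \<Rightarrow> complex) \<Rightarrow> complex) set" where
  "tempered = {u \<in> extensional schwartz.
     linear_functional_on schwartz u \<and>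
     (\<exists>C m. \<forall>\<phi>\<in>schwartz. norm (u \<phi>) \<le>
        C * (\<Sum>\<alpha> | length \<alpha> \<le> m. SUP x. bracket x ^ m * norm (iter_partial \<alpha> \<phi> x)))}"

definition translate :: "real^'n::finite \<Rightarrow> (real^'n \<Rightarrow> complex) \<Rightarrow> real^'n \<Rightarrow> complex" where
  "translate y \<theta> = (\<lambda>x. \<theta> (x - y))"

text \<open>For a distribution \<open>u\<close> and a test function \<open>\<psi>\<close>, the compactly supported distribution \<open>\<psi> u\<close>,
  viewed as a tempered distribution (the product \<open>\<psi> \<phi>\<close> is a test function for Schwartz \<open>\<phi>\<close>).\<close>

definition localize :: "(real^'n::finite \<Rightarrow> complex) \<Rightarrow> ((real^'n \<Rightarrow> complex) \<Rightarrow> complex)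
    \<Rightarrow> (real^'n \<Rightarrow> complex) \<Rightarrow> complex" where
  "localize \<psi> u = (\<lambda>\<phi>\<in>schwartz. u (\<lambda>x. \<psi> x * \<phi> x))"

definition fourier_fun :: "(real^'n::finite \<Rightarrow> complex) \<Rightarrow> real^'n \<Rightarrow> complex" where
  "fourier_fun \<phi> \<xi> = (LINT x|lebesgue. exp (- (\<i> * complex_of_real (x \<bullet> \<xi>))) * \<phi> x)"

definition fourier :: "((real^'n::finite \<Rightarrow> complex) \<Rightarrow> complex) \<Rightarrow> (real^'n \<Rightarrow> complex) \<Rightarrow> complex" where
  "fourier u = (\<lambda>\<phi>\<in>schwartz. u (fourier_fun \<phi>))"

text \<open>\<open>u\<close> is the locally integrable function \<open>f\<close>, as an element of the space of distributions;
  such an \<open>f\<close> is unique up to null sets.\<close>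

definition given_by :: "((real^'n::finite \<Rightarrow> complex) \<Rightarrow> complex) \<Rightarrow> (real^'n \<Rightarrow> complex) \<Rightarrow> bool" where
  "given_by u f \<longleftrightarrow> (\<forall>K. compact K \<longrightarrow> f absolutely_integrable_on K) \<and>
     (\<forall>\<phi>\<in>test_functions. u \<phi> = (LINT x|lebesgue. f x * \<phi> x))"


section \<open>Weights and the spaces built from them\<close>

definition K_pol :: "(real^'n::finite \<Rightarrow> real) set" where
  "K_pol = {k. k \<in> borel_measurable lebesgue \<and> (\<forall>\<xi>. 0 < k \<xi>) \<and>
     (\<exists>C>0. \<exists>N>0. \<forall>\<xi> \<eta>. k (\<xi> + \<eta>) \<le> C * bracket \<xi> powr N * k \<eta>)}"

definition B_space :: "(real^'n::finite \<Rightarrow> real) \<Rightarrow> ((real^'n \<Rightarrow> complex) \<Rightarrow> complex) set" where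
  "B_space k = {u \<in> tempered. \<exists>f. given_by (fourier u) f \<and>
     integrable lebesgue (\<lambda>\<xi>. (k \<xi> * norm (f \<xi>))\<^sup>2)}"

definition B_norm :: "(real^'n::finite \<Rightarrow> real) \<Rightarrow> ((real^'n \<Rightarrow> complex) \<Rightarrow> complex) \<Rightarrow> ennreal" where
  "B_norm k u = (if u \<in> B_space k
     then ennreal (sqrt (LINT \<xi>|lebesgue. (k \<xi> * norm ((SOME f. given_by (fourier u) f) \<xi>))\<^sup>2))
     else \<infinity>)"

text \<open>Membership in \<open>L\<^sup>p\<close> for functions with values in \<open>[0,\<infinity>]\<close>.  Finiteness almost everywhere has to be
  required separately for finite \<open>p\<close>, because \<^const>\<open>enn2real\<close> sends \<open>\<infinity>\<close> to \<open>0\<close>.\<close>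

definition in_Lp :: "ennreal \<Rightarrow> (real^'n::finite \<Rightarrow> ennreal) \<Rightarrow> bool" where
  "in_Lp p g \<longleftrightarrow> g \<in> borel_measurable lebesgue \<and>
     (if p = \<infinity> then esssup lebesgue g < \<infinity>
      else (AE y in lebesgue. g y < \<infinity>) \<and>
        (\<integral>\<^sup>+ y. ennreal (enn2real (g y) powr enn2real p) \<partial>lebesgue) < \<infinity>)"

definition Bp_space :: "(real^'n::finite \<Rightarrow> real) \<Rightarrow> ennreal \<Rightarrow> ((real^'n \<Rightarrow> complex) \<Rightarrow> complex) set" where
  "Bp_space k p = {u \<in> distributions. \<exists>\<theta>\<in>test_functions. \<theta> \<noteq> (\<lambda>x. 0) \<and>
     in_Lp p (\<lambda>y. B_norm k (localize (translate y \<theta>) u))}"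


section \<open>Convolutions and products\<close>

definition nn_conv :: "(real^'n::finite \<Rightarrow> ennreal) \<Rightarrow> (real^'n \<Rightarrow> ennreal) \<Rightarrow> real^'n \<Rightarrow> ennreal" where
  "nn_conv f g \<xi> = (\<integral>\<^sup>+ \<eta>. f (\<xi> - \<eta>) * g \<eta> \<partial>lebesgue)"

definition conv :: "(real^'n::finite \<Rightarrow> complex) \<Rightarrow> (real^'n \<Rightarrow> complex) \<Rightarrow> real^'n \<Rightarrow> complex" where
  "conv f g \<xi> = (LINT \<eta>|lebesgue. f (\<xi> - \<eta>) * g \<eta>)"

text \<open>\<open>v\<close> is the product of the tempered distributions \<open>v1\<close> and \<open>v2\<close>: its Fourier transform is
  \<open>(2 \<pi>)\<^sup>-\<^sup>n\<close> times the convolution of theirs, the convolution integral being absolutely convergent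
  almost everywhere.\<close>

definition is_tempered_product :: "((real^'n::finite \<Rightarrow> complex) \<Rightarrow> complex)
    \<Rightarrow> ((real^'n \<Rightarrow> complex) \<Rightarrow> complex) \<Rightarrow> ((real^'n \<Rightarrow> complex) \<Rightarrow> complex) \<Rightarrow> bool" where
  "is_tempered_product v1 v2 v \<longleftrightarrow> v \<in> tempered \<and>
     (\<exists>f1 f2. given_by (fourier v1) f1 \<and> given_by (fourier v2) f2 \<and>
       (AE \<xi> in lebesgue. integrable lebesgue (\<lambda>\<eta>. f1 (\<xi> - \<eta>) * f2 \<eta>)) \<and>
       given_by (fourier v)
         (\<lambda>\<xi>. complex_of_real (1 / (2 * pi) ^ CARD('n)) * conv f1 f2 \<xi>))"

definition is_product :: "((real^'n::finite \<Rightarrow> complex) \<Rightarrow> complex)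
    \<Rightarrow> ((real^'n \<Rightarrow> complex) \<Rightarrow> complex) \<Rightarrow> ((real^'n \<Rightarrow> complex) \<Rightarrow> complex) \<Rightarrow> bool" where
  "is_product u1 u2 w \<longleftrightarrow> w \<in> distributions \<and>
     (\<forall>\<phi>\<in>test_functions. \<forall>\<psi>\<in>test_functions.
        (\<exists>U. open U \<and> supp \<phi> \<subseteq> U \<and> (\<forall>x\<in>U. \<psi> x = 1)) \<longrightarrow>
        (\<exists>v. is_tempered_product (localize \<psi> u1) (localize \<psi> u2) v \<and> w \<phi> = v \<phi>))"

text \<open>There is at most one \<open>w\<close> with \<^term>\<open>is_product u1 u2 w\<close>; where there is none, the product below is
  an unspecified functional, about which nothing can be proved.\<close>

definition dist_product :: "((real^'n::finite \<Rightarrow> complex) \<Rightarrow> complex)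
    \<Rightarrow> ((real^'n \<Rightarrow> complex) \<Rightarrow> complex) \<Rightarrow> (real^'n \<Rightarrow> complex) \<Rightarrow> complex" where
  "dist_product u1 u2 = (THE w. is_product u1 u2 w)"

end

theory Submission
  imports Defs "HOL-Computational_Algebra.Polynomial" "HOL-Probability.Probability"
begin

text \<open>
  Why the inclusion holds.  If \<open>u\<close> is a distribution and \<open>\<psi>\<close> a test function, the Fourier transform of
  the compactly supported distribution \<open>\<psi> u\<close> is the continuous function \<open>\<xi> \<mapsto> u (\<psi> e\<^sub>\<xi>)\<close> with
  \<open>e\<^sub>\<xi> x = exp (- i x \<bullet> \<xi>)\<close>; it is called \<open>loc_ft u \<psi>\<close> below.  Hence the square of the norm of \<open>\<psi> u\<close> in the
  weighted space is the integral \<open>energy k (loc_ft u \<psi>)\<close> of \<open>k\<^sup>2 \<bar>loc_ft u \<psi>\<bar>\<^sup>2\<close> (\<open>B_norm_squared\<close>).  Writing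
  \<open>f\<^sub>1 (\<xi> - \<eta>) f\<^sub>2 \<eta>\<close> as \<open>1 / (k\<^sub>1 (\<xi> - \<eta>) k\<^sub>2 \<eta>)\<close> times \<open>(k\<^sub>1 f\<^sub>1) (\<xi> - \<eta>) (k\<^sub>2 f\<^sub>2) \<eta>\<close> and using Cauchy-Schwarz in
  \<open>\<eta>\<close>, the convolution hypothesis bounds \<open>k\<^sup>2 (\<bar>f\<^sub>1\<bar> * \<bar>f\<^sub>2\<bar>)\<^sup>2\<close> by \<open>C\<^sup>2\<close> times \<open>(k\<^sub>1 f\<^sub>1)\<^sup>2 * (k\<^sub>2 f\<^sub>2)\<^sup>2\<close>, and the
  integral of a convolution is the product of the integrals (\<open>weighted_convolution\<close>).  So the product of
  two localizations has norm at most \<open>C\<close> times the product of their norms.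

  If \<open>\<theta>\<^sub>1\<close> and \<open>\<theta>\<^sub>2\<close> witness that \<open>u\<^sub>1\<close> and \<open>u\<^sub>2\<close> belong to their spaces, some translate \<open>\<theta>\<^sub>2 (x - a)\<close> is not
  annihilated by \<open>\<theta>\<^sub>1\<close>, and the product \<open>\<theta> = \<theta>\<^sub>1 \<theta>\<^sub>2(\<cdot> - a)\<close> localizes \<open>u\<^sub>1 u\<^sub>2\<close>: its translate by \<open>y\<close> times \<open>u\<^sub>1 u\<^sub>2\<close> is
  the product of the localizations of \<open>u\<^sub>1\<close> at \<open>y\<close> and of \<open>u\<^sub>2\<close> at \<open>y + a\<close>.  The local norm of the product at \<open>y\<close>
  is therefore at most \<open>C\<close> times the product of the two local norms, and Hoelder's inequality
  (\<open>in_Lp_holder\<close>) concludes.  Measurability in \<open>y\<close> is \<open>B_norm_translate_measurable\<close>.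

  What this argument presupposes is that the product exists and is unique.  Uniqueness: the Fourier
  transform of a locally defined product is prescribed as a locally integrable function, hence prescribed
  against test functions, and test functions are dense in the Schwartz space on which the Fourier transform
  is continuous (\<open>tempered_eqI\<close>).  Existence: integrate \<open>loc_ft u\<^sub>1 \<psi> * loc_ft u\<^sub>2 \<psi>\<close> against the inverse
  Fourier transform of \<open>\<phi>\<close>.  By Fubini's theorem \<open>\<phi>\<close> can be moved onto either one of the two localizers
  (\<open>pairing_eq1\<close>, \<open>pairing_eq2\<close>), so the result does not depend on \<open>\<psi>\<close> as long as \<open>\<psi> = 1\<close> on the support of
  \<open>\<phi>\<close>; the same two formulas compute the localizations of the product (\<open>loc_ft_local_product\<close>).  All this
  needs finite norms for every localizer \<open>\<psi>\<close>, whereas membership in the space only gives them for almost all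
  translates of one test function; a finite cover of the support of \<open>\<psi>\<close> and the fact that multiplication by
  a test function preserves finiteness of the weighted norm close this gap (\<open>energy_finite_everywhere\<close>).
\<close>

section \<open>Calculus of smooth functions\<close>

lemma iter_partial_Nil [simp]: "iter_partial [] f = f"
  by (simp add: iter_partial_def)

lemma iter_partial_Cons: "iter_partial (i # \<alpha>) f = partial_deriv i (iter_partial \<alpha> f)"
  by (simp add: iter_partial_def)

lemma iter_partial_append: "iter_partial (\<alpha> @ \<beta>) f = iter_partial \<alpha> (iter_partial \<beta> f)"
  by (simp add: iter_partial_def)

lemma iter_partial_snoc: "iter_partial (\<alpha> @ [i]) f = iter_partial \<alpha> (partial_deriv i f)"
  by (simp add: iter_partial_def)

lemma partial_deriv_eqI: "(f has_derivative D) (at x) \<Longrightarrow> partial_deriv i f x = D (axis i 1)"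
  unfolding partial_deriv_def using frechet_derivative_at by metis

text \<open>Smoothness asks for infinitely many derivatives, so it is proved coinductively: a family of
  differentiable functions that contains the partial derivatives of its members consists of smooth
  functions.  This replaces explicit formulas for derivatives of higher order.\<close>

lemma smooth_coinduct:
  assumes "P f"
    and step: "\<And>g. P g \<Longrightarrow> \<exists>D. (\<forall>x. (g has_derivative D x) (at x)) \<and> (\<forall>i. P (\<lambda>x. D x (axis i 1)))"
  shows "smooth f"
proof -
  have *: "P (partial_deriv i g)" if "P g" for g i
  proof -
    obtain D where D: "\<forall>x. (g has_derivative D x) (at x)" "\<forall>i. P (\<lambda>x. D x (axis i 1))"
      using step[OF \<open>P g\<close>] by blast
    then have "partial_deriv i g = (\<lambda>x. D x (axis i 1))"
      by (auto intro!: partial_deriv_eqI)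
    with D show ?thesis by simp
  qed
  have "P (iter_partial \<alpha> f)" for \<alpha>
    by (induction \<alpha>) (auto simp: iter_partial_Cons assms(1) *)
  then show ?thesis
    unfolding smooth_def differentiable_def using step by blast
qed

lemma smooth_has_derivative: "smooth f \<Longrightarrow> (f has_derivative frechet_derivative f (at x)) (at x)"
  unfolding smooth_def using frechet_derivative_works iter_partial_Nil by metis

lemma smooth_differentiable: "smooth f \<Longrightarrow> f differentiable (at x)"
  unfolding smooth_def using iter_partial_Nil by metis

lemma smooth_iter_partial: "smooth f \<Longrightarrow> smooth (iter_partial \<alpha> f)"
  unfolding smooth_def by (simp flip: iter_partial_append)

lemma smooth_partial_deriv: "smooth f \<Longrightarrow> smooth (partial_deriv i f)"
  using smooth_iter_partial[of f "[i]"] by (simp add: iter_partial_Cons)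

lemma smooth_continuous_on: "smooth f \<Longrightarrow> continuous_on S f"
  by (meson smooth_differentiable continuous_at_imp_continuous_on differentiable_imp_continuous_within)

lemma smooth_borel_measurable: "smooth f \<Longrightarrow> f \<in> borel_measurable borel"
  by (simp add: borel_measurable_continuous_onI smooth_continuous_on)

lemma partial_deriv_add:
  assumes "smooth f" "smooth g"
  shows "partial_deriv i (\<lambda>x. f x + g x) = (\<lambda>x. partial_deriv i f x + partial_deriv i g x)"
  by (rule ext, rule partial_deriv_eqI[THEN trans])
     (rule has_derivative_add[OF smooth_has_derivative[OF assms(1)] smooth_has_derivative[OF assms(2)]],
      simp add: partial_deriv_def)

lemma partial_deriv_mult:
  assumes "smooth f" "smooth g"
  shows "partial_deriv i (\<lambda>x. f x * g x) = (\<lambda>x. f x * partial_deriv i g x + partial_deriv i f x * g x)"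
  by (rule ext, rule partial_deriv_eqI[THEN trans])
     (rule has_derivative_mult[OF smooth_has_derivative[OF assms(1)] smooth_has_derivative[OF assms(2)]],
      simp add: partial_deriv_def)

lemma smooth_const: "smooth (\<lambda>x. c)"
  by (rule smooth_coinduct[where P="\<lambda>g. \<exists>c. g = (\<lambda>x. c)"])
     (auto intro!: exI[of _ "\<lambda>x h. 0"])

lemma smooth_add:
  assumes "smooth f" "smooth g" shows "smooth (\<lambda>x. f x + g x)"
proof (rule smooth_coinduct[where P="\<lambda>h. \<exists>f g. smooth f \<and> smooth g \<and> h = (\<lambda>x. f x + g x)"])
  fix h :: "real^'a \<Rightarrow> complex" assume "\<exists>f g. smooth f \<and> smooth g \<and> h = (\<lambda>x. f x + g x)"
  then obtain f g where fg: "smooth f" "smooth g" "h = (\<lambda>x. f x + g x)" by blast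
  show "\<exists>D. (\<forall>x. (h has_derivative D x) (at x)) \<and>
     (\<forall>i. \<exists>f g. smooth f \<and> smooth g \<and> (\<lambda>x. D x (axis i 1)) = (\<lambda>x. f x + g x))"
    unfolding fg(3)
    by (rule exI, intro conjI allI,
        rule has_derivative_add[OF smooth_has_derivative[OF fg(1)] smooth_has_derivative[OF fg(2)]])
       (use smooth_partial_deriv[OF fg(1)] smooth_partial_deriv[OF fg(2)] in
         \<open>auto simp: partial_deriv_def[abs_def]\<close>)
qed (use assms in blast)

text \<open>Derivatives of products are sums of products, so products alone do not form a family that is closed
  under differentiation.\<close>

inductive product_sum :: "(real^'n::finite \<Rightarrow> complex) \<Rightarrow> bool" where
  "smooth f \<Longrightarrow> smooth g \<Longrightarrow> product_sum (\<lambda>x. f x * g x)"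
| "product_sum f \<Longrightarrow> product_sum g \<Longrightarrow> product_sum (\<lambda>x. f x + g x)"

lemma smooth_mult:
  assumes "smooth f" "smooth g" shows "smooth (\<lambda>x. f x * g x)"
proof (rule smooth_coinduct[where P=product_sum])
  fix h :: "real^'a \<Rightarrow> complex" assume "product_sum h"
  then show "\<exists>D. (\<forall>x. (h has_derivative D x) (at x)) \<and> (\<forall>i. product_sum (\<lambda>x. D x (axis i 1)))"
  proof induction
    case (1 f g)
    have *: "product_sum (\<lambda>x. f x * partial_deriv i g x + partial_deriv i f x * g x)" for i
      using 1 by (intro product_sum.intros smooth_partial_deriv)
    show ?case
      by (rule exI, intro conjI allI,
          rule has_derivative_mult[OF smooth_has_derivative[OF 1(1)] smooth_has_derivative[OF 1(2)]])
         (use * in \<open>simp add: partial_deriv_def\<close>)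
  next
    case (2 f g)
    then obtain D E where D: "\<forall>x. (f has_derivative D x) (at x)" "\<forall>i. product_sum (\<lambda>x. D x (axis i 1))"
      and E: "\<forall>x. (g has_derivative E x) (at x)" "\<forall>i. product_sum (\<lambda>x. E x (axis i 1))" by blast
    show ?case
      by (rule exI[of _ "\<lambda>x h. D x h + E x h"])
         (use D E in \<open>auto intro!: has_derivative_add product_sum.intros\<close>)
  qed
qed (use assms in \<open>simp add: product_sum.intros\<close>)

lemma smooth_cmult: "smooth f \<Longrightarrow> smooth (\<lambda>x. c * f x)"
  by (intro smooth_mult smooth_const)

lemma smooth_diff: "smooth f \<Longrightarrow> smooth g \<Longrightarrow> smooth (\<lambda>x. f x - g x)"
  using smooth_add[OF _ smooth_cmult[of g "-1"], of f] by simp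

lemma smooth_sum: "(\<And>j. j \<in> J \<Longrightarrow> smooth (f j)) \<Longrightarrow> smooth (\<lambda>x. \<Sum>j\<in>J. f j x)"
  by (induction J rule: infinite_finite_induct) (auto intro: smooth_const smooth_add)

lemma smooth_prod: "(\<And>j. j \<in> J \<Longrightarrow> smooth (f j)) \<Longrightarrow> smooth (\<lambda>x. \<Prod>j\<in>J. f j x)"
  by (induction J rule: infinite_finite_induct) (auto intro: smooth_const smooth_mult)

lemma partial_deriv_const: "partial_deriv i (\<lambda>x. c) = (\<lambda>x. 0)"
  by (rule ext, rule partial_deriv_eqI[THEN trans], rule has_derivative_const) simp

lemma iter_partial_const: "iter_partial \<alpha> (\<lambda>x. c) = (\<lambda>x. if \<alpha> = [] then c else 0)"
  by (induction \<alpha>) (auto simp: iter_partial_Cons partial_deriv_const)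

lemma partial_deriv_cmult:
  assumes "smooth f" shows "partial_deriv i (\<lambda>x. c * f x) = (\<lambda>x. c * partial_deriv i f x)"
  using partial_deriv_mult[OF smooth_const assms, of i c] by (simp add: partial_deriv_const)

lemma iter_partial_add:
  assumes "smooth f" "smooth g"
  shows "iter_partial \<alpha> (\<lambda>x. f x + g x) = (\<lambda>x. iter_partial \<alpha> f x + iter_partial \<alpha> g x)"
  by (induction \<alpha>) (simp_all add: iter_partial_Cons partial_deriv_add smooth_iter_partial assms)

lemma iter_partial_cmult:
  assumes "smooth f" shows "iter_partial \<alpha> (\<lambda>x. c * f x) = (\<lambda>x. c * iter_partial \<alpha> f x)"
  by (induction \<alpha>) (simp_all add: iter_partial_Cons partial_deriv_cmult smooth_iter_partial assms)

lemma iter_partial_diff: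
  assumes "smooth f" "smooth g"
  shows "iter_partial \<alpha> (\<lambda>x. f x - g x) = (\<lambda>x. iter_partial \<alpha> f x - iter_partial \<alpha> g x)"
  using iter_partial_add[OF assms(1) smooth_cmult[OF assms(2), of "-1"], of \<alpha>]
    iter_partial_cmult[OF assms(2), of \<alpha> "-1"] by simp

lemma iter_partial_sum:
  fixes f :: "'j \<Rightarrow> real^'n::finite \<Rightarrow> complex"
  assumes "\<And>j. j \<in> J \<Longrightarrow> smooth (f j)"
  shows "iter_partial \<alpha> (\<lambda>x. \<Sum>j\<in>J. f j x) = (\<lambda>x. \<Sum>j\<in>J. iter_partial \<alpha> (f j) x)"
  using assms
  by (induction J rule: infinite_finite_induct) (simp_all add: iter_partial_add smooth_sum iter_partial_const)

lemma smooth_cnj: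
  assumes "smooth f" shows "smooth (\<lambda>x. cnj (f x))"
proof (rule smooth_coinduct[where P="\<lambda>h. \<exists>f. smooth f \<and> h = (\<lambda>x. cnj (f x))"])
  fix h :: "real^'a \<Rightarrow> complex" assume "\<exists>f. smooth f \<and> h = (\<lambda>x. cnj (f x))"
  then obtain f where f: "smooth f" "h = (\<lambda>x. cnj (f x))" by blast
  show "\<exists>D. (\<forall>x. (h has_derivative D x) (at x)) \<and>
     (\<forall>i. \<exists>f. smooth f \<and> (\<lambda>x. D x (axis i 1)) = (\<lambda>x. cnj (f x)))"
    unfolding f(2)
    by (rule exI, intro conjI allI, rule has_derivative_cnj[OF smooth_has_derivative[OF f(1)]])
       (use smooth_partial_deriv[OF f(1)] in \<open>auto simp: partial_deriv_def[abs_def]\<close>)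
qed (use assms in blast)

lemma smooth_coordinate: "smooth (\<lambda>x. complex_of_real (x $ i))"
proof (rule smooth_coinduct[where P="\<lambda>g. \<exists>c d. g = (\<lambda>x. complex_of_real (c * x $ i + d))"])
  show "\<exists>c d. (\<lambda>x::real^'a. complex_of_real (x $ i)) = (\<lambda>x. complex_of_real (c * x $ i + d))"
    by (rule exI[of _ 1], rule exI[of _ 0]) simp
  fix g :: "real^'a \<Rightarrow> complex" assume "\<exists>c d. g = (\<lambda>x. complex_of_real (c * x $ i + d))"
  then obtain c d where g: "g = (\<lambda>x. complex_of_real (c * x $ i + d))" by blast
  show "\<exists>D. (\<forall>x. (g has_derivative D x) (at x)) \<and>
     (\<forall>j. \<exists>c d. (\<lambda>x. D x (axis j 1)) = (\<lambda>x. complex_of_real (c * x $ i + d)))"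
    unfolding g
  proof (rule exI[of _ "\<lambda>x v. complex_of_real (c * v $ i)"], intro conjI allI)
    show "((\<lambda>x. complex_of_real (c * x $ i + d)) has_derivative (\<lambda>v. complex_of_real (c * v $ i))) (at x)" for x
      by (rule has_derivative_eq_rhs, (rule derivative_intros bounded_linear.has_derivative[OF bounded_linear_vec_nth])+) simp
    show "\<exists>c' d. (\<lambda>x::real^'a. complex_of_real (c * axis j 1 $ i)) = (\<lambda>x. complex_of_real (c' * x $ i + d))" for j
      by (rule exI[of _ 0], rule exI[of _ "c * axis j 1 $ i"]) auto
  qed
qed

text \<open>The kernel of the Fourier transform.  As functions of \<open>x\<close> the characters are also what a localized
  distribution is applied to in order to obtain its Fourier transform.\<close>

definition chr :: "real^'n::finite \<Rightarrow> real^'n \<Rightarrow> complex" where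
  "chr \<xi> x = exp (- (\<i> * complex_of_real (x \<bullet> \<xi>)))"

lemma chr_has_derivative:
  "((\<lambda>x. c * chr \<xi> x) has_derivative (\<lambda>v. c * (- \<i> * complex_of_real (v \<bullet> \<xi>) * chr \<xi> x))) (at x)"
  unfolding chr_def
  by (rule has_derivative_eq_rhs, rule has_derivative_mult_right,
      rule has_derivative_compose[OF _ DERIV_exp[unfolded has_field_derivative_def]],
      (rule derivative_intros)+) (auto simp: fun_eq_iff algebra_simps)

lemma smooth_chr: "smooth (chr \<xi>)"
proof (rule smooth_coinduct[where P="\<lambda>g. \<exists>c. g = (\<lambda>x. c * chr \<xi> x)"])
  show "\<exists>c. chr \<xi> = (\<lambda>x. c * chr \<xi> x)" by (rule exI[of _ 1]) simp
  fix g assume "\<exists>c. g = (\<lambda>x. c * chr \<xi> x)"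
  then obtain c where g: "g = (\<lambda>x. c * chr \<xi> x)" by blast
  show "\<exists>D. (\<forall>x. (g has_derivative D x) (at x)) \<and> (\<forall>i. \<exists>c. (\<lambda>x. D x (axis i 1)) = (\<lambda>x. c * chr \<xi> x))"
    unfolding g
  proof (rule exI, intro conjI allI, rule chr_has_derivative)
    show "\<exists>c'. (\<lambda>x. c * (- \<i> * complex_of_real (axis i 1 \<bullet> \<xi>) * chr \<xi> x)) = (\<lambda>x. c' * chr \<xi> x)" for i
      by (rule exI[of _ "c * (- \<i> * complex_of_real (axis i 1 \<bullet> \<xi>))"]) (simp add: mult.assoc)
  qed
qed

text \<open>The factors \<open>(- i \<xi>)\<^sup>\<alpha>\<close> that differentiation of a character produces.\<close>

definition monom_i :: "'n::finite list \<Rightarrow> real^'n \<Rightarrow> complex" where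
  "monom_i \<alpha> \<xi> = prod_list (map (\<lambda>i. - (\<i> * complex_of_real (\<xi> $ i))) \<alpha>)"

lemma iter_partial_chr: "iter_partial \<alpha> (chr \<xi>) = (\<lambda>x. monom_i \<alpha> \<xi> * chr \<xi> x)"
proof (induction \<alpha>)
  case Nil then show ?case by (simp add: monom_i_def)
next
  case (Cons i \<alpha>)
  show ?case unfolding iter_partial_Cons Cons
    by (rule ext, rule partial_deriv_eqI[THEN trans], rule chr_has_derivative)
       (simp add: monom_i_def inner_axis' )
qed

lemma norm_chr [simp]: "norm (chr \<xi> x) = 1"
  by (simp add: chr_def)

lemma iter_partial_affine:
  assumes f: "smooth f"
  shows "iter_partial \<alpha> (\<lambda>x. f (c *\<^sub>R x + a)) =
    (\<lambda>x. complex_of_real c ^ length \<alpha> * iter_partial \<alpha> f (c *\<^sub>R x + a))"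
    and "smooth (\<lambda>x. f (c *\<^sub>R x + a))"
proof -
  have D: "((\<lambda>x. k * g (c *\<^sub>R x + a)) has_derivative
      (\<lambda>v. k * frechet_derivative g (at (c *\<^sub>R x + a)) (c *\<^sub>R v))) (at x)" if "smooth g" for g x k
  proof -
    have "((\<lambda>x. g (c *\<^sub>R x + a)) has_derivative (\<lambda>v. frechet_derivative g (at (c *\<^sub>R x + a)) (c *\<^sub>R v))) (at x)"
      by (rule has_derivative_compose[OF _ smooth_has_derivative[OF that], of "\<lambda>x. c *\<^sub>R x + a" "\<lambda>v. c *\<^sub>R v"])
         (auto intro!: derivative_eq_intros)
    then show ?thesis by (rule has_derivative_mult_right)
  qed
  have lin: "frechet_derivative g (at y) (c *\<^sub>R v) = complex_of_real c * frechet_derivative g (at y) v"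
    if "smooth g" for g :: "real^'a \<Rightarrow> complex" and y v
    using has_derivative_bounded_linear[OF smooth_has_derivative[OF that, of y]]
    by (simp add: linear_simps scaleR_conv_of_real[where 'a=complex])
  show *: "iter_partial \<alpha> (\<lambda>x. f (c *\<^sub>R x + a)) =
    (\<lambda>x. complex_of_real c ^ length \<alpha> * iter_partial \<alpha> f (c *\<^sub>R x + a))" for \<alpha>
  proof (induction \<alpha>)
    case (Cons i \<alpha>)
    show ?case unfolding iter_partial_Cons Cons
      by (rule ext, rule partial_deriv_eqI[THEN trans], rule D[OF smooth_iter_partial[OF f]])
         (simp add: lin smooth_iter_partial f partial_deriv_def)
  qed simp
  show "smooth (\<lambda>x. f (c *\<^sub>R x + a))"
    unfolding smooth_def * differentiable_def using D[OF smooth_iter_partial[OF f]] by blast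
qed

subsection \<open>Supports\<close>

lemma notin_supp: "x \<notin> supp f \<Longrightarrow> f x = 0"
  using closure_subset[of "{x. f x \<noteq> 0}"] by (auto simp: supp_def)

lemma supp_subset_iff: "closed K \<Longrightarrow> supp f \<subseteq> K \<longleftrightarrow> (\<forall>x. x \<notin> K \<longrightarrow> f x = 0)"
  using closure_minimal[of "{x. f x \<noteq> 0}" K] closure_subset[of "{x. f x \<noteq> 0}"]
  by (auto simp: supp_def)

lemma closed_supp [simp]: "closed (supp f)"
  by (simp add: supp_def)

lemma supp_partial_deriv: "supp (partial_deriv i f) \<subseteq> supp f"
proof (subst supp_subset_iff, simp, intro allI impI)
  fix x assume x: "x \<notin> supp f"
  have "(f has_derivative (\<lambda>h. 0)) (at x)"
    by (rule has_derivative_transform_within_open[OF has_derivative_const[of 0], of "- supp f"])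
       (use x notin_supp in \<open>auto simp: open_Compl\<close>)
  then show "partial_deriv i f x = 0" by (simp add: partial_deriv_eqI)
qed

lemma supp_iter_partial: "supp (iter_partial \<alpha> f) \<subseteq> supp f"
  by (induction \<alpha>) (use supp_partial_deriv in \<open>force simp: iter_partial_Cons\<close>)+

lemma supp_mult_left: "supp (\<lambda>x. f x * g x) \<subseteq> supp f"
  by (subst supp_subset_iff) (auto simp: notin_supp)

text \<open>The quotients \<open>f / s\<^sup>n\<close> form a family closed under differentiation.  Asking that the closed support of
  \<open>f\<close> avoids the zeros of \<open>s\<close> makes the quotient vanish near these zeros, where division by zero is \<open>0\<close>.\<close>

lemma smooth_divide:
  assumes f: "smooth f" and s: "smooth s" and fs: "supp f \<subseteq> {x. s x \<noteq> 0}"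
  shows "smooth (\<lambda>x. f x / s x)"
proof (rule smooth_coinduct[where
      P="\<lambda>g. \<exists>f n. smooth f \<and> supp f \<subseteq> {x. s x \<noteq> 0} \<and> g = (\<lambda>x. f x / s x ^ n)"])
  show "\<exists>f' n. smooth f' \<and> supp f' \<subseteq> {x. s x \<noteq> 0} \<and> (\<lambda>x. f x / s x) = (\<lambda>x. f' x / s x ^ n)"
    by (rule exI[of _ f], rule exI[of _ 1]) (use assms in simp)
  fix g assume "\<exists>f n. smooth f \<and> supp f \<subseteq> {x. s x \<noteq> 0} \<and> g = (\<lambda>x. f x / s x ^ n)"
  then obtain f n where f: "smooth f" "supp f \<subseteq> {x. s x \<noteq> 0}" and g: "g = (\<lambda>x. f x / s x ^ n)" by blast
  define f' where "f' i = (\<lambda>x. partial_deriv i f x * s x - f x * (of_nat n * partial_deriv i s x))" for i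
  define D where "D x = (\<lambda>v. (frechet_derivative f (at x) v * s x
      - f x * (of_nat n * frechet_derivative s (at x) v)) / s x ^ Suc n)" for x
  have "(g has_derivative D x) (at x)" for x
  proof (cases "x \<in> supp f")
    case True
    then have s0: "s x \<noteq> 0" using f by auto
    show ?thesis unfolding g
      by (rule has_derivative_eq_rhs[OF has_derivative_divide[OF smooth_has_derivative[OF f(1)]
            has_derivative_power[OF smooth_has_derivative[OF s]]]])
         (use s0 in \<open>cases n; auto simp: D_def fun_eq_iff field_simps\<close>)+
  next
    case False
    have "(f has_derivative (\<lambda>h. 0)) (at x)"
      by (rule has_derivative_transform_within_open[OF has_derivative_const[of 0], of "- supp f"])
         (use False notin_supp in \<open>auto simp: open_Compl\<close>)
    then have "frechet_derivative f (at x) = (\<lambda>h. 0)" by (metis frechet_derivative_at)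
    then have "D x = (\<lambda>h. 0)" by (simp add: D_def False notin_supp)
    moreover have "(g has_derivative (\<lambda>h. 0)) (at x)" unfolding g
      by (rule has_derivative_transform_within_open[OF has_derivative_const[of 0], of "- supp f"])
         (use False notin_supp in \<open>auto simp: open_Compl\<close>)
    ultimately show ?thesis by simp
  qed
  moreover have "smooth (f' i)" for i
    unfolding f'_def using f(1) s by (intro smooth_diff smooth_mult smooth_const smooth_partial_deriv)
  moreover have "supp (f' i) \<subseteq> {x. s x \<noteq> 0}" for i
  proof -
    have "supp (f' i) \<subseteq> supp f"
      by (subst supp_subset_iff)
         (use notin_supp[of _ f] notin_supp[of _ "partial_deriv i f"] supp_partial_deriv[of i f] in
           \<open>auto simp: f'_def\<close>)
    with f show ?thesis by blast
  qed
  moreover have "(\<lambda>x. D x (axis i 1)) = (\<lambda>x. f' i x / s x ^ Suc n)" for i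
    by (simp add: D_def f'_def partial_deriv_def)
  ultimately show "\<exists>D. (\<forall>x. (g has_derivative D x) (at x)) \<and> (\<forall>i. \<exists>f n. smooth f \<and>
        supp f \<subseteq> {x. s x \<noteq> 0} \<and> (\<lambda>x. D x (axis i 1)) = (\<lambda>x. f x / s x ^ n))"
    by blast
qed

subsection \<open>Cutoff functions\<close>

text \<open>Functions that vanish to infinite order at \<open>0\<close>.  The polynomial factor is there because the derivatives
  of \<open>exp (- 1 / t)\<close> are of this form.\<close>

definition flat :: "real poly \<Rightarrow> real \<Rightarrow> real" where
  "flat p t = (if t > 0 then poly p (1 / t) * exp (- (1 / t)) else 0)"

lemma poly_exp_tendsto_0: "((\<lambda>y::real. poly p y * exp (- y)) \<longlongrightarrow> 0) at_top"
proof -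
  \<comment> \<open>termwise comparison of a polynomial with the exponential\<close>
  have "((\<lambda>y. \<Sum>i\<le>degree p. coeff p i * (y ^ i / exp y)) \<longlongrightarrow> (\<Sum>i\<le>degree p. coeff p i * 0)) at_top"
    by (intro tendsto_sum tendsto_mult tendsto_const tendsto_power_div_exp_0)
  then show ?thesis
    by (simp add: poly_altdef sum_distrib_right exp_minus divide_inverse mult.assoc)
qed

lemma flat_has_derivative:
  "(flat p has_real_derivative flat ([:0, 0, 1:] * (p - pderiv p)) t) (at t)"
proof -
  consider "t > 0" | "t < 0" | "t = 0" by linarith
  then show ?thesis
  proof cases
    case 1
    have "((\<lambda>t. poly p (1 / t) * exp (- (1 / t))) has_real_derivative
        flat ([:0, 0, 1:] * (p - pderiv p)) t) (at t)"
      using 1 by (auto intro!: derivative_eq_intros poly_DERIV[THEN DERIV_chain2]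
          simp: flat_def field_simps power2_eq_square)
    then show ?thesis
      by (rule has_field_derivative_transform_within_open[of _ _ _ "{0<..}"])
         (use 1 in \<open>auto simp: flat_def\<close>)
  next
    case 2
    then have z: "flat ([:0, 0, 1:] * (p - pderiv p)) t = 0" by (simp add: flat_def)
    show ?thesis unfolding z
      by (rule has_field_derivative_transform_within_open[OF DERIV_const[of 0], of "{..<0}"])
         (use 2 in \<open>auto simp: flat_def\<close>)
  next
    case 3
    \<comment> \<open>the substitution \<open>y = 1 / h\<close> turns the difference quotient into a polynomial times \<open>exp (- y)\<close>\<close>
    have "((\<lambda>h. (flat p h - flat p 0) / h) \<longlongrightarrow> 0) (at_right 0)"
    proof (rule Lim_transform_eventually)
      show "((\<lambda>h::real. poly ([:0, 1:] * p) (inverse h) * exp (- inverse h)) \<longlongrightarrow> 0) (at_right 0)"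
        by (rule filterlim_compose[OF poly_exp_tendsto_0 filterlim_inverse_at_top_right])
      show "\<forall>\<^sub>F h in at_right 0. poly ([:0, 1:] * p) (inverse h) * exp (- inverse h)
           = (flat p h - flat p 0) / h"
        by (rule eventually_at_rightI[of 0 1]) (auto simp: flat_def field_simps)
    qed
    moreover have "((\<lambda>h. (flat p h - flat p 0) / h) \<longlongrightarrow> 0) (at_left 0)"
      by (rule Lim_transform_eventually[OF tendsto_const])
         (rule eventually_at_leftI[of "-1"], auto simp: flat_def)
    ultimately have "((\<lambda>h. (flat p h - flat p 0) / h) \<longlongrightarrow> 0) (at 0)"
      by (simp add: filterlim_split_at)
    then show ?thesis using 3 by (simp add: DERIV_def flat_def)
  qed
qed

lemma smooth_flat: "smooth (\<lambda>x. complex_of_real (flat p (c * x $ i + d)))"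
proof (rule smooth_coinduct[where P="\<lambda>g. \<exists>p. g = (\<lambda>x. complex_of_real (flat p (c * x $ i + d)))"])
  fix g :: "real^'a \<Rightarrow> complex" assume "\<exists>p. g = (\<lambda>x. complex_of_real (flat p (c * x $ i + d)))"
  then obtain p where g: "g = (\<lambda>x. complex_of_real (flat p (c * x $ i + d)))" by blast
  let ?q = "[:0, 0, 1:] * (p - pderiv p)"
  have 1: "((\<lambda>x. complex_of_real (flat p (c * x $ i + d))) has_derivative
      (\<lambda>v. complex_of_real ((c * v $ i) * flat ?q (c * x $ i + d)))) (at x)" for x :: "real^'a"
    by (rule has_derivative_of_real, rule has_derivative_eq_rhs,
        rule DERIV_compose_FDERIV[OF flat_has_derivative],
        (rule derivative_intros bounded_linear.has_derivative[OF bounded_linear_vec_nth])+) simp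
  have 2: "complex_of_real ((c * axis j 1 $ i) * flat ?q t) =
      complex_of_real (flat (smult (c * axis j 1 $ i) ?q) t)" for j t
    by (simp add: flat_def mult.assoc del: mult_pCons_left)
  show "\<exists>D. (\<forall>x. (g has_derivative D x) (at x)) \<and>
     (\<forall>j. \<exists>p. (\<lambda>x. D x (axis j 1)) = (\<lambda>x. complex_of_real (flat p (c * x $ i + d))))"
    unfolding g by (intro exI conjI allI, rule 1, rule ext, rule 2)
qed blast

text \<open>A smooth transition from \<open>0\<close> (for \<open>t \<le> 0\<close>) to \<open>1\<close> (for \<open>t \<ge> 1\<close>).\<close>

definition step :: "real \<Rightarrow> real" where
  "step t = flat 1 t / (flat 1 t + flat 1 (1 - t))"

lemma step_denom_pos: "flat 1 t + flat 1 (1 - t) > 0"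
  by (cases "t > 0") (auto simp: flat_def add_pos_nonneg)

lemma step_bounds: "0 \<le> step t" "step t \<le> 1"
proof -
  have "0 \<le> flat 1 t" "0 \<le> flat 1 (1 - t)" by (auto simp: flat_def)
  then show "0 \<le> step t" "step t \<le> 1" unfolding step_def by (auto intro!: divide_le_eq_1[THEN iffD2])
qed

lemma step_0: "t \<le> 0 \<Longrightarrow> step t = 0" and step_1: "t \<ge> 1 \<Longrightarrow> step t = 1"
  by (auto simp: step_def flat_def)

lemma smooth_step: "smooth (\<lambda>x. complex_of_real (step (c * x $ i + d)))"
proof -
  have "smooth (\<lambda>x. complex_of_real (flat 1 (c * x $ i + d)) /
     (complex_of_real (flat 1 (c * x $ i + d)) + complex_of_real (flat 1 (- c * x $ i + (1 - d)))))"
  proof (intro smooth_divide smooth_add smooth_flat)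
    have "complex_of_real (flat 1 (c * x $ i + d)) + complex_of_real (flat 1 (- c * x $ i + (1 - d))) \<noteq> 0"
      for x :: "real^'a"
      unfolding of_real_add[symmetric] of_real_eq_0_iff
      using step_denom_pos[of "c * x $ i + d"] by (simp add: algebra_simps)
    then show "supp (\<lambda>x::real^'a. complex_of_real (flat 1 (c * x $ i + d))) \<subseteq> {x.
        complex_of_real (flat 1 (c * x $ i + d)) + complex_of_real (flat 1 (- c * x $ i + (1 - d))) \<noteq> 0}"
      by blast
  qed
  then show ?thesis by (simp add: step_def algebra_simps)
qed

section \<open>Test functions, Schwartz functions and distributions\<close>

lemma bracket_ge_1: "1 \<le> bracket x"
  by (simp add: bracket_def)

lemma bracket_pos [simp]: "0 < bracket x"
  using bracket_ge_1[of x] by linarith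

lemma bracket_nonneg [simp]: "0 \<le> bracket x"
  by (simp add: less_imp_le)

lemma bracket_squared: "(bracket x)\<^sup>2 = 1 + (norm x)\<^sup>2"
  by (simp add: bracket_def)

lemma norm_le_bracket: "norm x \<le> bracket x"
  by (rule power2_le_imp_le) (simp_all add: bracket_squared)

lemma bracket_mono: "norm x \<le> norm y \<Longrightarrow> bracket x \<le> bracket y"
  by (simp add: bracket_def power_mono)

lemma bracket_le: "norm x \<le> r \<Longrightarrow> bracket x \<le> sqrt (1 + r\<^sup>2)"
  by (simp add: bracket_def power_mono)

lemma bracket_uminus [simp]: "bracket (- x) = bracket x"
  by (simp add: bracket_def)

lemma continuous_bracket: "continuous_on S bracket"
  unfolding bracket_def by (intro continuous_intros)

lemma bracket_scaleR_le: "bracket (c *\<^sub>R x) \<le> (1 + \<bar>c\<bar>) * bracket x"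
proof (rule power2_le_imp_le)
  have "1 \<le> (1 + \<bar>c\<bar>)\<^sup>2" "c\<^sup>2 \<le> (1 + \<bar>c\<bar>)\<^sup>2"
    by (auto intro: one_le_power abs_le_square_iff[THEN iffD1])
  then have "1 + c\<^sup>2 * (norm x)\<^sup>2 \<le> (1 + \<bar>c\<bar>)\<^sup>2 * 1 + (1 + \<bar>c\<bar>)\<^sup>2 * (norm x)\<^sup>2"
    by (intro add_mono mult_right_mono) auto
  then show "(bracket (c *\<^sub>R x))\<^sup>2 \<le> ((1 + \<bar>c\<bar>) * bracket x)\<^sup>2"
    by (simp only: power_mult_distrib bracket_squared norm_scaleR power2_abs distrib_left mult_1_right)
qed simp

text \<open>Peetre's inequality; the constant is not optimal.\<close>

lemma bracket_add_le: "bracket (x + y) \<le> 2 * bracket x * bracket y"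
proof (rule power2_le_imp_le)
  have "(norm (x + y))\<^sup>2 \<le> (norm x + norm y)\<^sup>2"
    by (intro power_mono norm_triangle_ineq) simp
  also have "\<dots> \<le> 2 * (norm x)\<^sup>2 + 2 * (norm y)\<^sup>2"
    using zero_le_power2[of "norm x - norm y"] by (simp add: power2_sum power2_diff)
  finally have "1 + (norm (x + y))\<^sup>2 \<le> 1 + 2 * (norm x)\<^sup>2 + 2 * (norm y)\<^sup>2" by simp
  also have "\<dots> \<le> 4 * (1 + (norm x)\<^sup>2) * (1 + (norm y)\<^sup>2)"
    by (simp add: algebra_simps)
  finally show "(bracket (x + y))\<^sup>2 \<le> (2 * bracket x * bracket y)\<^sup>2"
    by (simp add: bracket_squared power_mult_distrib)
qed simp

lemma bracket_power_mono: "m \<le> n \<Longrightarrow> bracket x ^ m \<le> bracket x ^ n"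
  by (rule power_increasing) (simp_all add: bracket_ge_1)

lemma bounded_bracket_power:
  assumes "compact K" obtains B where "0 \<le> B" "\<And>x. x \<in> K \<Longrightarrow> bracket x ^ m \<le> B"
proof -
  obtain r where r: "\<And>x. x \<in> K \<Longrightarrow> norm x \<le> r"
    using compact_imp_bounded[OF assms] bounded_iff by metis
  show thesis
    by (rule that[of "sqrt (1 + r\<^sup>2) ^ m"]) (auto intro!: power_mono bracket_le r)
qed

lemma finite_multi_indices: "finite {\<alpha> :: 'n::finite list. length \<alpha> \<le> m}"
  using finite_lists_length_le[of "UNIV :: 'n set" m] by simp

subsection \<open>Test functions\<close>

lemma test_smooth: "f \<in> test_functions \<Longrightarrow> smooth f"
  and test_compact: "f \<in> test_functions \<Longrightarrow> compact (supp f)"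
  by (simp_all add: test_functions_def)

lemma testI: "smooth f \<Longrightarrow> compact K \<Longrightarrow> (\<And>x. x \<notin> K \<Longrightarrow> f x = 0) \<Longrightarrow> f \<in> test_functions"
  unfolding test_functions_def
  using supp_subset_iff[of K f] compact_imp_closed[of K] compact_Int_closed[of K "supp f"]
  by (auto simp: Int_absorb1)

lemma test_mult: "f \<in> test_functions \<Longrightarrow> smooth g \<Longrightarrow> (\<lambda>x. f x * g x) \<in> test_functions"
  by (rule testI[of _ "supp f"]) (auto simp: smooth_mult test_smooth test_compact notin_supp)

lemma test_cmult: "f \<in> test_functions \<Longrightarrow> (\<lambda>x. c * f x) \<in> test_functions"
  using test_mult[OF _ smooth_const[of c]] by (simp add: mult.commute)

lemma test_add: "f \<in> test_functions \<Longrightarrow> g \<in> test_functions \<Longrightarrow> (\<lambda>x. f x + g x) \<in> test_functions"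
  by (rule testI[of _ "supp f \<union> supp g"])
     (auto simp: smooth_add test_smooth test_compact notin_supp compact_Un)

lemma test_zero: "(\<lambda>x. 0) \<in> test_functions"
  by (rule testI[of _ "{}"]) (auto simp: smooth_const)

lemma test_sum: "(\<And>j. j \<in> J \<Longrightarrow> f j \<in> test_functions) \<Longrightarrow> (\<lambda>x. \<Sum>j\<in>J. f j x) \<in> test_functions"
  by (induction J rule: infinite_finite_induct) (auto intro: test_zero test_add)

lemma test_iter_partial: "f \<in> test_functions \<Longrightarrow> iter_partial \<alpha> f \<in> test_functions"
  by (rule testI[of _ "supp f"])
     (use supp_iter_partial[of \<alpha> f] in \<open>auto simp: smooth_iter_partial test_smooth test_compact subset_iff intro!: notin_supp\<close>)

lemma test_affine:
  assumes f: "f \<in> test_functions" and c: "c \<noteq> 0"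
  shows "(\<lambda>x. f (c *\<^sub>R x + a)) \<in> test_functions"
proof (rule testI)
  show "smooth (\<lambda>x. f (c *\<^sub>R x + a))" by (rule iter_partial_affine(2)[OF test_smooth[OF f]])
  show "compact ((\<lambda>y. (1 / c) *\<^sub>R (y - a)) ` supp f)"
    by (intro compact_continuous_image continuous_intros test_compact f)
  show "f (c *\<^sub>R x + a) = 0" if "x \<notin> (\<lambda>y. (1 / c) *\<^sub>R (y - a)) ` supp f" for x
  proof (rule notin_supp, rule notI)
    assume "c *\<^sub>R x + a \<in> supp f"
    moreover have "x = (1 / c) *\<^sub>R ((c *\<^sub>R x + a) - a)" using c by simp
    ultimately show False using that by blast
  qed
qed

lemma test_translate: "f \<in> test_functions \<Longrightarrow> translate y f \<in> test_functions"
  using test_affine[of f 1 "- y"] by (simp add: translate_def)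

lemma test_bounded:
  assumes "f \<in> test_functions" obtains B where "0 \<le> B" "\<And>x. norm (f x) \<le> B"
proof -
  have "compact (f ` supp f)"
    by (intro compact_continuous_image smooth_continuous_on test_smooth test_compact assms)
  then obtain B where B: "\<And>x. x \<in> supp f \<Longrightarrow> norm (f x) \<le> B"
    using compact_imp_bounded bounded_iff by (metis imageI)
  have "norm (f x) \<le> max 0 B" for x
    using B[of x] notin_supp[of x f] by (cases "x \<in> supp f") auto
  then show thesis by (intro that[of "max 0 B"]) auto
qed

text \<open>Equal to \<open>1\<close> on the cube \<open>[-1, 1]\<^sup>n\<close> and supported in \<open>[-2, 2]\<^sup>n\<close>.\<close>

definition plateau :: "real^'n::finite \<Rightarrow> complex" where
  "plateau x = (\<Prod>i\<in>UNIV. complex_of_real (step (1 * x $ i + 2)) * complex_of_real (step ((-1) * x $ i + 2)))"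

lemma test_plateau: "plateau \<in> test_functions"
proof (rule testI)
  show "smooth plateau"
    unfolding plateau_def[abs_def] by (intro smooth_prod smooth_mult smooth_step)
  show "compact (cbox (\<chi> i. -2) (\<chi> i. 2) :: (real^'a) set)" by simp
  show "plateau x = 0" if "x \<notin> cbox (\<chi> i. -2) (\<chi> i. 2)" for x :: "real^'a"
  proof -
    obtain i where "x $ i < -2 \<or> 2 < x $ i"
      using \<open>x \<notin> cbox (\<chi> i. -2) (\<chi> i. 2)\<close> by (force simp: mem_box_cart not_le)
    then have "complex_of_real (step (1 * x $ i + 2)) * complex_of_real (step ((-1) * x $ i + 2)) = 0"
      by (auto simp: step_0)
    then show ?thesis unfolding plateau_def by (intro prod_zero) auto
  qed
qed

lemma plateau_eq_1: "norm x \<le> 1 \<Longrightarrow> plateau x = 1"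
proof -
  assume x: "norm x \<le> 1"
  have "\<bar>x $ i\<bar> \<le> 1" for i using component_le_norm_cart[of x i] x by linarith
  then have "step (1 * x $ i + 2) = 1" "step ((-1) * x $ i + 2) = 1" for i
    by (intro step_1; smt (verit))+
  then show ?thesis by (simp add: plateau_def)
qed

definition cutoff :: "real \<Rightarrow> real^'n::finite \<Rightarrow> complex" where
  "cutoff R x = plateau ((1 / R) *\<^sub>R x)"

lemma test_cutoff: "0 < R \<Longrightarrow> cutoff R \<in> test_functions"
  using test_affine[OF test_plateau, of "1 / R" 0] by (simp add: cutoff_def[abs_def])

lemma cutoff_eq_1: "0 < R \<Longrightarrow> norm x \<le> R \<Longrightarrow> cutoff R x = 1"
  unfolding cutoff_def by (rule plateau_eq_1) (simp add: field_simps)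

lemma cutoff_near_compact:
  fixes K :: "(real^'n::finite) set"
  assumes "compact K"
  obtains R U where "0 < R" "open U" "K \<subseteq> U" "\<And>x. x \<in> U \<Longrightarrow> cutoff R x = 1"
proof -
  obtain r where r: "0 < r" "\<And>x. x \<in> K \<Longrightarrow> norm x \<le> r"
    using compact_imp_bounded[OF assms] bounded_pos by metis
  show thesis
  proof (rule that[of "r + 1" "ball 0 (r + 1)"])
    show "K \<subseteq> ball 0 (r + 1)" using r by force
  qed (use r in \<open>auto intro!: cutoff_eq_1\<close>)
qed

subsection \<open>Multipliers of slow growth\<close>

text \<open>The multipliers of the Schwartz space: test functions, characters, constants and coordinates are the
  ones that occur.\<close>

definition slow :: "(real^'n::finite \<Rightarrow> complex) \<Rightarrow> bool" where
  "slow g \<longleftrightarrow> smooth g \<and> (\<forall>\<alpha>. \<exists>C M. \<forall>x. norm (iter_partial \<alpha> g x) \<le> C * bracket x ^ M)"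

lemma slow_smooth: "slow g \<Longrightarrow> smooth g"
  by (simp add: slow_def)

lemma test_slow: "f \<in> test_functions \<Longrightarrow> slow f"
  unfolding slow_def
proof (intro conjI allI)
  fix \<alpha> assume f: "f \<in> test_functions"
  obtain B where "\<And>x. norm (iter_partial \<alpha> f x) \<le> B"
    using test_bounded[OF test_iter_partial[OF f]] by metis
  then show "\<exists>C M. \<forall>x. norm (iter_partial \<alpha> f x) \<le> C * bracket x ^ M"
    by (intro exI[of _ B] exI[of _ 0]) simp
qed (rule test_smooth)

lemma slow_chr: "slow (chr \<xi>)"
  unfolding slow_def
proof (intro conjI smooth_chr allI)
  show "\<exists>C M. \<forall>x. norm (iter_partial \<alpha> (chr \<xi>) x) \<le> C * bracket x ^ M" for \<alpha>
    by (intro exI[of _ "norm (monom_i \<alpha> \<xi>)"] exI[of _ 0]) (simp add: iter_partial_chr norm_mult)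
qed

lemma slow_const: "slow (\<lambda>x. c)"
  unfolding slow_def
proof (intro conjI smooth_const allI)
  show "\<exists>C M. \<forall>x. norm (iter_partial \<alpha> (\<lambda>x. c) x) \<le> C * bracket x ^ M" for \<alpha>
    by (intro exI[of _ "norm c"] exI[of _ 0]) (simp add: iter_partial_const)
qed

text \<open>Iterating the product rule doubles the number of terms with every derivative; no binomial
  coefficients are needed for an estimate.\<close>

lemma leibniz_pointwise:
  assumes "smooth g" "smooth \<phi>"
    and "\<And>\<beta>. length \<beta> \<le> length \<alpha> \<Longrightarrow> norm (iter_partial \<beta> g x) \<le> A"
    and "\<And>\<beta>. length \<beta> \<le> length \<alpha> \<Longrightarrow> norm (iter_partial \<beta> \<phi> x) \<le> B"
  shows "norm (iter_partial \<alpha> (\<lambda>x. g x * \<phi> x) x) \<le> 2 ^ length \<alpha> * (A * B)"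
  using assms
proof (induction \<alpha> arbitrary: g \<phi> rule: rev_induct)
  case Nil
  have "norm (g x) * norm (\<phi> x) \<le> A * B"
    using Nil(3)[of "[]"] Nil(4)[of "[]"] by (intro mult_mono) (auto intro: order_trans[OF norm_ge_zero])
  then show ?case by (simp add: norm_mult)
next
  case (snoc i \<alpha>)
  have A': "norm (iter_partial \<beta> (partial_deriv i g) x) \<le> A" if "length \<beta> \<le> length \<alpha>" for \<beta>
    using snoc.prems(3)[of "\<beta> @ [i]"] that by (simp add: iter_partial_snoc)
  have B': "norm (iter_partial \<beta> (partial_deriv i \<phi>) x) \<le> B" if "length \<beta> \<le> length \<alpha>" for \<beta>
    using snoc.prems(4)[of "\<beta> @ [i]"] that by (simp add: iter_partial_snoc)
  have "iter_partial (\<alpha> @ [i]) (\<lambda>x. g x * \<phi> x) x =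
      iter_partial \<alpha> (\<lambda>x. g x * partial_deriv i \<phi> x) x + iter_partial \<alpha> (\<lambda>x. partial_deriv i g x * \<phi> x) x"
    unfolding iter_partial_snoc partial_deriv_mult[OF snoc.prems(1,2)]
    by (subst iter_partial_add) (auto intro: smooth_mult smooth_partial_deriv snoc.prems)
  also have "norm \<dots> \<le> 2 ^ length \<alpha> * (A * B) + 2 ^ length \<alpha> * (A * B)"
    by (intro norm_triangle_mono snoc.IH smooth_partial_deriv snoc.prems(1,2) A' B')
       (use snoc.prems(3,4) in auto)
  finally show ?case by (simp add: algebra_simps)
qed

lemma leibniz_bound:
  assumes g: "slow g"
  obtains C M where "0 \<le> C"
    "\<And>\<phi> x B \<alpha>. smooth \<phi> \<Longrightarrow> (\<And>\<beta>. length \<beta> \<le> m \<Longrightarrow> norm (iter_partial \<beta> \<phi> x) \<le> B) \<Longrightarrow> length \<alpha> \<le> m \<Longrightarrow>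
     norm (iter_partial \<alpha> (\<lambda>x. g x * \<phi> x) x) \<le> C * bracket x ^ M * B"
proof -
  have "\<forall>\<alpha>. \<exists>C M. \<forall>x. norm (iter_partial \<alpha> g x) \<le> C * bracket x ^ M"
    using g by (simp add: slow_def)
  then obtain C M where CM: "\<And>\<alpha> x. norm (iter_partial \<alpha> g x) \<le> C \<alpha> * bracket x ^ M \<alpha>" by metis
  have C0: "0 \<le> C \<alpha>" for \<alpha>
    using order_trans[OF norm_ge_zero CM[of \<alpha> 0]] by (simp add: zero_le_mult_iff bracket_def)
  define C' where "C' = (\<Sum>\<alpha> | length \<alpha> \<le> m. C \<alpha>)"
  define M' where "M' = (\<Sum>\<alpha> | length \<alpha> \<le> m. M \<alpha>)"
  have C'0: "0 \<le> C'" unfolding C'_def by (intro sum_nonneg C0)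
  have gA: "norm (iter_partial \<beta> g x) \<le> C' * bracket x ^ M'" if "length \<beta> \<le> m" for \<beta> x
  proof -
    have "C \<beta> * bracket x ^ M \<beta> \<le> C' * bracket x ^ M'"
      unfolding C'_def M'_def using that C0
      by (intro mult_mono bracket_power_mono member_le_sum finite_multi_indices) (auto intro!: sum_nonneg)
    with CM[of \<beta> x] show ?thesis by linarith
  qed
  show thesis
  proof (rule that[of "2 ^ m * C'" M'])
    fix \<phi> :: "real^'a \<Rightarrow> complex" and x B and \<alpha> :: "'a list"
    assume h: "smooth \<phi>" "\<And>\<beta>. length \<beta> \<le> m \<Longrightarrow> norm (iter_partial \<beta> \<phi> x) \<le> B" "length \<alpha> \<le> m"
    have B0: "0 \<le> B" using order_trans[OF norm_ge_zero h(2)[of "[]"]] by simp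
    have "norm (iter_partial \<alpha> (\<lambda>x. g x * \<phi> x) x) \<le> 2 ^ length \<alpha> * (C' * bracket x ^ M' * B)"
      by (rule leibniz_pointwise[OF slow_smooth[OF g] h(1)]) (use gA h(2,3) in auto)
    also have "\<dots> \<le> 2 ^ m * (C' * bracket x ^ M' * B)"
      using h(3) C'0 B0 by (intro mult_right_mono power_increasing) auto
    finally show "norm (iter_partial \<alpha> (\<lambda>x. g x * \<phi> x) x) \<le> 2 ^ m * C' * bracket x ^ M' * B"
      by (simp add: mult.assoc)
  qed (use C'0 in simp)
qed

subsection \<open>Schwartz functions\<close>

text \<open>Continuity estimates are stated in terms of a common bound \<open>B\<close> for the seminorms up to order \<open>m\<close>, because
  such bounds compose more easily than sums of suprema.\<close>

definition schwartz_bound :: "nat \<Rightarrow> real \<Rightarrow> (real^'n::finite \<Rightarrow> complex) \<Rightarrow> bool" where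
  "schwartz_bound m B \<phi> \<longleftrightarrow> (\<forall>\<alpha> x. length \<alpha> \<le> m \<longrightarrow> bracket x ^ m * norm (iter_partial \<alpha> \<phi> x) \<le> B)"

lemma schwartz_boundD: "schwartz_bound m B \<phi> \<Longrightarrow> length \<alpha> \<le> m \<Longrightarrow> bracket x ^ m * norm (iter_partial \<alpha> \<phi> x) \<le> B"
  by (simp add: schwartz_bound_def)

lemma schwartz_bound_nonneg: "schwartz_bound m B \<phi> \<Longrightarrow> 0 \<le> B"
  using schwartz_boundD[of m B \<phi> "[]" 0] order_trans[of 0 "bracket 0 ^ m * norm (\<phi> 0)" B] by simp

lemma schwartz_bound_mono: "schwartz_bound m' B \<phi> \<Longrightarrow> m \<le> m' \<Longrightarrow> B \<le> B' \<Longrightarrow> schwartz_bound m B' \<phi>"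
  unfolding schwartz_bound_def by (meson bracket_power_mono mult_right_mono norm_ge_zero order_trans)

lemma schwartz_smooth: "\<phi> \<in> schwartz \<Longrightarrow> smooth \<phi>"
  by (simp add: schwartz_def)

lemma schwartz_obtain_bound:
  assumes "\<phi> \<in> schwartz" obtains B where "schwartz_bound m B \<phi>"
proof -
  have "\<exists>B. \<forall>x. bracket x ^ m * norm (iter_partial \<alpha> \<phi> x) \<le> B" for \<alpha>
  proof -
    have "bounded (range (\<lambda>x. bracket x ^ m * norm (iter_partial \<alpha> \<phi> x)))"
      using assms by (simp add: schwartz_def)
    then obtain B where "\<And>x. norm (bracket x ^ m * norm (iter_partial \<alpha> \<phi> x)) \<le> B"
      unfolding bounded_iff by blast
    then show ?thesis by (intro exI[of _ B]) (auto dest: order_trans[OF abs_ge_self] simp del: abs_mult)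
  qed
  then obtain B where B: "\<And>\<alpha> x. bracket x ^ m * norm (iter_partial \<alpha> \<phi> x) \<le> B \<alpha>" by metis
  have B0: "0 \<le> B \<alpha>" for \<alpha> :: "'a list" by (rule order_trans[OF _ B[of 0 \<alpha>]]) simp
  have "schwartz_bound m (\<Sum>\<alpha> | length \<alpha> \<le> m. B \<alpha>) \<phi>"
    unfolding schwartz_bound_def
    by (intro allI impI order_trans[OF B] member_le_sum finite_multi_indices) (auto simp: B0)
  then show thesis by (rule that)
qed

lemma schwartzI:
  assumes "smooth \<phi>" "\<And>m. \<exists>B. schwartz_bound m B \<phi>" shows "\<phi> \<in> schwartz"
  unfolding schwartz_def
proof (safe, rule assms(1))
  fix \<alpha> :: "'a list" and m
  obtain B where B: "schwartz_bound (max m (length \<alpha>)) B \<phi>" using assms(2) by blast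
  have "bracket x ^ m * norm (iter_partial \<alpha> \<phi> x) \<le> B" for x
    by (rule order_trans[OF mult_right_mono schwartz_boundD[OF B, of \<alpha> x]]) (auto intro: bracket_power_mono)
  then show "bounded (range (\<lambda>x. bracket x ^ m * norm (iter_partial \<alpha> \<phi> x)))"
    by (intro boundedI[of _ B]) auto
qed

text \<open>Continuity of an operator on the Schwartz space: seminorms of the image are bounded by seminorms of the
  argument.  The estimate is stable under composition because it is linear in \<open>B\<close>.\<close>

definition schwartz_op :: "((real^'n::finite \<Rightarrow> complex) \<Rightarrow> real^'n \<Rightarrow> complex) \<Rightarrow> bool" where
  "schwartz_op T \<longleftrightarrow> (\<forall>\<phi>\<in>schwartz. smooth (T \<phi>)) \<and>
     (\<forall>m. \<exists>C m'. \<forall>\<phi>\<in>schwartz. \<forall>B. schwartz_bound m' B \<phi> \<longrightarrow> schwartz_bound m (C * B) (T \<phi>))"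

lemma schwartz_op_bound:
  assumes "schwartz_op T"
  obtains C m' where "0 \<le> C" "\<And>\<phi> B. \<phi> \<in> schwartz \<Longrightarrow> schwartz_bound m' B \<phi> \<Longrightarrow> schwartz_bound m (C * B) (T \<phi>)"
proof -
  obtain C m' where C: "\<And>\<phi> B. \<phi> \<in> schwartz \<Longrightarrow> schwartz_bound m' B \<phi> \<Longrightarrow> schwartz_bound m (C * B) (T \<phi>)"
    using assms unfolding schwartz_op_def by metis
  have "schwartz_bound m (\<bar>C\<bar> * B) (T \<phi>)" if "\<phi> \<in> schwartz" "schwartz_bound m' B \<phi>" for \<phi> B
    using schwartz_bound_mono[OF C[OF that] order_refl, of "\<bar>C\<bar> * B"] schwartz_bound_nonneg[OF that(2)]
    by (simp add: mult_right_mono)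
  then show thesis by (intro that[of "\<bar>C\<bar>" m']) auto
qed

lemma schwartz_op_schwartz: "schwartz_op T \<Longrightarrow> \<phi> \<in> schwartz \<Longrightarrow> T \<phi> \<in> schwartz"
  by (rule schwartzI) (auto simp: schwartz_op_def, metis schwartz_obtain_bound)

lemma schwartz_op_id: "schwartz_op (\<lambda>\<phi>. \<phi>)"
  unfolding schwartz_op_def using schwartz_smooth by (metis mult_1)

lemma schwartz_op_comp:
  assumes S: "schwartz_op S" and T: "schwartz_op T" shows "schwartz_op (\<lambda>\<phi>. S (T \<phi>))"
  unfolding schwartz_op_def
proof (intro conjI ballI allI)
  show "smooth (S (T \<phi>))" if "\<phi> \<in> schwartz" for \<phi>
    using schwartz_smooth schwartz_op_schwartz S T that by blast
  fix m
  obtain C1 m1 where "0 \<le> C1" and 1: "\<And>\<phi> B. \<phi> \<in> schwartz \<Longrightarrow> schwartz_bound m1 B \<phi> \<Longrightarrow> schwartz_bound m (C1 * B) (S \<phi>)"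
    using schwartz_op_bound[OF S, of m] that by blast
  obtain C2 m2 where "0 \<le> C2" and 2: "\<And>\<phi> B. \<phi> \<in> schwartz \<Longrightarrow> schwartz_bound m2 B \<phi> \<Longrightarrow> schwartz_bound m1 (C2 * B) (T \<phi>)"
    using schwartz_op_bound[OF T, of m1] that by blast
  show "\<exists>C m'. \<forall>\<phi>\<in>schwartz. \<forall>B. schwartz_bound m' B \<phi> \<longrightarrow> schwartz_bound m (C * B) (S (T \<phi>))"
  proof (intro exI[of _ "C1 * C2"] exI[of _ m2] ballI allI impI)
    fix \<phi> :: "real^'a \<Rightarrow> complex" and B assume \<phi>: "\<phi> \<in> schwartz" and B: "schwartz_bound m2 B \<phi>"
    show "schwartz_bound m (C1 * C2 * B) (S (T \<phi>))"
      using 1[OF schwartz_op_schwartz[OF T \<phi>] 2[OF \<phi> B]] by (simp add: mult.assoc)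
  qed
qed

lemma schwartz_op_add:
  assumes S: "schwartz_op S" and T: "schwartz_op T" shows "schwartz_op (\<lambda>\<phi> x. S \<phi> x + T \<phi> x)"
  unfolding schwartz_op_def
proof (intro conjI ballI allI)
  show "smooth (\<lambda>x. S \<phi> x + T \<phi> x)" if "\<phi> \<in> schwartz" for \<phi>
    using S T that by (auto simp: schwartz_op_def intro: smooth_add)
  fix m
  obtain C1 m1 where "0 \<le> C1" and 1: "\<And>\<phi> B. \<phi> \<in> schwartz \<Longrightarrow> schwartz_bound m1 B \<phi> \<Longrightarrow> schwartz_bound m (C1 * B) (S \<phi>)"
    using schwartz_op_bound[OF S, of m] that by blast
  obtain C2 m2 where "0 \<le> C2" and 2: "\<And>\<phi> B. \<phi> \<in> schwartz \<Longrightarrow> schwartz_bound m2 B \<phi> \<Longrightarrow> schwartz_bound m (C2 * B) (T \<phi>)"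
    using schwartz_op_bound[OF T, of m] that by blast
  show "\<exists>C m'. \<forall>\<phi>\<in>schwartz. \<forall>B. schwartz_bound m' B \<phi> \<longrightarrow> schwartz_bound m (C * B) (\<lambda>x. S \<phi> x + T \<phi> x)"
  proof (intro exI[of _ "C1 + C2"] exI[of _ "max m1 m2"] ballI allI impI)
    fix \<phi> :: "real^'a \<Rightarrow> complex" and B assume \<phi>: "\<phi> \<in> schwartz" and B: "schwartz_bound (max m1 m2) B \<phi>"
    have s: "smooth (S \<phi>)" "smooth (T \<phi>)" using S T \<phi> by (auto simp: schwartz_op_def)
    have a: "schwartz_bound m (C1 * B) (S \<phi>)" "schwartz_bound m (C2 * B) (T \<phi>)"
      by (rule 1[OF \<phi> schwartz_bound_mono[OF B]] 2[OF \<phi> schwartz_bound_mono[OF B]]; simp)+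
    show "schwartz_bound m ((C1 + C2) * B) (\<lambda>x. S \<phi> x + T \<phi> x)"
      unfolding schwartz_bound_def
    proof (intro allI impI)
      fix \<alpha> :: "'a list" and x assume "length \<alpha> \<le> m"
      have "bracket x ^ m * norm (iter_partial \<alpha> (S \<phi>) x + iter_partial \<alpha> (T \<phi>) x)
         \<le> bracket x ^ m * norm (iter_partial \<alpha> (S \<phi>) x) + bracket x ^ m * norm (iter_partial \<alpha> (T \<phi>) x)"
        unfolding distrib_left[symmetric] by (intro mult_left_mono norm_triangle_ineq) simp
      also have "\<dots> \<le> C1 * B + C2 * B"
        by (intro add_mono schwartz_boundD a \<open>length \<alpha> \<le> m\<close>)
      finally show "bracket x ^ m * norm (iter_partial \<alpha> (\<lambda>x. S \<phi> x + T \<phi> x) x) \<le> (C1 + C2) * B"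
        by (simp add: iter_partial_add s algebra_simps)
    qed
  qed
qed

lemma schwartz_op_mult:
  assumes "slow g" shows "schwartz_op (\<lambda>\<phi> x. g x * \<phi> x)"
  unfolding schwartz_op_def
proof (intro conjI ballI allI)
  show "smooth (\<lambda>x. g x * \<phi> x)" if "\<phi> \<in> schwartz" for \<phi>
    using that assms by (intro smooth_mult slow_smooth schwartz_smooth)
  fix m
  obtain C M where CM: "0 \<le> C"
    "\<And>\<phi> x B \<alpha>. smooth \<phi> \<Longrightarrow> (\<And>\<beta>. length \<beta> \<le> m \<Longrightarrow> norm (iter_partial \<beta> \<phi> x) \<le> B) \<Longrightarrow> length \<alpha> \<le> m \<Longrightarrow>
     norm (iter_partial \<alpha> (\<lambda>x. g x * \<phi> x) x) \<le> C * bracket x ^ M * B"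
    using leibniz_bound[OF assms, of m] that by blast
  show "\<exists>C m'. \<forall>\<phi>\<in>schwartz. \<forall>B. schwartz_bound m' B \<phi> \<longrightarrow> schwartz_bound m (C * B) (\<lambda>x. g x * \<phi> x)"
  proof (intro exI[of _ C] exI[of _ "m + M"] ballI allI impI)
    fix \<phi> :: "real^'a \<Rightarrow> complex" and B assume \<phi>: "\<phi> \<in> schwartz" and B: "schwartz_bound (m + M) B \<phi>"
    show "schwartz_bound m (C * B) (\<lambda>x. g x * \<phi> x)"
      unfolding schwartz_bound_def
    proof (intro allI impI)
      fix \<alpha> :: "'a list" and x assume \<alpha>: "length \<alpha> \<le> m"
      have "norm (iter_partial \<alpha> (\<lambda>x. g x * \<phi> x) x) \<le> C * bracket x ^ M * (B / bracket x ^ (m + M))"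
      proof (rule CM(2)[OF schwartz_smooth[OF \<phi>] _ \<alpha>])
        fix \<beta> :: "'a list" assume "length \<beta> \<le> m"
        then have "bracket x ^ (m + M) * norm (iter_partial \<beta> \<phi> x) \<le> B" by (intro schwartz_boundD[OF B]) simp
        then show "norm (iter_partial \<beta> \<phi> x) \<le> B / bracket x ^ (m + M)"
          by (simp add: pos_le_divide_eq mult.commute)
      qed
      also have "\<dots> = C * B / bracket x ^ m"
        using less_imp_neq[OF bracket_pos[of x]] by (simp add: power_add)
      finally show "bracket x ^ m * norm (iter_partial \<alpha> (\<lambda>x. g x * \<phi> x) x) \<le> C * B"
        by (simp add: pos_le_divide_eq mult.commute)
    qed
  qed
qed

lemma schwartz_op_partial_deriv: "schwartz_op (partial_deriv i)"
  unfolding schwartz_op_def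
proof (intro conjI ballI allI)
  fix m
  show "\<exists>C m'. \<forall>\<phi>\<in>schwartz. \<forall>B. schwartz_bound m' B \<phi> \<longrightarrow> schwartz_bound m (C * B) (partial_deriv i \<phi>)"
  proof (intro exI[of _ "1::real"] exI[of _ "Suc m"] ballI allI impI)
    fix \<phi> :: "real^'a \<Rightarrow> complex" and B assume B: "schwartz_bound (Suc m) B \<phi>"
    show "schwartz_bound m (1 * B) (partial_deriv i \<phi>)"
      unfolding schwartz_bound_def
    proof (intro allI impI)
      fix \<alpha> :: "'a list" and x assume "length \<alpha> \<le> m"
      then have "bracket x ^ Suc m * norm (iter_partial (\<alpha> @ [i]) \<phi> x) \<le> B" by (intro schwartz_boundD[OF B]) simp
      then show "bracket x ^ m * norm (iter_partial \<alpha> (partial_deriv i \<phi>) x) \<le> 1 * B"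
        unfolding iter_partial_snoc
        by (intro order_trans[OF mult_right_mono[OF bracket_power_mono[of m "Suc m"]]]) auto
    qed
  qed
qed (simp add: smooth_partial_deriv schwartz_smooth)

lemma test_schwartz: "f \<in> test_functions \<Longrightarrow> f \<in> schwartz"
proof (rule schwartzI)
  fix m assume f: "f \<in> test_functions"
  obtain K where K: "0 \<le> K" "\<And>x. x \<in> supp f \<Longrightarrow> bracket x ^ m \<le> K"
    using bounded_bracket_power[OF test_compact[OF f]] by metis
  have "\<exists>b\<ge>0. \<forall>x. norm (iter_partial \<alpha> f x) \<le> b" for \<alpha>
    using test_bounded[OF test_iter_partial[OF f]] by metis
  then obtain b where b: "\<And>\<alpha>. 0 \<le> b \<alpha>" "\<And>\<alpha> x. norm (iter_partial \<alpha> f x) \<le> b \<alpha>" by metis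
  have "bracket x ^ m * norm (iter_partial \<alpha> f x) \<le> K * (\<Sum>\<alpha> | length \<alpha> \<le> m. b \<alpha>)" if "length \<alpha> \<le> m" for \<alpha> x
  proof (cases "x \<in> supp f")
    case True
    then show ?thesis
      using that by (intro mult_mono K order_trans[OF b(2)] member_le_sum finite_multi_indices) (auto simp: b)
  next
    case False
    then have "iter_partial \<alpha> f x = 0" using supp_iter_partial notin_supp by blast
    then show ?thesis by (simp add: K b sum_nonneg)
  qed
  then show "\<exists>B. schwartz_bound m B f" unfolding schwartz_bound_def by blast
qed (rule test_smooth)

lemma schwartz_cmult: "\<phi> \<in> schwartz \<Longrightarrow> (\<lambda>x. c * \<phi> x) \<in> schwartz"
  by (rule schwartz_op_schwartz[OF schwartz_op_mult[OF slow_const]])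

lemma schwartz_add: "\<phi> \<in> schwartz \<Longrightarrow> \<psi> \<in> schwartz \<Longrightarrow> (\<lambda>x. \<phi> x + \<psi> x) \<in> schwartz"
proof (rule schwartzI)
  fix m assume h: "\<phi> \<in> schwartz" "\<psi> \<in> schwartz"
  obtain B where "schwartz_bound m B \<phi>" using schwartz_obtain_bound[OF h(1)] .
  moreover obtain B' where "schwartz_bound m B' \<psi>" using schwartz_obtain_bound[OF h(2)] .
  ultimately have "schwartz_bound m (B + B') (\<lambda>x. \<phi> x + \<psi> x)"
    unfolding schwartz_bound_def iter_partial_add[OF h[THEN schwartz_smooth]]
    by (auto intro!: order_trans[OF mult_left_mono[OF norm_triangle_ineq]] add_mono simp: distrib_left)
  then show "\<exists>B. schwartz_bound m B (\<lambda>x. \<phi> x + \<psi> x)" ..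
qed (intro smooth_add schwartz_smooth)

lemma schwartz_diff: "\<phi> \<in> schwartz \<Longrightarrow> \<psi> \<in> schwartz \<Longrightarrow> (\<lambda>x. \<phi> x - \<psi> x) \<in> schwartz"
  using schwartz_add[OF _ schwartz_cmult[of \<psi> "-1"], of \<phi>] by simp

lemma schwartz_affine:
  assumes \<phi>: "\<phi> \<in> schwartz" and c: "c \<noteq> 0"
  shows "(\<lambda>x. \<phi> (c *\<^sub>R x + a)) \<in> schwartz"
proof (rule schwartzI)
  show "smooth (\<lambda>x. \<phi> (c *\<^sub>R x + a))" by (rule iter_partial_affine(2)[OF schwartz_smooth[OF \<phi>]])
  fix m
  obtain B where B: "schwartz_bound m B \<phi>" using schwartz_obtain_bound[OF \<phi>] .
  define D where "D = (1 + \<bar>1 / c\<bar>) * 2 * bracket a"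
  have D: "bracket x \<le> D * bracket (c *\<^sub>R x + a)" for x
  proof -
    have "bracket x = bracket ((1 / c) *\<^sub>R ((c *\<^sub>R x + a) + (- a)))" using c by simp
    also have "\<dots> \<le> (1 + \<bar>1 / c\<bar>) * bracket ((c *\<^sub>R x + a) + (- a))" by (rule bracket_scaleR_le)
    also have "\<dots> \<le> (1 + \<bar>1 / c\<bar>) * (2 * bracket (c *\<^sub>R x + a) * bracket (- a))"
      by (intro mult_left_mono bracket_add_le) simp
    finally show ?thesis by (simp only: D_def mult_ac bracket_uminus)
  qed
  have D0: "0 \<le> D" by (simp add: D_def)
  have "schwartz_bound m (D ^ m * (1 + \<bar>c\<bar>) ^ m * B) (\<lambda>x. \<phi> (c *\<^sub>R x + a))"
    unfolding schwartz_bound_def iter_partial_affine(1)[OF schwartz_smooth[OF \<phi>]]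
  proof (intro allI impI)
    fix \<alpha> :: "'a list" and x assume \<alpha>: "length \<alpha> \<le> m"
    have "bracket x ^ m * norm (complex_of_real c ^ length \<alpha> * iter_partial \<alpha> \<phi> (c *\<^sub>R x + a)) =
      \<bar>c\<bar> ^ length \<alpha> * (bracket x ^ m * norm (iter_partial \<alpha> \<phi> (c *\<^sub>R x + a)))"
      by (simp add: norm_mult norm_power)
    also have "\<dots> \<le> (1 + \<bar>c\<bar>) ^ m * ((D * bracket (c *\<^sub>R x + a)) ^ m * norm (iter_partial \<alpha> \<phi> (c *\<^sub>R x + a)))"
    proof (intro mult_mono mult_right_mono power_mono D)
      have "\<bar>c\<bar> ^ length \<alpha> \<le> (1 + \<bar>c\<bar>) ^ length \<alpha>" by (rule power_mono) auto
      also have "\<dots> \<le> (1 + \<bar>c\<bar>) ^ m" using \<alpha> by (intro power_increasing) auto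
      finally show "\<bar>c\<bar> ^ length \<alpha> \<le> (1 + \<bar>c\<bar>) ^ m" .
    qed (auto simp: D0)
    also have "\<dots> = (1 + \<bar>c\<bar>) ^ m * D ^ m * (bracket (c *\<^sub>R x + a) ^ m * norm (iter_partial \<alpha> \<phi> (c *\<^sub>R x + a)))"
      by (simp add: power_mult_distrib mult_ac)
    also have "\<dots> \<le> (1 + \<bar>c\<bar>) ^ m * D ^ m * B"
      using D0 by (intro mult_left_mono schwartz_boundD[OF B] \<alpha>) auto
    finally show "bracket x ^ m * norm (complex_of_real c ^ length \<alpha> * iter_partial \<alpha> \<phi> (c *\<^sub>R x + a))
        \<le> D ^ m * (1 + \<bar>c\<bar>) ^ m * B" by (simp add: mult_ac)
  qed
  then show "\<exists>B. schwartz_bound m B (\<lambda>x. \<phi> (c *\<^sub>R x + a))" ..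
qed

subsection \<open>Distributions\<close>

lemma distribution_lincomb:
  "u \<in> distributions \<Longrightarrow> f \<in> test_functions \<Longrightarrow> g \<in> test_functions \<Longrightarrow>
    u (\<lambda>x. a * f x + b * g x) = a * u f + b * u g"
  by (simp add: distributions_def linear_functional_on_def)

lemma distribution_add:
  "u \<in> distributions \<Longrightarrow> f \<in> test_functions \<Longrightarrow> g \<in> test_functions \<Longrightarrow> u (\<lambda>x. f x + g x) = u f + u g"
  using distribution_lincomb[of u f g 1 1] by simp

lemma distribution_diff:
  "u \<in> distributions \<Longrightarrow> f \<in> test_functions \<Longrightarrow> g \<in> test_functions \<Longrightarrow> u (\<lambda>x. f x - g x) = u f - u g"
  using distribution_lincomb[of u f g 1 "-1"] by simp

lemma distribution_cmult:
  "u \<in> distributions \<Longrightarrow> f \<in> test_functions \<Longrightarrow> u (\<lambda>x. a * f x) = a * u f"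
  using distribution_lincomb[of u f f a 0] by simp

lemma distribution_sum:
  "u \<in> distributions \<Longrightarrow> (\<And>j. j \<in> J \<Longrightarrow> f j \<in> test_functions) \<Longrightarrow>
    u (\<lambda>x. \<Sum>j\<in>J. f j x) = (\<Sum>j\<in>J. u (f j))"
proof (induction J rule: infinite_finite_induct)
  case empty
  then show ?case using distribution_cmult[OF _ test_zero, of u 0] by simp
next
  case infinite
  then show ?case using distribution_cmult[OF _ test_zero, of u 0] by simp
next
  case (insert j J)
  have "u (\<lambda>x. f j x + (\<Sum>j\<in>J. f j x)) = u (f j) + u (\<lambda>x. \<Sum>j\<in>J. f j x)"
    by (intro distribution_add test_sum insert.prems) auto
  then show ?case using insert by simp
qed

lemma tempered_lincomb:
  "v \<in> tempered \<Longrightarrow> f \<in> schwartz \<Longrightarrow> g \<in> schwartz \<Longrightarrow> v (\<lambda>x. a * f x + b * g x) = a * v f + b * v g"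
  by (simp add: tempered_def linear_functional_on_def)

lemma distribution_bound:
  assumes u: "u \<in> distributions" and K: "compact K"
  obtains C m where "0 \<le> C" "\<And>\<phi> B. \<phi> \<in> test_functions \<Longrightarrow> supp \<phi> \<subseteq> K \<Longrightarrow>
     (\<And>\<alpha> x. length \<alpha> \<le> m \<Longrightarrow> norm (iter_partial \<alpha> \<phi> x) \<le> B) \<Longrightarrow> norm (u \<phi>) \<le> C * B"
proof -
  have "\<exists>C m. \<forall>\<phi>\<in>test_functions. supp \<phi> \<subseteq> K \<longrightarrow>
        norm (u \<phi>) \<le> C * (\<Sum>\<alpha> | length \<alpha> \<le> m. SUP x. norm (iter_partial \<alpha> \<phi> x))"
    using u K by (simp add: distributions_def)
  then obtain C m where Cm: "\<And>\<phi>. \<phi> \<in> test_functions \<Longrightarrow> supp \<phi> \<subseteq> K \<Longrightarrow>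
     norm (u \<phi>) \<le> C * (\<Sum>\<alpha> | length \<alpha> \<le> m. SUP x. norm (iter_partial \<alpha> \<phi> x))"
    using that by meson
  define N where "N = card {\<alpha> :: 'a list. length \<alpha> \<le> m}"
  show thesis
  proof (rule that[of "\<bar>C\<bar> * real N"])
    fix \<phi> :: "real^'a \<Rightarrow> complex" and B
    assume \<phi>: "\<phi> \<in> test_functions" "supp \<phi> \<subseteq> K"
      and B: "\<And>\<alpha> x. length \<alpha> \<le> m \<Longrightarrow> norm (iter_partial \<alpha> \<phi> x) \<le> B"
    have s: "0 \<le> (SUP x. norm (iter_partial \<alpha> \<phi> x))" if "length \<alpha> \<le> m" for \<alpha>
      by (rule cSUP_upper2[of _ _ undefined]) (use B[OF that] in \<open>auto intro!: bdd_aboveI2\<close>)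
    have "norm (u \<phi>) \<le> C * (\<Sum>\<alpha> | length \<alpha> \<le> m. SUP x. norm (iter_partial \<alpha> \<phi> x))"
      by (rule Cm[OF \<phi>])
    also have "\<dots> \<le> \<bar>C\<bar> * (\<Sum>\<alpha> | length \<alpha> \<le> m. SUP x. norm (iter_partial \<alpha> \<phi> x))"
      by (intro mult_right_mono sum_nonneg) (auto simp: s)
    also have "\<dots> \<le> \<bar>C\<bar> * (\<Sum>\<alpha> :: 'a list | length \<alpha> \<le> m. B)"
      by (intro mult_left_mono sum_mono cSUP_least) (auto simp: B)
    finally show "norm (u \<phi>) \<le> \<bar>C\<bar> * real N * B" by (simp add: N_def)
  qed simp
qed

lemma distributionI:
  assumes "u \<in> extensional test_functions" "linear_functional_on test_functions u"
    and bd: "\<And>K. compact K \<Longrightarrow> \<exists>C m. 0 \<le> C \<and> (\<forall>\<phi> B. \<phi> \<in> test_functions \<longrightarrow> supp \<phi> \<subseteq> K \<longrightarrow>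
     (\<forall>\<alpha> x. length \<alpha> \<le> m \<longrightarrow> norm (iter_partial \<alpha> \<phi> x) \<le> B) \<longrightarrow> norm (u \<phi>) \<le> C * B)"
  shows "u \<in> distributions"
  unfolding distributions_def
proof (intro CollectI conjI allI impI assms(1,2))
  fix K :: "(real^'a) set" assume "compact K"
  from bd[OF this] obtain C m where C: "0 \<le> C" and Cm: "\<And>\<phi> B. \<phi> \<in> test_functions \<Longrightarrow> supp \<phi> \<subseteq> K \<Longrightarrow>
     (\<forall>\<alpha> x. length \<alpha> \<le> m \<longrightarrow> norm (iter_partial \<alpha> \<phi> x) \<le> B) \<Longrightarrow> norm (u \<phi>) \<le> C * B"
    using that by meson
  show "\<exists>C m. \<forall>\<phi>\<in>test_functions. supp \<phi> \<subseteq> K \<longrightarrow>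
        norm (u \<phi>) \<le> C * (\<Sum>\<alpha> | length \<alpha> \<le> m. SUP x. norm (iter_partial \<alpha> \<phi> x))"
  proof (intro exI[of _ C] exI[of _ m] ballI impI Cm allI)
    fix \<phi> :: "real^'a \<Rightarrow> complex" and \<alpha> :: "'a list" and x
    assume \<phi>: "\<phi> \<in> test_functions" and \<alpha>: "length \<alpha> \<le> m"
    have bdd: "bdd_above (range (\<lambda>x. norm (iter_partial \<beta> \<phi> x)))" for \<beta>
      using test_bounded[OF test_iter_partial[OF \<phi>]] by (metis bdd_aboveI2)
    have "norm (iter_partial \<alpha> \<phi> x) \<le> (SUP x. norm (iter_partial \<alpha> \<phi> x))"
      by (rule cSUP_upper) (auto simp: bdd)
    also have "\<dots> \<le> (\<Sum>\<alpha> | length \<alpha> \<le> m. SUP x. norm (iter_partial \<alpha> \<phi> x))"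
      by (rule member_le_sum[of \<alpha>])
         (use \<alpha> finite_multi_indices in \<open>auto intro!: cSUP_upper2[OF bdd, of undefined]\<close>)
    finally show "norm (iter_partial \<alpha> \<phi> x) \<le> (\<Sum>\<alpha> | length \<alpha> \<le> m. SUP x. norm (iter_partial \<alpha> \<phi> x))" .
  qed
qed

lemma tempered_bound:
  assumes v: "v \<in> tempered"
  obtains C m where "0 \<le> C" "\<And>\<phi> B. \<phi> \<in> schwartz \<Longrightarrow> schwartz_bound m B \<phi> \<Longrightarrow> norm (v \<phi>) \<le> C * B"
proof -
  have "\<exists>C m. \<forall>\<phi>\<in>schwartz. norm (v \<phi>) \<le>
      C * (\<Sum>\<alpha> | length \<alpha> \<le> m. SUP x. bracket x ^ m * norm (iter_partial \<alpha> \<phi> x))"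
    using v by (simp add: tempered_def)
  then obtain C m where Cm: "\<And>\<phi>. \<phi> \<in> schwartz \<Longrightarrow>
     norm (v \<phi>) \<le> C * (\<Sum>\<alpha> | length \<alpha> \<le> m. SUP x. bracket x ^ m * norm (iter_partial \<alpha> \<phi> x))"
    using that by meson
  define N where "N = card {\<alpha> :: 'a list. length \<alpha> \<le> m}"
  show thesis
  proof (rule that[of "\<bar>C\<bar> * real N"])
    fix \<phi> :: "real^'a \<Rightarrow> complex" and B
    assume \<phi>: "\<phi> \<in> schwartz" and B: "schwartz_bound m B \<phi>"
    have s: "0 \<le> (SUP x. bracket x ^ m * norm (iter_partial \<alpha> \<phi> x))" if "length \<alpha> \<le> m" for \<alpha>
      by (rule cSUP_upper2[of _ _ undefined]) (use schwartz_boundD[OF B that] in \<open>auto intro!: bdd_aboveI2\<close>)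
    have "norm (v \<phi>) \<le> C * (\<Sum>\<alpha> | length \<alpha> \<le> m. SUP x. bracket x ^ m * norm (iter_partial \<alpha> \<phi> x))"
      by (rule Cm[OF \<phi>])
    also have "\<dots> \<le> \<bar>C\<bar> * (\<Sum>\<alpha> | length \<alpha> \<le> m. SUP x. bracket x ^ m * norm (iter_partial \<alpha> \<phi> x))"
      by (intro mult_right_mono sum_nonneg) (auto simp: s)
    also have "\<dots> \<le> \<bar>C\<bar> * (\<Sum>\<alpha> :: 'a list | length \<alpha> \<le> m. B)"
      by (intro mult_left_mono sum_mono cSUP_least) (auto intro: schwartz_boundD[OF B])
    finally show "norm (v \<phi>) \<le> \<bar>C\<bar> * real N * B" by (simp add: N_def)
  qed simp
qed

lemma temperedI:
  assumes "v \<in> extensional schwartz" "linear_functional_on schwartz v"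
    and C: "0 \<le> C" and Cm: "\<And>\<phi> B. \<phi> \<in> schwartz \<Longrightarrow> schwartz_bound m B \<phi> \<Longrightarrow> norm (v \<phi>) \<le> C * B"
  shows "v \<in> tempered"
  unfolding tempered_def
proof (intro CollectI conjI assms(1,2) exI[of _ C] exI[of _ m] ballI)
  fix \<phi> :: "real^'a \<Rightarrow> complex" assume \<phi>: "\<phi> \<in> schwartz"
  show "norm (v \<phi>) \<le> C * (\<Sum>\<alpha> | length \<alpha> \<le> m. SUP x. bracket x ^ m * norm (iter_partial \<alpha> \<phi> x))"
  proof (rule Cm[OF \<phi>], unfold schwartz_bound_def, intro allI impI)
    fix \<alpha> :: "'a list" and x assume \<alpha>: "length \<alpha> \<le> m"
    have bdd: "bdd_above (range (\<lambda>x. bracket x ^ m * norm (iter_partial \<beta> \<phi> x)))" for \<beta>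
      using \<phi> by (simp add: schwartz_def bounded_imp_bdd_above)
    have "bracket x ^ m * norm (iter_partial \<alpha> \<phi> x) \<le> (SUP x. bracket x ^ m * norm (iter_partial \<alpha> \<phi> x))"
      by (rule cSUP_upper) (auto simp: bdd)
    also have "\<dots> \<le> (\<Sum>\<alpha> | length \<alpha> \<le> m. SUP x. bracket x ^ m * norm (iter_partial \<alpha> \<phi> x))"
      by (rule member_le_sum[of \<alpha>])
         (use \<alpha> finite_multi_indices in \<open>auto intro!: cSUP_upper2[OF bdd, of undefined]\<close>)
    finally show "bracket x ^ m * norm (iter_partial \<alpha> \<phi> x)
       \<le> (\<Sum>\<alpha> | length \<alpha> \<le> m. SUP x. bracket x ^ m * norm (iter_partial \<alpha> \<phi> x))" .
  qed
qed

text \<open>A localized distribution is continuous with respect to the derivatives of finitely many orders on the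
  support of the localizer.  In contrast to the continuity of \<open>u\<close> itself, this applies to all smooth
  functions, in particular to characters.\<close>

lemma localized_bound:
  assumes u: "u \<in> distributions" and \<psi>: "\<psi> \<in> test_functions"
  obtains C m where "0 \<le> C" "\<And>h B. smooth h \<Longrightarrow> 0 \<le> B \<Longrightarrow>
     (\<And>\<alpha> x. length \<alpha> \<le> m \<Longrightarrow> x \<in> supp \<psi> \<Longrightarrow> norm (iter_partial \<alpha> h x) \<le> B) \<Longrightarrow> norm (u (\<lambda>x. \<psi> x * h x)) \<le> C * B"
proof -
  obtain C m where Cm: "0 \<le> C" "\<And>\<phi> B. \<phi> \<in> test_functions \<Longrightarrow> supp \<phi> \<subseteq> supp \<psi> \<Longrightarrow>
     (\<And>\<alpha> x. length \<alpha> \<le> m \<Longrightarrow> norm (iter_partial \<alpha> \<phi> x) \<le> B) \<Longrightarrow> norm (u \<phi>) \<le> C * B"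
    using distribution_bound[OF u test_compact[OF \<psi>]] that by blast
  obtain D M where D: "0 \<le> D"
    "\<And>\<phi> x B \<alpha>. smooth \<phi> \<Longrightarrow> (\<And>\<beta>. length \<beta> \<le> m \<Longrightarrow> norm (iter_partial \<beta> \<phi> x) \<le> B) \<Longrightarrow> length \<alpha> \<le> m \<Longrightarrow>
     norm (iter_partial \<alpha> (\<lambda>x. \<psi> x * \<phi> x) x) \<le> D * bracket x ^ M * B"
    using leibniz_bound[OF test_slow[OF \<psi>], of m] that by blast
  obtain K where K: "0 \<le> K" "\<And>x. x \<in> supp \<psi> \<Longrightarrow> bracket x ^ M \<le> K"
    using bounded_bracket_power[OF test_compact[OF \<psi>]] by metis
  show thesis
  proof (rule that[of "C * (D * K)" m])
    fix h :: "real^'a \<Rightarrow> complex" and B assume h: "smooth h" and B0: "0 \<le> B"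
      and B: "\<And>\<alpha> x. length \<alpha> \<le> m \<Longrightarrow> x \<in> supp \<psi> \<Longrightarrow> norm (iter_partial \<alpha> h x) \<le> B"
    have "norm (iter_partial \<alpha> (\<lambda>x. \<psi> x * h x) x) \<le> D * K * B" if \<alpha>: "length \<alpha> \<le> m" for \<alpha> x
    proof (cases "x \<in> supp \<psi>")
      case True
      have "norm (iter_partial \<alpha> (\<lambda>x. \<psi> x * h x) x) \<le> D * bracket x ^ M * B"
        by (rule D(2)[OF h B \<alpha>]) (auto simp: True)
      also have "\<dots> \<le> D * K * B"
        using D(1) B0 K(2)[OF True] by (intro mult_right_mono mult_left_mono)
      finally show ?thesis .
    next
      case False
      then have "iter_partial \<alpha> (\<lambda>x. \<psi> x * h x) x = 0"
        using supp_iter_partial[of \<alpha> "\<lambda>x. \<psi> x * h x"] supp_mult_left[of \<psi> h] notin_supp by blast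
      then show ?thesis using D K B0 by simp
    qed
    then have "norm (u (\<lambda>x. \<psi> x * h x)) \<le> C * (D * K * B)"
      by (intro Cm(2) test_mult \<psi> h supp_mult_left)
    then show "norm (u (\<lambda>x. \<psi> x * h x)) \<le> C * (D * K) * B" by (simp add: mult_ac)
  qed (use Cm D K in auto)
qed

lemma localize_tempered:
  assumes u: "u \<in> distributions" and \<psi>: "\<psi> \<in> test_functions"
  shows "localize \<psi> u \<in> tempered"
proof -
  obtain C m where Cm: "0 \<le> C" "\<And>h B. smooth h \<Longrightarrow> 0 \<le> B \<Longrightarrow>
     (\<And>\<alpha> x. length \<alpha> \<le> m \<Longrightarrow> x \<in> supp \<psi> \<Longrightarrow> norm (iter_partial \<alpha> h x) \<le> B) \<Longrightarrow> norm (u (\<lambda>x. \<psi> x * h x)) \<le> C * B"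
    using localized_bound[OF u \<psi>] that by blast
  show ?thesis
  proof (rule temperedI[OF _ _ Cm(1)])
    show "localize \<psi> u \<in> extensional schwartz" by (simp add: localize_def)
    show "linear_functional_on schwartz (localize \<psi> u)"
      unfolding linear_functional_on_def
    proof (intro ballI allI)
      fix f g :: "real^'a \<Rightarrow> complex" and a b assume fg: "f \<in> schwartz" "g \<in> schwartz"
      have "u (\<lambda>x. a * (\<psi> x * f x) + b * (\<psi> x * g x)) = a * u (\<lambda>x. \<psi> x * f x) + b * u (\<lambda>x. \<psi> x * g x)"
        by (intro distribution_lincomb u test_mult \<psi> schwartz_smooth fg)
      moreover have "(\<lambda>x. a * f x + b * g x) \<in> schwartz" by (intro schwartz_add schwartz_cmult fg)
      ultimately show "localize \<psi> u (\<lambda>x. a * f x + b * g x) = a * localize \<psi> u f + b * localize \<psi> u g"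
        using fg by (simp add: localize_def algebra_simps)
    qed
    fix \<phi> :: "real^'a \<Rightarrow> complex" and B assume \<phi>: "\<phi> \<in> schwartz" and B: "schwartz_bound m B \<phi>"
    have "norm (u (\<lambda>x. \<psi> x * \<phi> x)) \<le> C * B"
    proof (rule Cm(2)[OF schwartz_smooth[OF \<phi>] schwartz_bound_nonneg[OF B]])
      fix \<alpha> :: "'a list" and x assume "length \<alpha> \<le> m"
      have "1 * norm (iter_partial \<alpha> \<phi> x) \<le> bracket x ^ m * norm (iter_partial \<alpha> \<phi> x)"
        by (intro mult_right_mono one_le_power bracket_ge_1) simp
      with schwartz_boundD[OF B \<open>length \<alpha> \<le> m\<close>, of x] show "norm (iter_partial \<alpha> \<phi> x) \<le> B" by simp
    qed
    then show "norm (localize \<psi> u \<phi>) \<le> C * B" using \<phi> by (simp add: localize_def)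
  qed
qed

section \<open>The Fourier transform on Schwartz functions\<close>

lemma bracket_measurable [measurable]: "bracket \<in> borel_measurable borel"
  by (rule borel_measurable_continuous_onI[OF continuous_bracket])

lemma chr_measurable [measurable]: "chr \<xi> \<in> borel_measurable borel"
  by (rule smooth_borel_measurable[OF smooth_chr])

text \<open>Each of the \<open>n\<close> factors \<open>1 + x\<^sub>j\<^sup>2\<close> is at most \<open>\<langle>x\<rangle>\<^sup>2\<close>, which reduces the integral to a product of
  integrals over the line.\<close>

lemma bracket_integrable:
  "integrable lborel (\<lambda>x::real^'n::finite. 1 / bracket x ^ (2 * CARD('n)))"
proof -
  have 1: "(\<integral>\<^sup>+t. ennreal (inverse (1 + t\<^sup>2)) \<partial>lborel) < \<infinity>" for b :: "real^'n"
  proof -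
    have "integrable lborel (\<lambda>t::real. inverse (1 + t\<^sup>2))"
      using integrable_inverse_1_plus_square by (simp add: set_integrable_def einterval_def)
    then show ?thesis by (simp add: integrable_iff_bounded)
  qed
  have "(\<integral>\<^sup>+x. ennreal (norm (1 / bracket x ^ (2 * CARD('n)))) \<partial>(lborel :: (real^'n) measure))
      \<le> (\<integral>\<^sup>+x. (\<Prod>b\<in>Basis. ennreal (inverse (1 + (x \<bullet> b)\<^sup>2))) \<partial>(lborel :: (real^'n) measure))"
  proof (intro nn_integral_mono)
    fix x :: "real^'n"
    have "(\<Prod>b\<in>Basis. (1 + (x \<bullet> b)\<^sup>2)) \<le> (\<Prod>b\<in>(Basis :: (real^'n) set). (bracket x)\<^sup>2)"
    proof (intro prod_mono conjI)
      fix b :: "real^'n" assume "b \<in> Basis"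
      then have "\<bar>x \<bullet> b\<bar> \<le> norm x" by (rule Basis_le_norm)
      then have "(x \<bullet> b)\<^sup>2 \<le> (norm x)\<^sup>2" using abs_le_square_iff[of "x \<bullet> b" "norm x"] by simp
      then show "1 + (x \<bullet> b)\<^sup>2 \<le> (bracket x)\<^sup>2" by (simp add: bracket_squared)
    qed simp
    also have "\<dots> = bracket x ^ (2 * CARD('n))" by (simp add: power_mult)
    finally have "(\<Prod>b\<in>Basis. (1 + (x \<bullet> b)\<^sup>2)) \<le> bracket x ^ (2 * CARD('n))" .
    moreover have "0 < (\<Prod>b\<in>(Basis :: (real^'n) set). (1 + (x \<bullet> b)\<^sup>2))"
      by (intro prod_pos) (simp add: add_pos_nonneg)
    ultimately have "inverse (bracket x ^ (2 * CARD('n))) \<le> inverse (\<Prod>b\<in>Basis. (1 + (x \<bullet> b)\<^sup>2))"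
      by (rule le_imp_inverse_le)
    then have "norm (1 / bracket x ^ (2 * CARD('n))) \<le> (\<Prod>b\<in>Basis. inverse (1 + (x \<bullet> b)\<^sup>2))"
      by (simp add: prod_inversef[symmetric, unfolded comp_def] divide_inverse)
    moreover have "(\<Prod>b\<in>(Basis :: (real^'n) set). ennreal (inverse (1 + (x \<bullet> b)\<^sup>2)))
       = ennreal (\<Prod>b\<in>(Basis :: (real^'n) set). inverse (1 + (x \<bullet> b)\<^sup>2))"
      by (rule prod_ennreal) simp
    ultimately show "ennreal (norm (1 / bracket x ^ (2 * CARD('n)))) \<le> (\<Prod>b\<in>Basis. ennreal (inverse (1 + (x \<bullet> b)\<^sup>2)))"
      by (simp only: ennreal_leI)
  qed
  also have "\<dots> = (\<Prod>b\<in>(Basis :: (real^'n) set). (\<integral>\<^sup>+t. ennreal (inverse (1 + t\<^sup>2)) \<partial>lborel))"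
    by (rule nn_integral_lborel_prod) auto
  also have "\<dots> < \<infinity>"
    using 1 by (simp add: less_top[symmetric] power_eq_top_ennreal)
  finally show ?thesis by (simp add: integrable_iff_bounded)
qed

lemma decay_integrable:
  fixes f :: "real^'n::finite \<Rightarrow> 'b::{banach, second_countable_topology}"
  assumes [measurable]: "f \<in> borel_measurable borel"
    and bd: "\<And>x. bracket x ^ (2 * CARD('n)) * norm (f x) \<le> B"
  shows "integrable lborel f"
    and "norm (LINT x|lborel. f x) \<le> B * (LINT x|(lborel :: (real^'n) measure). 1 / bracket x ^ (2 * CARD('n)))"
proof -
  have le: "norm (f x) \<le> B * (1 / bracket x ^ (2 * CARD('n)))" for x
    using bd[of x] by (simp add: pos_le_divide_eq mult.commute)
  have i: "integrable lborel (\<lambda>x::real^'n. B * (1 / bracket x ^ (2 * CARD('n))))"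
    by (intro integrable_mult_right bracket_integrable)
  show f: "integrable lborel f"
    by (rule Bochner_Integration.integrable_bound[OF i], simp, rule AE_I2, unfold real_norm_def)
       (rule order_trans[OF le abs_ge_self])
  have "norm (LINT x|lborel. f x) \<le> (LINT x|(lborel :: (real^'n) measure). B * (1 / bracket x ^ (2 * CARD('n))))"
    by (rule Bochner_Integration.integral_norm_bound_integral[OF f i le])
  then show "norm (LINT x|lborel. f x) \<le> B * (LINT x|(lborel :: (real^'n) measure). 1 / bracket x ^ (2 * CARD('n)))"
    by (simp del: times_divide_eq_right)
qed

lemma schwartz_measurable: "\<phi> \<in> schwartz \<Longrightarrow> \<phi> \<in> borel_measurable borel"
  by (simp add: smooth_borel_measurable schwartz_smooth)

lemma schwartz_mult_integrable:
  fixes \<phi> :: "real^'n::finite \<Rightarrow> complex"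
  assumes \<phi>: "\<phi> \<in> schwartz" and [measurable]: "g \<in> borel_measurable borel"
    and g: "\<And>x. norm (g x) \<le> C * bracket x ^ M"
  shows "integrable lborel (\<lambda>x. g x * \<phi> x)"
proof -
  have [measurable]: "\<phi> \<in> borel_measurable borel" by (rule schwartz_measurable[OF \<phi>])
  obtain B where B: "schwartz_bound (2 * CARD('n) + M) B \<phi>" using schwartz_obtain_bound[OF \<phi>] .
  have C: "0 \<le> C" using order_trans[OF norm_ge_zero g[of 0]] by (simp add: zero_le_mult_iff bracket_def)
  show ?thesis
  proof (rule decay_integrable)
    fix x
    have "bracket x ^ (2 * CARD('n)) * norm (g x * \<phi> x) \<le> bracket x ^ (2 * CARD('n)) * (C * bracket x ^ M * norm (\<phi> x))"
      unfolding norm_mult by (intro mult_left_mono mult_right_mono g) auto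
    also have "\<dots> = C * (bracket x ^ (2 * CARD('n) + M) * norm (iter_partial [] \<phi> x))"
      by (simp add: power_add)
    also have "\<dots> \<le> C * B" by (intro mult_left_mono schwartz_boundD[OF B] C) simp
    finally show "bracket x ^ (2 * CARD('n)) * norm (g x * \<phi> x) \<le> C * B" .
  qed simp
qed

lemma schwartz_integrable: "\<phi> \<in> schwartz \<Longrightarrow> integrable lborel \<phi>"
  using schwartz_mult_integrable[of \<phi> "\<lambda>x. 1" 1 0] by simp

lemma schwartz_chr_integrable: "\<phi> \<in> schwartz \<Longrightarrow> integrable lborel (\<lambda>x. chr \<xi> x * \<phi> x)"
  using schwartz_mult_integrable[of \<phi> "chr \<xi>" 1 0] by simp

lemma fourier_fun_lborel:
  assumes [measurable]: "\<phi> \<in> borel_measurable borel"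
  shows "fourier_fun \<phi> \<xi> = (LINT x|lborel. chr \<xi> x * \<phi> x)"
  unfolding fourier_fun_def chr_def[symmetric] by (rule integral_completion) simp

lemma slow_coordinate: "slow (\<lambda>x. complex_of_real (x $ i))"
  unfolding slow_def
proof (intro conjI smooth_coordinate allI)
  fix \<alpha> :: "'a list"
  show "\<exists>C M. \<forall>x. norm (iter_partial \<alpha> (\<lambda>x. complex_of_real (x $ i)) x) \<le> C * bracket x ^ M"
  proof (cases \<alpha> rule: rev_exhaust)
    case Nil
    have "\<bar>x $ i\<bar> \<le> bracket x" for x :: "real^'a"
      using component_le_norm_cart[of x i] norm_le_bracket[of x] by linarith
    then show ?thesis unfolding Nil by (intro exI[of _ 1] exI[of _ "1::nat"]) simp
  next
    case (snoc \<beta> j)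
    have *: "partial_deriv j (\<lambda>x. complex_of_real (x $ i)) = (\<lambda>x. complex_of_real (axis j 1 $ i))"
      by (rule ext, rule partial_deriv_eqI[THEN trans],
          rule has_derivative_of_real[OF bounded_linear.has_derivative[OF bounded_linear_vec_nth has_derivative_ident]]) simp
    show ?thesis using slow_const[of "complex_of_real (axis j 1 $ i)"]
      unfolding snoc iter_partial_snoc * slow_def by blast
  qed
qed

lemma schwartz_op_cmult: "schwartz_op (\<lambda>\<phi> x. c * \<phi> x)"
  by (rule schwartz_op_mult[OF slow_const])

lemma schwartz_op_sum:
  assumes "finite J" "\<And>j. j \<in> J \<Longrightarrow> schwartz_op (T j)"
  shows "schwartz_op (\<lambda>\<phi> x. \<Sum>j\<in>J. T j \<phi> x)"
  using assms
proof (induction J)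
  case empty
  show ?case using schwartz_op_cmult[of 0] by simp
next
  case (insert j J)
  then show ?case using schwartz_op_add[of "T j" "\<lambda>\<phi> x. \<Sum>j\<in>J. T j \<phi> x"] by simp
qed

lemma schwartz_op_funpow: "schwartz_op T \<Longrightarrow> schwartz_op (T ^^ m)"
proof (induction m)
  case 0 then show ?case using schwartz_op_id by (simp add: id_def)
next
  case (Suc m) then show ?case using schwartz_op_comp[of T "T ^^ m"] by (simp add: comp_def)
qed

subsection \<open>Differentiation of Fourier transforms\<close>

lemma exp_i_remainder: "norm (exp (- (\<i> * complex_of_real t)) - 1 + \<i> * complex_of_real t) \<le> t\<^sup>2"
proof -
  have "(\<Sum>k\<le>1. (\<i> * complex_of_real (- t)) ^ k / fact k) = 1 - \<i> * complex_of_real t"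
    by (simp add: atMost_Suc numeral_eq_Suc)
  then have "norm (exp (- (\<i> * complex_of_real t)) - (1 - \<i> * complex_of_real t)) \<le> t\<^sup>2 / 2"
    using iexp_approx1[of "- t" 1] by (simp add: power2_eq_square abs_mult_self_eq numeral_eq_Suc)
  also have "\<dots> \<le> t\<^sup>2" by simp
  finally show ?thesis by (simp add: algebra_simps)
qed

lemma chr_add: "chr (\<xi> + \<eta>) x = chr \<xi> x * chr \<eta> x"
  by (simp add: chr_def inner_add_right algebra_simps flip: exp_add)

lemma chr_commute: "chr \<xi> x = chr x \<xi>"
  by (simp add: chr_def inner_commute)

lemma chr_add_left: "chr \<xi> (x + y) = chr \<xi> x * chr \<xi> y"
  by (metis chr_add chr_commute)

lemma chr_0 [simp]: "chr 0 x = 1" "chr \<xi> 0 = 1"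
  by (simp_all add: chr_def)

lemma inner_slow: "\<bar>x \<bullet> h\<bar> \<le> norm h * bracket x"
  using Cauchy_Schwarz_ineq2[of x h] mult_left_mono[OF norm_le_bracket[of x] norm_ge_zero[of h]]
  by (simp add: mult.commute)

text \<open>Differentiation under the integral sign, with the quadratic remainder of the exponential in place of
  dominated convergence.\<close>

lemma fourier_fun_has_derivative:
  assumes \<phi>: "\<phi> \<in> schwartz"
  shows "(fourier_fun \<phi> has_derivative
    (\<lambda>h. LINT x|lborel. (- \<i> * complex_of_real (x \<bullet> h) * chr \<xi> x) * \<phi> x)) (at \<xi>)"
proof -
  note [measurable] = schwartz_measurable[OF \<phi>]
  let ?D = "\<lambda>h. LINT x|lborel. (- \<i> * complex_of_real (x \<bullet> h) * chr \<xi> x) * \<phi> x"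
  have iD: "integrable lborel (\<lambda>x. (- \<i> * complex_of_real (x \<bullet> h) * chr \<xi> x) * \<phi> x)" for h
    by (rule schwartz_mult_integrable[OF \<phi>, of _ "norm h" 1]) (auto simp: norm_mult inner_slow)
  have i2: "integrable lborel (\<lambda>x. complex_of_real ((bracket x)\<^sup>2) * \<phi> x)"
    by (rule schwartz_mult_integrable[OF \<phi>, of _ 1 2]) (auto simp: norm_power)
  \<comment> \<open>the constant in the quadratic estimate of the remainder\<close>
  define K where "K = (LINT x|lborel. norm (complex_of_real ((bracket x)\<^sup>2) * \<phi> x))"
  have lin: "?D (a + b) = ?D a + ?D b" for a b
    unfolding Bochner_Integration.integral_add[OF iD iD, symmetric]
    by (simp add: inner_add_right algebra_simps)
  have sc: "?D (r *\<^sub>R a) = r *\<^sub>R ?D a" for r a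
  proof -
    have "?D (r *\<^sub>R a) = (LINT x|lborel. r *\<^sub>R ((- \<i> * complex_of_real (x \<bullet> a) * chr \<xi> x) * \<phi> x))"
      by (intro Bochner_Integration.integral_cong) (auto simp: scaleR_conv_of_real[where 'a=complex])
    then show ?thesis by simp
  qed
  have bl: "bounded_linear ?D"
    by (rule linear_conv_bounded_linear[THEN iffD1], rule linearI) (use lin sc in auto)
  have rem: "norm (fourier_fun \<phi> (\<xi> + h) - fourier_fun \<phi> \<xi> - ?D h) \<le> (norm h)\<^sup>2 * K" for h
  proof -
    have "fourier_fun \<phi> (\<xi> + h) - fourier_fun \<phi> \<xi> - ?D h =
      (LINT x|lborel. chr (\<xi> + h) x * \<phi> x - chr \<xi> x * \<phi> x - (- \<i> * complex_of_real (x \<bullet> h) * chr \<xi> x) * \<phi> x)"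
      by (simp only: fourier_fun_lborel[OF schwartz_measurable[OF \<phi>]] Bochner_Integration.integral_diff
          Bochner_Integration.integrable_diff schwartz_chr_integrable[OF \<phi>] iD)
    also have "norm \<dots> \<le> (LINT x|lborel. (norm h)\<^sup>2 * norm (complex_of_real ((bracket x)\<^sup>2) * \<phi> x))"
    proof (rule Bochner_Integration.integral_norm_bound_integral)
      fix x
      have "chr (\<xi> + h) x * \<phi> x - chr \<xi> x * \<phi> x - (- \<i> * complex_of_real (x \<bullet> h) * chr \<xi> x) * \<phi> x
        = chr \<xi> x * (exp (- (\<i> * complex_of_real (x \<bullet> h))) - 1 + \<i> * complex_of_real (x \<bullet> h)) * \<phi> x"
        by (simp add: chr_add chr_def[of h] algebra_simps)
      also have "norm \<dots> \<le> 1 * (x \<bullet> h)\<^sup>2 * norm (\<phi> x)"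
        unfolding norm_mult by (intro mult_mono exp_i_remainder) auto
      also have "\<dots> \<le> (norm h * bracket x)\<^sup>2 * norm (\<phi> x)"
        using inner_slow[of x h] by (intro mult_right_mono) (auto simp: abs_le_square_iff[symmetric] abs_mult)
      finally show "norm (chr (\<xi> + h) x * \<phi> x - chr \<xi> x * \<phi> x - (- \<i> * complex_of_real (x \<bullet> h) * chr \<xi> x) * \<phi> x)
         \<le> (norm h)\<^sup>2 * norm (complex_of_real ((bracket x)\<^sup>2) * \<phi> x)"
        by (simp add: power_mult_distrib norm_mult norm_power)
    qed (intro Bochner_Integration.integrable_diff schwartz_chr_integrable \<phi> iD integrable_mult_right integrable_norm i2)+
    finally show ?thesis by (simp add: K_def)
  qed
  show ?thesis
    unfolding has_derivative_at
  proof (intro conjI bl)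
    show "(\<lambda>h. norm (fourier_fun \<phi> (\<xi> + h) - fourier_fun \<phi> \<xi> - ?D h) / norm h) \<midarrow>0\<rightarrow> 0"
    proof (rule Lim_null_comparison)
      show "\<forall>\<^sub>F h in at 0. norm (norm (fourier_fun \<phi> (\<xi> + h) - fourier_fun \<phi> \<xi> - ?D h) / norm h) \<le> norm h * K"
        using rem by (intro always_eventually allI) (auto simp: divide_le_eq power2_eq_square mult_ac)
      have "((\<lambda>h::real^'a. norm h * K) \<longlongrightarrow> norm (0::real^'a) * K) (at 0)" by (intro tendsto_mult tendsto_norm[OF tendsto_ident_at] tendsto_const)
      then show "((\<lambda>h::real^'a. norm h * K) \<longlongrightarrow> 0) (at 0)" by simp
    qed
  qed
qed

text \<open>The operator that corresponds to \<open>\<partial>\<^sub>i\<close> under the Fourier transform.\<close>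

definition xmult :: "'n::finite \<Rightarrow> (real^'n \<Rightarrow> complex) \<Rightarrow> real^'n \<Rightarrow> complex" where
  "xmult i \<phi> x = - (\<i> * complex_of_real (x $ i)) * \<phi> x"

lemma schwartz_op_xmult: "schwartz_op (xmult i)"
  using schwartz_op_comp[OF schwartz_op_cmult[of "- \<i>"] schwartz_op_mult[OF slow_coordinate[of i]]]
  by (simp add: xmult_def[abs_def] mult.assoc)

lemma partial_deriv_fourier_fun:
  assumes \<phi>: "\<phi> \<in> schwartz"
  shows "partial_deriv i (fourier_fun \<phi>) = fourier_fun (xmult i \<phi>)"
proof
  fix \<xi>
  note [measurable] = schwartz_measurable[OF schwartz_op_schwartz[OF schwartz_op_xmult \<phi>]]
  show "partial_deriv i (fourier_fun \<phi>) \<xi> = fourier_fun (xmult i \<phi>) \<xi>"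
    unfolding partial_deriv_eqI[OF fourier_fun_has_derivative[OF \<phi>]]
    by (subst fourier_fun_lborel, simp)
       (intro Bochner_Integration.integral_cong, auto simp: xmult_def inner_axis)
qed

lemma smooth_fourier_fun: "\<phi> \<in> schwartz \<Longrightarrow> smooth (fourier_fun \<phi>)"
proof (rule smooth_coinduct[where P="\<lambda>f. \<exists>\<phi>\<in>schwartz. f = fourier_fun \<phi>"])
  fix f :: "real^'a \<Rightarrow> complex" assume "\<exists>\<phi>\<in>schwartz. f = fourier_fun \<phi>"
  then obtain \<phi> where \<phi>: "\<phi> \<in> schwartz" "f = fourier_fun \<phi>" by blast
  let ?D = "\<lambda>\<xi> h. LINT x|lborel. (- \<i> * complex_of_real (x \<bullet> h) * chr \<xi> x) * \<phi> x"
  show "\<exists>D. (\<forall>\<xi>. (f has_derivative D \<xi>) (at \<xi>)) \<and> (\<forall>i. \<exists>\<phi>\<in>schwartz. (\<lambda>\<xi>. D \<xi> (axis i 1)) = fourier_fun \<phi>)"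
    unfolding \<phi>(2)
  proof (rule exI[of _ ?D], intro conjI allI fourier_fun_has_derivative[OF \<phi>(1)])
    fix i
    have "(\<lambda>\<xi>. ?D \<xi> (axis i 1)) = fourier_fun (xmult i \<phi>)"
      unfolding partial_deriv_fourier_fun[OF \<phi>(1), symmetric]
      by (rule ext, rule partial_deriv_eqI[symmetric], rule fourier_fun_has_derivative[OF \<phi>(1)])
    then show "\<exists>\<phi>\<in>schwartz. (\<lambda>\<xi>. ?D \<xi> (axis i 1)) = fourier_fun \<phi>"
      using schwartz_op_schwartz[OF schwartz_op_xmult \<phi>(1)] by blast
  qed
qed blast

text \<open>The operator that corresponds to \<open>\<partial>\<^sup>\<alpha>\<close> under the Fourier transform.\<close>

definition xmults :: "'n::finite list \<Rightarrow> (real^'n \<Rightarrow> complex) \<Rightarrow> real^'n \<Rightarrow> complex" where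
  "xmults \<alpha> \<phi> x = monom_i \<alpha> x * \<phi> x"

lemma xmults_Cons: "xmults (i # \<alpha>) \<phi> = xmult i (xmults \<alpha> \<phi>)"
  by (simp add: xmults_def xmult_def monom_i_def fun_eq_iff mult.assoc)

lemma schwartz_op_xmults: "schwartz_op (xmults \<alpha>)"
proof (induction \<alpha>)
  case Nil
  have "xmults [] = (\<lambda>\<phi>::real^'a \<Rightarrow> complex. \<phi>)" by (simp add: xmults_def monom_i_def fun_eq_iff)
  then show ?case using schwartz_op_id by simp
next
  case (Cons i \<alpha>)
  have "xmults (i # \<alpha>) = (\<lambda>\<phi>. xmult i (xmults \<alpha> \<phi>))" by (simp add: xmults_Cons fun_eq_iff)
  then show ?case using schwartz_op_comp[OF schwartz_op_xmult Cons.IH] by simp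
qed

lemma iter_partial_fourier_fun:
  "\<phi> \<in> schwartz \<Longrightarrow> iter_partial \<alpha> (fourier_fun \<phi>) = fourier_fun (xmults \<alpha> \<phi>)"
proof (induction \<alpha>)
  case Nil
  have "xmults [] \<phi> = \<phi>" by (simp add: xmults_def monom_i_def fun_eq_iff)
  then show ?case by simp
next
  case (Cons i \<alpha>)
  then show ?case
    by (simp add: iter_partial_Cons xmults_Cons partial_deriv_fourier_fun schwartz_op_schwartz[OF schwartz_op_xmults])
qed

subsection \<open>Integration by parts\<close>

lemma lborel_integral_translate:
  fixes f :: "'a::euclidean_space \<Rightarrow> 'b::{banach, second_countable_topology}"
  assumes [measurable]: "f \<in> borel_measurable borel"
  shows "(LINT x|lborel. f (x + a)) = (LINT x|lborel. f x)"
    and "integrable lborel f \<Longrightarrow> integrable lborel (\<lambda>x. f (x + a))"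
proof -
  have 1: "(LINT x|lborel. f x) = (LINT x|distr lborel borel ((+) a). f x)" by (simp add: lborel_distr_plus)
  then show "(LINT x|lborel. f (x + a)) = (LINT x|lborel. f x)"
    by (subst 1, subst integral_distr) (auto simp: add.commute)
  show "integrable lborel (\<lambda>x. f (x + a))" if "integrable lborel f"
  proof -
    have "integrable (distr lborel borel ((+) a)) f" using that by (simp add: lborel_distr_plus)
    then show ?thesis by (subst (asm) integrable_distr_eq) (auto simp: add.commute)
  qed
qed

lemma line_has_vector_derivative:
  assumes "smooth f"
  shows "((\<lambda>s. f (x + s *\<^sub>R axis i 1)) has_vector_derivative partial_deriv i f (x + s *\<^sub>R axis i 1)) (at s within S)"
proof -
  let ?D = "frechet_derivative f (at (x + s *\<^sub>R axis i 1))"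
  have "((\<lambda>s. f (x + s *\<^sub>R axis i 1)) has_derivative (\<lambda>h. ?D (h *\<^sub>R axis i 1))) (at s within S)"
    by (rule has_derivative_compose[OF _ smooth_has_derivative[OF assms], of "\<lambda>s. x + s *\<^sub>R axis i 1" "\<lambda>h. h *\<^sub>R axis i 1"])
       (auto intro!: derivative_eq_intros)
  moreover have "?D (h *\<^sub>R axis i 1) = h *\<^sub>R ?D (axis i 1)" for h
    by (rule linear_scale[OF bounded_linear.linear[OF has_derivative_bounded_linear[OF smooth_has_derivative[OF assms]]]])
  ultimately show ?thesis by (simp add: has_vector_derivative_def partial_deriv_def)
qed

text \<open>By translation invariance all difference quotients have integral \<open>0\<close>; they converge to the derivative
  and are dominated because the derivative decays uniformly along short segments.\<close>

lemma integral_partial_deriv_eq_0: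
  fixes f :: "real^'n::finite \<Rightarrow> complex"
  assumes f: "f \<in> schwartz"
  shows "(LINT x|lborel. partial_deriv i f x) = 0"
proof -
  note s = schwartz_smooth[OF f]
  note [measurable] = schwartz_measurable[OF f]
  let ?L = "2 * CARD('n)"
  let ?e = "axis i 1 :: real^'n"
  have "partial_deriv i f \<in> schwartz" by (rule schwartz_op_schwartz[OF schwartz_op_partial_deriv f])
  note m2[measurable] = schwartz_measurable[OF this]
  obtain B where B: "schwartz_bound (?L + 1) B f" using schwartz_obtain_bound[OF f] .
  have B0: "0 \<le> B" by (rule schwartz_bound_nonneg[OF B])
  have pB: "bracket x ^ ?L * norm (partial_deriv i f x) \<le> B" for x
    using schwartz_boundD[OF schwartz_bound_mono[OF B, of "?L + 1" B], of "[i]" x] bracket_power_mono[of ?L "?L + 1" x]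
    by (auto simp: iter_partial_Cons intro: order_trans[OF mult_right_mono] simp del: One_nat_def)
  define r where "r n = inverse (real (Suc n))" for n
  have r: "0 < r n" "r n \<le> 1" for n by (auto simp: r_def field_simps)
  define q where "q n x = (1 / r n) *\<^sub>R (f (x + r n *\<^sub>R ?e) - f x)" for n x
  have "(\<lambda>n. LINT x|lborel. q n x) \<longlonglongrightarrow> (LINT x|lborel. partial_deriv i f x)"
  proof (rule integral_dominated_convergence)
    show "integrable lborel (\<lambda>x::real^'n. (3 * 4 ^ ?L * B) * (1 / bracket x ^ ?L))"
      by (intro integrable_mult_right bracket_integrable)
    show "AE x in lborel. (\<lambda>n. q n x) \<longlonglongrightarrow> partial_deriv i f x"
    proof (rule AE_I2)
      fix x :: "real^'n"
      have "((\<lambda>h. norm (f (x + (0 + h) *\<^sub>R ?e) - f (x + 0 *\<^sub>R ?e) - h *\<^sub>R partial_deriv i f (x + 0 *\<^sub>R ?e)) / norm h) \<longlongrightarrow> 0) (at 0)"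
        using line_has_vector_derivative[OF s, of x i 0 UNIV]
        unfolding has_vector_derivative_def has_derivative_at by blast
      moreover have "filterlim r (at 0) sequentially"
        unfolding filterlim_at using LIMSEQ_inverse_real_of_nat r by (auto simp: r_def[abs_def])
      ultimately have "(\<lambda>n. norm (f (x + (0 + r n) *\<^sub>R ?e) - f (x + 0 *\<^sub>R ?e) - r n *\<^sub>R partial_deriv i f (x + 0 *\<^sub>R ?e)) / norm (r n)) \<longlonglongrightarrow> 0"
        by (rule filterlim_compose)
      moreover have "norm (f (x + (0 + r n) *\<^sub>R ?e) - f (x + 0 *\<^sub>R ?e) - r n *\<^sub>R partial_deriv i f (x + 0 *\<^sub>R ?e)) / norm (r n)
         = norm (q n x - partial_deriv i f x)" for n
      proof -
        have "q n x - partial_deriv i f x = (1 / r n) *\<^sub>R (f (x + r n *\<^sub>R ?e) - f x - r n *\<^sub>R partial_deriv i f x)"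
          using r[of n] by (simp add: q_def scaleR_diff_right)
        then show ?thesis using r[of n] by simp
      qed
      ultimately have "(\<lambda>n. norm (q n x - partial_deriv i f x)) \<longlonglongrightarrow> 0" by simp
      then show "(\<lambda>n. q n x) \<longlonglongrightarrow> partial_deriv i f x"
        by (rule LIM_zero_cancel[OF tendsto_norm_zero_cancel])
    qed
    show "AE x in lborel. norm (q n x) \<le> (3 * 4 ^ ?L * B) * (1 / bracket x ^ ?L)" for n
    proof (rule AE_I2)
      fix x :: "real^'n"
      define b where "b = 4 ^ ?L * B / bracket x ^ ?L"
      have near: "norm (partial_deriv i f (x + t *\<^sub>R ?e)) \<le> b" if "t \<in> {0..r n}" for t
      proof -
        \<comment> \<open>the factor 4 comes from Peetre's inequality and \<open>\<langle>t e\<rangle> \<le> 2\<close>\<close>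
        have "bracket x = bracket ((x + t *\<^sub>R ?e) + (- (t *\<^sub>R ?e)))" by simp
        also have "\<dots> \<le> 2 * bracket (x + t *\<^sub>R ?e) * bracket (- (t *\<^sub>R ?e))" by (rule bracket_add_le)
        also have "\<dots> \<le> 2 * bracket (x + t *\<^sub>R ?e) * 2"
        proof (intro mult_left_mono)
          have "norm (t *\<^sub>R ?e) \<le> 1" using that r[of n] by (auto simp: norm_axis_1)
          then have "bracket (t *\<^sub>R ?e) \<le> sqrt (1 + 1\<^sup>2)" by (rule bracket_le)
          also have "\<dots> \<le> 2" by (intro real_le_lsqrt) auto
          finally show "bracket (- (t *\<^sub>R ?e)) \<le> 2" by simp
        qed auto
        finally have "bracket x \<le> 4 * bracket (x + t *\<^sub>R ?e)" by simp
        then have "bracket x ^ ?L \<le> (4 * bracket (x + t *\<^sub>R ?e)) ^ ?L" by (intro power_mono) auto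
        then have "bracket x ^ ?L * norm (partial_deriv i f (x + t *\<^sub>R ?e)) \<le>
           4 ^ ?L * (bracket (x + t *\<^sub>R ?e) ^ ?L * norm (partial_deriv i f (x + t *\<^sub>R ?e)))"
          by (simp add: power_mult_distrib mult_right_mono flip: mult.assoc)
        also have "\<dots> \<le> 4 ^ ?L * B" by (intro mult_left_mono pB) auto
        finally show ?thesis unfolding b_def by (simp add: pos_le_divide_eq mult.commute)
      qed
      \<comment> \<open>the derivative varies by at most \<open>2 b\<close> on the segment; together with its value at \<open>0\<close> this gives \<open>3 b\<close>\<close>
      have "norm (f (x + r n *\<^sub>R ?e) - f (x + 0 *\<^sub>R ?e) - (r n - 0) *\<^sub>R partial_deriv i f (x + 0 *\<^sub>R ?e)) \<le> norm (r n - 0) * (2 * b)"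
      proof (rule vector_differentiable_bound_linearization[where S="{0..r n}" and ?x0.0=0 and f="\<lambda>s. f (x + s *\<^sub>R ?e)"])
        show "((\<lambda>s. f (x + s *\<^sub>R ?e)) has_vector_derivative partial_deriv i f (x + s *\<^sub>R ?e)) (at s within {0..r n})" for s
          by (rule line_has_vector_derivative[OF s])
        show "closed_segment 0 (r n) \<subseteq> {0..r n}" using r[of n] by (auto simp: closed_segment_eq_real_ivl)
        fix t assume "t \<in> {0..r n}"
        then show "norm (partial_deriv i f (x + t *\<^sub>R ?e) - partial_deriv i f (x + 0 *\<^sub>R ?e)) \<le> 2 * b"
          using near[of t] near[of 0] r[of n] norm_triangle_ineq4[of "partial_deriv i f (x + t *\<^sub>R ?e)" "partial_deriv i f (x + 0 *\<^sub>R ?e)"]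
          by (simp del: norm_triangle_ineq4)
      qed (use r[of n] in auto)
      then have "norm (f (x + r n *\<^sub>R ?e) - f x) \<le> r n * (2 * b) + norm (r n *\<^sub>R partial_deriv i f x)"
        using norm_triangle_sub[of "f (x + r n *\<^sub>R ?e) - f x" "r n *\<^sub>R partial_deriv i f x"] r[of n]
        by (simp del: norm_scaleR)
      also have "\<dots> \<le> r n * (2 * b) + r n * b"
        using near[of 0] r[of n] by (simp add: mult_left_mono)
      finally have "norm (q n x) \<le> 3 * b"
        using r[of n] unfolding q_def norm_scaleR by (simp add: divide_le_eq mult_ac)
      then show "norm (q n x) \<le> (3 * 4 ^ ?L * B) * (1 / bracket x ^ ?L)" by (simp add: b_def)
    qed
  qed (auto simp: q_def)
  moreover have "(LINT x|lborel. q n x) = 0" for n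
    using schwartz_integrable[OF f]
    by (simp add: q_def lborel_integral_translate)
  ultimately show ?thesis using LIMSEQ_unique[OF _ tendsto_const] by fastforce
qed

lemma fourier_fun_partial_deriv:
  assumes \<phi>: "\<phi> \<in> schwartz"
  shows "fourier_fun (partial_deriv i \<phi>) \<xi> = \<i> * complex_of_real (\<xi> $ i) * fourier_fun \<phi> \<xi>"
proof -
  have d: "partial_deriv i \<phi> \<in> schwartz" by (rule schwartz_op_schwartz[OF schwartz_op_partial_deriv \<phi>])
  have "partial_deriv i (chr \<xi>) = (\<lambda>x. monom_i [i] \<xi> * chr \<xi> x)"
    using iter_partial_chr[of "[i]" \<xi>] by (simp add: iter_partial_Cons)
  then have "partial_deriv i (\<lambda>x. chr \<xi> x * \<phi> x) =
      (\<lambda>x. chr \<xi> x * partial_deriv i \<phi> x + (- (\<i> * complex_of_real (\<xi> $ i))) * (chr \<xi> x * \<phi> x))"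
    unfolding partial_deriv_mult[OF smooth_chr schwartz_smooth[OF \<phi>]] by (simp add: monom_i_def mult.assoc)
  moreover have "(LINT x|lborel. partial_deriv i (\<lambda>x. chr \<xi> x * \<phi> x) x) = 0"
    by (rule integral_partial_deriv_eq_0[OF schwartz_op_schwartz[OF schwartz_op_mult[OF slow_chr] \<phi>]])
  ultimately have "(LINT x|lborel. chr \<xi> x * partial_deriv i \<phi> x) +
      (- (\<i> * complex_of_real (\<xi> $ i))) * (LINT x|lborel. chr \<xi> x * \<phi> x) = 0"
    using schwartz_chr_integrable[OF d, of \<xi>] schwartz_chr_integrable[OF \<phi>, of \<xi>] by simp
  then show ?thesis
    by (simp add: fourier_fun_lborel schwartz_measurable \<phi> d)
qed

lemma fourier_fun_add:
  assumes "\<phi> \<in> schwartz" "\<psi> \<in> schwartz"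
  shows "fourier_fun (\<lambda>x. \<phi> x + \<psi> x) \<xi> = fourier_fun \<phi> \<xi> + fourier_fun \<psi> \<xi>"
  using assms[THEN schwartz_measurable] assms[THEN schwartz_chr_integrable, of \<xi>]
  by (simp add: fourier_fun_lborel distrib_left)

lemma fourier_fun_cmult:
  assumes "\<phi> \<in> schwartz" shows "fourier_fun (\<lambda>x. c * \<phi> x) \<xi> = c * fourier_fun \<phi> \<xi>"
proof -
  have "(LINT x|lborel. chr \<xi> x * (c * \<phi> x)) = (LINT x|lborel. c * (chr \<xi> x * \<phi> x))"
    by (simp only: mult.left_commute)
  then show ?thesis
    using assms by (simp add: fourier_fun_lborel schwartz_measurable schwartz_cmult)
qed

lemma fourier_fun_diff:
  assumes "\<phi> \<in> schwartz" "\<psi> \<in> schwartz"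
  shows "fourier_fun (\<lambda>x. \<phi> x - \<psi> x) \<xi> = fourier_fun \<phi> \<xi> - fourier_fun \<psi> \<xi>"
  using fourier_fun_add[OF assms(1) schwartz_cmult[OF assms(2), of "-1"]] fourier_fun_cmult[OF assms(2), of "-1"]
  by simp

lemma fourier_fun_sum:
  assumes "finite J" "\<And>j. j \<in> J \<Longrightarrow> f j \<in> schwartz"
  shows "(\<lambda>x. \<Sum>j\<in>J. f j x) \<in> schwartz \<and> fourier_fun (\<lambda>x. \<Sum>j\<in>J. f j x) \<xi> = (\<Sum>j\<in>J. fourier_fun (f j) \<xi>)"
  using assms
proof (induction J)
  case empty
  then show ?case using test_schwartz[OF test_zero] by (simp add: fourier_fun_def)
qed (simp add: fourier_fun_add schwartz_add)

text \<open>The operator \<open>1 - \<Delta>\<close>.  It becomes multiplication by \<open>\<langle>\<xi>\<rangle>\<^sup>2\<close>, so its powers measure decay of Fourier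
  transforms.\<close>

definition bessel :: "(real^'n::finite \<Rightarrow> complex) \<Rightarrow> real^'n \<Rightarrow> complex" where
  "bessel \<phi> x = \<phi> x + (\<Sum>j\<in>UNIV. -1 * partial_deriv j (partial_deriv j \<phi>) x)"

lemma schwartz_op_bessel: "schwartz_op bessel"
proof -
  have "schwartz_op (\<lambda>\<phi> x. \<phi> x + (\<Sum>j\<in>UNIV. -1 * partial_deriv j (partial_deriv j \<phi>) x))"
    by (intro schwartz_op_add schwartz_op_id schwartz_op_sum finite
        schwartz_op_comp[OF schwartz_op_cmult schwartz_op_comp[OF schwartz_op_partial_deriv schwartz_op_partial_deriv]])
  then show ?thesis by (simp add: bessel_def[abs_def])
qed

lemma fourier_fun_bessel:
  assumes \<phi>: "\<phi> \<in> schwartz"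
  shows "fourier_fun (bessel \<phi>) \<xi> = complex_of_real ((bracket \<xi>)\<^sup>2) * fourier_fun \<phi> \<xi>"
proof -
  have d: "partial_deriv j f \<in> schwartz" if "f \<in> schwartz" for j and f :: "real^'a \<Rightarrow> complex"
    by (rule schwartz_op_schwartz[OF schwartz_op_partial_deriv that])
  have c: "(\<lambda>x. -1 * partial_deriv j (partial_deriv j \<phi>) x) \<in> schwartz" for j
    by (intro schwartz_cmult d \<phi>)
  have s: "(\<lambda>x. \<Sum>j\<in>UNIV. -1 * partial_deriv j (partial_deriv j \<phi>) x) \<in> schwartz \<and>
      fourier_fun (\<lambda>x. \<Sum>j\<in>UNIV. -1 * partial_deriv j (partial_deriv j \<phi>) x) \<xi> =
      (\<Sum>j\<in>UNIV. fourier_fun (\<lambda>x. -1 * partial_deriv j (partial_deriv j \<phi>) x) \<xi>)"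
    by (rule fourier_fun_sum[OF finite]) (rule c)
  have "fourier_fun (bessel \<phi>) \<xi> = fourier_fun \<phi> \<xi> + (\<Sum>j\<in>UNIV. fourier_fun (\<lambda>x. -1 * partial_deriv j (partial_deriv j \<phi>) x) \<xi>)"
    unfolding bessel_def[abs_def]
    using fourier_fun_add[OF \<phi> conjunct1[OF s], of \<xi>] conjunct2[OF s] by (simp only:)
  also have "(\<Sum>j\<in>UNIV. fourier_fun (\<lambda>x. -1 * partial_deriv j (partial_deriv j \<phi>) x) \<xi>) =
     (\<Sum>j\<in>UNIV. complex_of_real ((\<xi> $ j)\<^sup>2) * fourier_fun \<phi> \<xi>)"
  proof (intro sum.cong refl)
    fix j
    have "\<i> * \<i> = -1" by simp
    then have "-1 * (\<i> * c * (\<i> * c * z)) = c\<^sup>2 * z" for c z by algebra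
    then show "fourier_fun (\<lambda>x. -1 * partial_deriv j (partial_deriv j \<phi>) x) \<xi> = complex_of_real ((\<xi> $ j)\<^sup>2) * fourier_fun \<phi> \<xi>"
      by (subst fourier_fun_cmult[OF d[OF d[OF \<phi>]]]) (simp add: fourier_fun_partial_deriv d \<phi>)
  qed
  also have "\<dots> = complex_of_real ((norm \<xi>)\<^sup>2) * fourier_fun \<phi> \<xi>"
    by (simp add: norm_vec_def L2_set_def sum_nonneg sum_distrib_right)
  finally show ?thesis by (simp add: bracket_squared algebra_simps)
qed

lemma fourier_fun_bessel_funpow:
  "\<phi> \<in> schwartz \<Longrightarrow> fourier_fun ((bessel ^^ m) \<phi>) \<xi> = complex_of_real (bracket \<xi> ^ (2 * m)) * fourier_fun \<phi> \<xi>"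
proof (induction m)
  case (Suc m)
  then show ?case
    using fourier_fun_bessel[OF schwartz_op_schwartz[OF schwartz_op_funpow[OF schwartz_op_bessel] Suc.prems], of m]
    by (simp add: power2_eq_square)
qed simp

lemma fourier_fun_bound:
  fixes \<phi> :: "real^'n::finite \<Rightarrow> complex"
  assumes \<phi>: "\<phi> \<in> schwartz" and B: "schwartz_bound (2 * CARD('n)) B \<phi>"
  shows "norm (fourier_fun \<phi> \<xi>) \<le> B * (LINT x|(lborel :: (real^'n) measure). 1 / bracket x ^ (2 * CARD('n)))"
proof -
  note [measurable] = schwartz_measurable[OF \<phi>]
  show ?thesis
    unfolding fourier_fun_lborel[OF schwartz_measurable[OF \<phi>]]
    by (rule decay_integrable(2)) (use schwartz_boundD[OF B, of "[]"] in \<open>auto simp: norm_mult\<close>)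
qed

text \<open>Every seminorm of the Fourier transform is controlled by the suprema of
  \<open>\<langle>\<xi>\<rangle>\<^sup>2\<^sup>m \<partial>\<^sup>\<alpha> F \<phi>\<close>, and these functions are the Fourier transforms of \<open>(1 - \<Delta>)\<^sup>m\<close> applied to \<open>(- i x)\<^sup>\<alpha> \<phi>\<close>; and a Fourier
  transform is bounded by the integral of the absolute value.\<close>

theorem schwartz_op_fourier_fun: "schwartz_op (fourier_fun :: (real^'n::finite \<Rightarrow> complex) \<Rightarrow> real^'n \<Rightarrow> complex)"
  unfolding schwartz_op_def
proof (intro conjI ballI allI smooth_fourier_fun)
  fix m
  let ?I = "LINT x|(lborel :: (real^'n) measure). 1 / bracket x ^ (2 * CARD('n))"
  have I0: "0 \<le> ?I" by (intro Bochner_Integration.integral_nonneg) simp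
  define T where "T \<alpha> \<phi> = (bessel ^^ m) (xmults \<alpha> \<phi>)" for \<alpha> and \<phi> :: "real^'n \<Rightarrow> complex"
  have T: "schwartz_op (T \<alpha>)" for \<alpha>
    unfolding T_def[abs_def] by (rule schwartz_op_comp[OF schwartz_op_funpow[OF schwartz_op_bessel] schwartz_op_xmults])
  have "\<forall>\<alpha>. \<exists>C m'. 0 \<le> C \<and> (\<forall>\<phi> B. \<phi> \<in> schwartz \<longrightarrow> schwartz_bound m' B \<phi> \<longrightarrow> schwartz_bound (2 * CARD('n)) (C * B) (T \<alpha> \<phi>))"
  proof
    show "\<exists>C m'. 0 \<le> C \<and> (\<forall>\<phi> B. \<phi> \<in> schwartz \<longrightarrow> schwartz_bound m' B \<phi> \<longrightarrow> schwartz_bound (2 * CARD('n)) (C * B) (T \<alpha> \<phi>))" for \<alpha>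
    proof (rule schwartz_op_bound[OF T[of \<alpha>], of "2 * CARD('n)"])
      fix C m' assume "0 \<le> C" "\<And>\<phi> B. \<phi> \<in> schwartz \<Longrightarrow> schwartz_bound m' B \<phi> \<Longrightarrow> schwartz_bound (2 * CARD('n)) (C * B) (T \<alpha> \<phi>)"
      then show ?thesis by (intro exI[of _ C] exI[of _ m']) simp
    qed
  qed
  from this[unfolded choice_iff] obtain C m' where "\<forall>\<alpha>. 0 \<le> C \<alpha> \<and>
    (\<forall>\<phi> B. \<phi> \<in> schwartz \<longrightarrow> schwartz_bound (m' \<alpha>) B \<phi> \<longrightarrow> schwartz_bound (2 * CARD('n)) (C \<alpha> * B) (T \<alpha> \<phi>))"
    by (elim exE) (rule that)
  then have C: "\<And>\<alpha>. 0 \<le> C \<alpha>"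
    "\<And>\<alpha> \<phi> B. \<phi> \<in> schwartz \<Longrightarrow> schwartz_bound (m' \<alpha>) B \<phi> \<Longrightarrow> schwartz_bound (2 * CARD('n)) (C \<alpha> * B) (T \<alpha> \<phi>)"
    by simp_all
  \<comment> \<open>constants that serve all multi-indices of order at most \<open>m\<close> at once\<close>
  define C' where "C' = (\<Sum>\<alpha> | length \<alpha> \<le> m. C \<alpha>)"
  define M where "M = (\<Sum>\<alpha> | length \<alpha> \<le> m. m' \<alpha>)"
  show "\<exists>C m'. \<forall>\<phi>\<in>schwartz. \<forall>B. schwartz_bound m' B \<phi> \<longrightarrow> schwartz_bound m (C * B) (fourier_fun \<phi> :: real^'n \<Rightarrow> complex)"
  proof (intro exI[of _ "C' * ?I"] exI[of _ M] ballI allI impI)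
    fix \<phi> :: "real^'n \<Rightarrow> complex" and B assume \<phi>: "\<phi> \<in> schwartz" and B: "schwartz_bound M B \<phi>"
    show "schwartz_bound m (C' * ?I * B) (fourier_fun \<phi>)"
      unfolding schwartz_bound_def
    proof (intro allI impI)
      fix \<alpha> :: "'n list" and \<xi> assume \<alpha>: "length \<alpha> \<le> m"
      note X = schwartz_op_schwartz[OF schwartz_op_xmults \<phi>]
      have "schwartz_bound (m' \<alpha>) B \<phi>"
        by (rule schwartz_bound_mono[OF B]) (use \<alpha> finite_multi_indices in \<open>auto simp: M_def intro!: member_le_sum\<close>)
      then have TB: "schwartz_bound (2 * CARD('n)) (C \<alpha> * B) (T \<alpha> \<phi>)" by (rule C(2)[OF \<phi>])
      have "bracket \<xi> ^ m * norm (iter_partial \<alpha> (fourier_fun \<phi>) \<xi>) \<le> bracket \<xi> ^ (2 * m) * norm (iter_partial \<alpha> (fourier_fun \<phi>) \<xi>)"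
        by (intro mult_right_mono bracket_power_mono) auto
      also have "\<dots> = norm (fourier_fun (T \<alpha> \<phi>) \<xi>)"
        by (simp add: T_def fourier_fun_bessel_funpow[OF X] iter_partial_fourier_fun[OF \<phi>] norm_mult norm_power)
      also have "\<dots> \<le> C \<alpha> * B * ?I"
        by (rule fourier_fun_bound[OF schwartz_op_schwartz[OF T \<phi>] TB])
      also have "\<dots> \<le> C' * B * ?I"
        unfolding C'_def using \<alpha> C(1) schwartz_bound_nonneg[OF B] I0 finite_multi_indices
        by (intro mult_right_mono member_le_sum) auto
      finally show "bracket \<xi> ^ m * norm (iter_partial \<alpha> (fourier_fun \<phi>) \<xi>) \<le> C' * ?I * B"
        by (simp add: mult_ac)
    qed
  qed
qed

lemma fourier_fun_schwartz: "\<phi> \<in> schwartz \<Longrightarrow> fourier_fun \<phi> \<in> schwartz"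
  by (rule schwartz_op_schwartz[OF schwartz_op_fourier_fun])

section \<open>Fourier inversion\<close>

lemma lborel_product_integral:
  fixes f :: "'a::euclidean_space \<Rightarrow> real \<Rightarrow> complex"
  assumes f: "\<And>b. b \<in> Basis \<Longrightarrow> integrable lborel (f b)"
  shows "integrable lborel (\<lambda>x. \<Prod>b\<in>Basis. f b (x \<bullet> b))"
    and "(LINT x|lborel. (\<Prod>b\<in>Basis. f b (x \<bullet> b))) = (\<Prod>b\<in>Basis. LINT t|lborel. f b t)"
proof -
  interpret product_sigma_finite "\<lambda>_::'a. lborel :: real measure" by standard
  have [measurable]: "f b \<in> borel_measurable borel" if "b \<in> Basis" for b
    using borel_measurable_integrable[OF f[OF that]] by simp
  let ?g = "\<lambda>x. \<Prod>b\<in>Basis. f b (x \<bullet> b)"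
  let ?h = "\<lambda>y. \<Sum>b\<in>Basis. y b *\<^sub>R (b :: 'a)"
  have h[measurable]: "?h \<in> (\<Pi>\<^sub>M b\<in>Basis. lborel) \<rightarrow>\<^sub>M borel" by measurable
  have g[measurable]: "?g \<in> borel_measurable borel" by measurable
  have gh: "?g (?h y) = (\<Prod>b\<in>Basis. f b (y b))" for y
    by (intro prod.cong refl) (simp add: inner_sum_left_Basis)
  show "integrable lborel ?g"
    by (subst lborel_eq, subst integrable_distr_eq[OF h g])
       (simp only: gh product_integrable_prod[OF finite_Basis f])
  show "integral\<^sup>L lborel ?g = (\<Prod>b\<in>Basis. LINT t|lborel. f b t)"
    by (subst lborel_eq, subst integral_distr[OF h g])
       (simp only: gh product_integral_prod[OF finite_Basis f])
qed

definition gauss :: "real^'n::finite \<Rightarrow> real" where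
  "gauss x = exp (- ((norm x)\<^sup>2 / 2))"

lemma gauss_measurable [measurable]: "gauss \<in> borel_measurable borel"
  unfolding gauss_def by simp

lemma gauss_bounds: "0 \<le> gauss x" "gauss x \<le> 1"
  by (simp_all add: gauss_def)

text \<open>The characteristic function of the standard normal distribution, up to normalization.\<close>

lemma gauss_fourier_1d:
  "integrable lborel (\<lambda>t. exp (- (\<i> * complex_of_real (t * s))) * complex_of_real (exp (- (t\<^sup>2 / 2))))" (is ?I)
  "(LINT t|lborel. exp (- (\<i> * complex_of_real (t * s))) * complex_of_real (exp (- (t\<^sup>2 / 2))))
     = complex_of_real (sqrt (2 * pi) * exp (- (s\<^sup>2 / 2)))" (is ?E)
proof -
  have d: "exp (- (t\<^sup>2 / 2)) = sqrt (2 * pi) * std_normal_density t" for t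
    by (simp add: normal_density_def)
  have i: "integrable lborel (\<lambda>t. complex_of_real (sqrt (2 * pi) * std_normal_density t))"
    by (intro integrable_of_real integrable_mult_right) (rule integrable_normal_density, simp)
  show ?I
    by (rule Bochner_Integration.integrable_bound[OF i]) (auto simp: d norm_mult)
  have "complex_of_real (exp (- (s\<^sup>2) / 2)) = char std_normal_distribution (- s)"
    by (simp add: char_std_normal_distribution)
  also have "\<dots> = (LINT t|lborel. std_normal_density t *\<^sub>R iexp (- s * t))"
    unfolding char_def by (subst integral_density) auto
  finally have 1: "complex_of_real (exp (- (s\<^sup>2) / 2)) = (LINT t|lborel. std_normal_density t *\<^sub>R iexp (- s * t))" .
  have 2: "(LINT t|lborel. exp (- (\<i> * complex_of_real (t * s))) * complex_of_real (exp (- (t\<^sup>2 / 2))))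
     = (LINT t|lborel. complex_of_real (sqrt (2 * pi)) * (std_normal_density t *\<^sub>R iexp (- s * t)))"
    unfolding d by (intro Bochner_Integration.integral_cong refl) (simp add: scaleR_conv_of_real mult_ac)
  show ?E unfolding 2 integral_mult_right_zero 1[symmetric] by simp
qed

lemma gauss_fourier:
  fixes \<xi> :: "real^'n::finite"
  shows "integrable lborel (\<lambda>x. chr \<xi> x * complex_of_real (gauss x))"
    and "(LINT x|lborel. chr \<xi> x * complex_of_real (gauss x)) = complex_of_real (sqrt (2 * pi) ^ CARD('n) * gauss \<xi>)"
proof -
  let ?f = "\<lambda>b t. exp (- (\<i> * complex_of_real (t * (\<xi> \<bullet> b)))) * complex_of_real (exp (- (t\<^sup>2 / 2)))"
  have nsq: "(norm x)\<^sup>2 = (\<Sum>b\<in>Basis. (x \<bullet> b)\<^sup>2)" for x :: "real^'n"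
    unfolding power2_norm_eq_inner by (simp add: euclidean_inner[of x x] power2_eq_square)
  have g: "gauss x = (\<Prod>b\<in>Basis. exp (- ((x \<bullet> b)\<^sup>2 / 2)))" for x :: "real^'n"
    by (simp add: gauss_def nsq sum_divide_distrib exp_sum flip: sum_negf)
  have c: "chr \<xi> x = (\<Prod>b\<in>Basis. exp (- (\<i> * complex_of_real ((x \<bullet> b) * (\<xi> \<bullet> b)))))" for x
    by (simp add: chr_def euclidean_inner[of x \<xi>] sum_distrib_left exp_sum flip: sum_negf)
  have e: "chr \<xi> x * complex_of_real (gauss x) = (\<Prod>b\<in>Basis. ?f b (x \<bullet> b))" for x
    unfolding c g by (simp add: prod.distrib)
  show "integrable lborel (\<lambda>x. chr \<xi> x * complex_of_real (gauss x))"
    unfolding e by (rule lborel_product_integral(1)) (rule gauss_fourier_1d(1))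
  have "(LINT x|lborel. chr \<xi> x * complex_of_real (gauss x)) =
     (\<Prod>b\<in>Basis. complex_of_real (sqrt (2 * pi) * exp (- ((\<xi> \<bullet> b)\<^sup>2 / 2))))"
    unfolding e by (subst lborel_product_integral(2)) (simp_all only: gauss_fourier_1d)
  also have "\<dots> = complex_of_real (sqrt (2 * pi) ^ CARD('n) * gauss \<xi>)"
    unfolding g by (simp add: prod.distrib)
  finally show "(LINT x|lborel. chr \<xi> x * complex_of_real (gauss x)) = complex_of_real (sqrt (2 * pi) ^ CARD('n) * gauss \<xi>)" .
qed

lemma gauss_integrable: "integrable lborel (gauss :: real^'n::finite \<Rightarrow> real)"
  and gauss_integral: "(LINT x|lborel. gauss (x :: real^'n)) = sqrt (2 * pi) ^ CARD('n)"
proof -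
  have i: "integrable lborel (\<lambda>x :: real^'n. complex_of_real (gauss x))" using gauss_fourier(1)[of 0] by simp
  from integrable_norm[OF this] show "integrable lborel (gauss :: real^'n \<Rightarrow> real)"
    by (simp add: gauss_bounds)
  have "complex_of_real (LINT x|lborel. gauss (x :: real^'n)) = complex_of_real (sqrt (2 * pi) ^ CARD('n) * gauss (0 :: real^'n))"
    using gauss_fourier(2)[of "0 :: real^'n"] by (simp del: of_real_mult of_real_power)
  then show "(LINT x|lborel. gauss (x :: real^'n)) = sqrt (2 * pi) ^ CARD('n)"
    unfolding of_real_eq_iff using gauss_def[of "0 :: real^'n"] by simp
qed

lemma lborel_integral_affine:
  fixes f :: "'a::euclidean_space \<Rightarrow> 'b::{banach, second_countable_topology}"
  assumes [measurable]: "f \<in> borel_measurable borel" and c: "c \<noteq> 0"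
  shows "(LINT x|lborel. f x) = \<bar>c\<bar> ^ DIM('a) *\<^sub>R (LINT x|lborel. f (t + c *\<^sub>R x))"
    and "integrable lborel f \<longleftrightarrow> integrable lborel (\<lambda>x. f (t + c *\<^sub>R x))"
proof -
  show "(LINT x|lborel. f x) = \<bar>c\<bar> ^ DIM('a) *\<^sub>R (LINT x|lborel. f (t + c *\<^sub>R x))"
    by (subst lborel_affine[OF c, of t], subst integral_density, simp, simp, simp, subst integral_distr) auto
  have "integrable lborel f \<longleftrightarrow> integrable lborel (\<lambda>x. \<bar>c\<bar> ^ DIM('a) *\<^sub>R f (t + c *\<^sub>R x))"
    by (subst lborel_affine[OF c, of t], subst integrable_density, simp, simp, simp, subst integrable_distr_eq) auto
  then show "integrable lborel f \<longleftrightarrow> integrable lborel (\<lambda>x. f (t + c *\<^sub>R x))"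
    using c integrable_scaleR_right[of "1 / \<bar>c\<bar> ^ DIM('a)" lborel "\<lambda>x. \<bar>c\<bar> ^ DIM('a) *\<^sub>R f (t + c *\<^sub>R x)"]
      integrable_scaleR_right[of "\<bar>c\<bar> ^ DIM('a)" lborel "\<lambda>x. f (t + c *\<^sub>R x)"] by auto
qed

lemma lborel_pair_product_integrable:
  fixes f g :: "'a::euclidean_space \<Rightarrow> complex"
  assumes "integrable lborel f" "integrable lborel g"
  shows "integrable (lborel \<Otimes>\<^sub>M lborel) (\<lambda>(x, y). f x * g y)"
proof -
  have [measurable]: "f \<in> borel_measurable borel" "g \<in> borel_measurable borel"
    using assms[THEN borel_measurable_integrable] by simp_all
  show ?thesis
  proof (rule lborel_pair.Fubini_integrable)
    show "(\<lambda>(x, y). f x * g y) \<in> borel_measurable (lborel \<Otimes>\<^sub>M lborel)" by measurable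
    show "integrable lborel (\<lambda>x. LINT y|lborel. norm (case (x, y) of (x, y) \<Rightarrow> f x * g y))"
      using assms by (simp add: norm_mult)
    show "AE x in lborel. integrable lborel (\<lambda>y. case (x, y) of (x, y) \<Rightarrow> f x * g y)"
      using assms by simp
  qed
qed

lemma chr_scaleR: "chr (c *\<^sub>R \<xi>) x = chr \<xi> (c *\<^sub>R x)"
  by (simp add: chr_def)

text \<open>Insert the convergence factor \<open>gauss (r\<^sub>k \<xi>)\<close> with \<open>r\<^sub>k \<rightarrow> 0\<close>.  Fubini's theorem then turns the integral into
  an average of \<open>\<phi>\<close> around \<open>x\<close> with a Gaussian weight of width \<open>r\<^sub>k\<close>, which tends to a multiple of \<open>\<phi> x\<close>.\<close>

theorem fourier_inversion:
  fixes \<phi> :: "real^'n::finite \<Rightarrow> complex"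
  assumes \<phi>: "\<phi> \<in> schwartz"
  shows "(LINT \<xi>|lborel. chr (- x) \<xi> * fourier_fun \<phi> \<xi>) = complex_of_real ((2 * pi) ^ CARD('n)) * \<phi> x"
proof -
  let ?c = "sqrt (2 * pi) ^ CARD('n)"
  note m\<phi>[measurable] = schwartz_measurable[OF \<phi>]
  have F: "fourier_fun \<phi> \<in> schwartz" by (rule fourier_fun_schwartz[OF \<phi>])
  note [measurable] = schwartz_measurable[OF F]
  obtain B where B: "\<And>y. norm (\<phi> y) \<le> B"
    using schwartz_obtain_bound[OF \<phi>, of 0] schwartz_boundD[of 0 _ \<phi> "[]"] by (metis iter_partial_Nil list.size(3) mult_1 order_refl power_0)
  define r where "r k = inverse (real (Suc k))" for k
  have r: "0 < r k" for k by (simp add: r_def)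
  have r0: "r \<longlonglongrightarrow> 0" unfolding r_def[abs_def] by (rule LIMSEQ_inverse_real_of_nat)
  define a where "a k = (LINT \<xi>|lborel. chr (- x) \<xi> * fourier_fun \<phi> \<xi> * complex_of_real (gauss (r k *\<^sub>R \<xi>)))" for k
  have g1: "(\<lambda>k. gauss (r k *\<^sub>R \<xi>)) \<longlonglongrightarrow> 1" for \<xi> :: "real^'n"
  proof -
    have "(\<lambda>k. exp (- ((norm (r k *\<^sub>R \<xi>))\<^sup>2 / 2))) \<longlonglongrightarrow> exp (- ((norm (0 *\<^sub>R \<xi>))\<^sup>2 / 2))"
      by (intro tendsto_intros r0) simp
    then show ?thesis by (simp add: gauss_def)
  qed
  have lim1: "a \<longlonglongrightarrow> (LINT \<xi>|lborel. chr (- x) \<xi> * fourier_fun \<phi> \<xi>)"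
    unfolding a_def
  proof (rule integral_dominated_convergence)
    show "integrable lborel (\<lambda>\<xi>. norm (fourier_fun \<phi> \<xi>))" by (intro integrable_norm schwartz_integrable F)
    show "AE \<xi> in lborel. (\<lambda>k. chr (- x) \<xi> * fourier_fun \<phi> \<xi> * complex_of_real (gauss (r k *\<^sub>R \<xi>)))
       \<longlonglongrightarrow> chr (- x) \<xi> * fourier_fun \<phi> \<xi>"
    proof (rule AE_I2)
      fix \<xi>
      have "(\<lambda>k. chr (- x) \<xi> * fourier_fun \<phi> \<xi> * complex_of_real (gauss (r k *\<^sub>R \<xi>)))
       \<longlonglongrightarrow> chr (- x) \<xi> * fourier_fun \<phi> \<xi> * complex_of_real 1"
        by (intro tendsto_mult tendsto_const tendsto_of_real g1)
      then show "(\<lambda>k. chr (- x) \<xi> * fourier_fun \<phi> \<xi> * complex_of_real (gauss (r k *\<^sub>R \<xi>)))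
       \<longlonglongrightarrow> chr (- x) \<xi> * fourier_fun \<phi> \<xi>" by simp
    qed
  qed (auto simp: norm_mult gauss_bounds intro!: mult_left_le)
  \<comment> \<open>the weighted integral is a Gaussian average of \<open>\<phi>\<close>\<close>
  have a_eq: "a k = complex_of_real ?c * (LINT z|lborel. \<phi> (x + r k *\<^sub>R z) * complex_of_real (gauss z))" for k
  proof -
    define h where "h \<xi> = complex_of_real (gauss (r k *\<^sub>R \<xi>))" for \<xi> :: "real^'n"
    have [measurable]: "h \<in> borel_measurable borel" unfolding h_def by measurable
    have "integrable lborel (\<lambda>\<xi>::real^'n. gauss (0 + r k *\<^sub>R \<xi>))"
      by (subst lborel_integral_affine(2)[symmetric]) (use r[of k] gauss_integrable in auto)
    then have hi: "integrable lborel h" unfolding h_def by simp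
    have "a k = (LINT \<xi>|lborel. (LINT y|lborel. chr \<xi> (y - x) * (h \<xi> * \<phi> y)))"
    proof -
      have "chr (- x) \<xi> * fourier_fun \<phi> \<xi> * h \<xi> = (LINT y|lborel. chr \<xi> (y - x) * (h \<xi> * \<phi> y))" for \<xi>
      proof -
        have "(LINT y|lborel. chr \<xi> (y - x) * (h \<xi> * \<phi> y)) = (LINT y|lborel. (chr (- x) \<xi> * h \<xi>) * (chr \<xi> y * \<phi> y))"
        proof (intro Bochner_Integration.integral_cong refl)
          fix y
          have "chr \<xi> (y - x) = chr \<xi> y * chr (- x) \<xi>"
            using chr_add_left[of \<xi> y "- x"] by (simp add: chr_commute[of \<xi> "- x"])
          then show "chr \<xi> (y - x) * (h \<xi> * \<phi> y) = (chr (- x) \<xi> * h \<xi>) * (chr \<xi> y * \<phi> y)" by simp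
        qed
        then show ?thesis by (simp add: fourier_fun_lborel[OF m\<phi>])
      qed
      then show ?thesis unfolding a_def h_def[symmetric] by simp
    qed
    also have "\<dots> = (LINT y|lborel. (LINT \<xi>|lborel. chr \<xi> (y - x) * (h \<xi> * \<phi> y)))"
    proof (rule lborel_pair.Fubini_integral[symmetric], rule Bochner_Integration.integrable_bound)
      show "integrable (lborel \<Otimes>\<^sub>M lborel) (\<lambda>(\<xi>, y). h \<xi> * \<phi> y)"
        by (rule lborel_pair_product_integrable[OF hi schwartz_integrable[OF \<phi>]])
      show "case_prod (\<lambda>\<xi> y. chr \<xi> (y - x) * (h \<xi> * \<phi> y)) \<in> borel_measurable (lborel \<Otimes>\<^sub>M lborel)"
        unfolding chr_def by measurable
    qed (auto simp: norm_mult)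
    also have "\<dots> = (LINT y|lborel. complex_of_real (?c * (1 / r k ^ CARD('n)) * gauss ((1 / r k) *\<^sub>R (y - x))) * \<phi> y)"
    proof (intro Bochner_Integration.integral_cong refl)
      fix y
      let ?t = "(1 / r k) *\<^sub>R (y - x)"
      have "(LINT \<xi>|lborel. chr \<xi> (y - x) * (h \<xi> * \<phi> y)) = (LINT \<xi>|lborel. chr (y - x) \<xi> * h \<xi>) * \<phi> y"
        by (simp add: chr_commute[of _ "y - x"] flip: mult.assoc)
      moreover have "complex_of_real ?c * complex_of_real (gauss ?t) = (LINT \<zeta>|lborel. chr ?t \<zeta> * complex_of_real (gauss \<zeta>))"
        using gauss_fourier(2)[of ?t] by simp
      moreover have "\<dots> = \<bar>r k\<bar> ^ DIM(real^'n) *\<^sub>R (LINT \<xi>|lborel. chr ?t (0 + r k *\<^sub>R \<xi>) * complex_of_real (gauss (0 + r k *\<^sub>R \<xi>)))"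
        by (rule lborel_integral_affine(1)) (use r[of k] in auto)
      moreover have "chr ?t (0 + r k *\<^sub>R \<xi>) * complex_of_real (gauss (0 + r k *\<^sub>R \<xi>)) = chr (y - x) \<xi> * h \<xi>" for \<xi>
        using r[of k] by (simp add: chr_scaleR h_def)
      ultimately show "(LINT \<xi>|lborel. chr \<xi> (y - x) * (h \<xi> * \<phi> y)) = complex_of_real (?c * (1 / r k ^ CARD('n)) * gauss ?t) * \<phi> y"
        using r[of k] by (simp add: scaleR_conv_of_real field_simps)
    qed
    also have "\<dots> = \<bar>r k\<bar> ^ DIM(real^'n) *\<^sub>R (LINT z|lborel. complex_of_real (?c * (1 / r k ^ CARD('n)) * gauss ((1 / r k) *\<^sub>R ((x + r k *\<^sub>R z) - x))) * \<phi> (x + r k *\<^sub>R z))"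
      by (rule lborel_integral_affine(1)) (use r[of k] in auto)
    also have "\<dots> = (LINT z|lborel. \<bar>r k\<bar> ^ DIM(real^'n) *\<^sub>R (complex_of_real (?c * (1 / r k ^ CARD('n)) * gauss ((1 / r k) *\<^sub>R ((x + r k *\<^sub>R z) - x))) * \<phi> (x + r k *\<^sub>R z)))"
      by simp
    also have "\<dots> = (LINT z|lborel. complex_of_real ?c * (\<phi> (x + r k *\<^sub>R z) * complex_of_real (gauss z)))"
      using r[of k] by (intro Bochner_Integration.integral_cong refl) (simp add: scaleR_conv_of_real[where 'a=complex])
    finally show ?thesis by simp
  qed
  have "(\<lambda>k. complex_of_real ?c * (LINT z|lborel. \<phi> (x + r k *\<^sub>R z) * complex_of_real (gauss z)))
    \<longlonglongrightarrow> complex_of_real ?c * (LINT z|lborel. \<phi> x * complex_of_real (gauss (z :: real^'n)))"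
  proof (intro tendsto_mult tendsto_const integral_dominated_convergence)
    show "integrable lborel (\<lambda>z :: real^'n. B * gauss z)" by (intro integrable_mult_right gauss_integrable)
    show "AE z in lborel. (\<lambda>k. \<phi> (x + r k *\<^sub>R z) * complex_of_real (gauss z)) \<longlonglongrightarrow> \<phi> x * complex_of_real (gauss z)"
    proof (intro AE_I2 tendsto_mult tendsto_const)
      fix z
      have "(\<lambda>k. x + r k *\<^sub>R z) \<longlonglongrightarrow> x + 0 *\<^sub>R z" by (intro tendsto_intros r0)
      moreover have "isCont \<phi> x"
        using smooth_continuous_on[OF schwartz_smooth[OF \<phi>], of UNIV] by (simp add: continuous_on_eq_continuous_at)
      ultimately show "(\<lambda>k. \<phi> (x + r k *\<^sub>R z)) \<longlonglongrightarrow> \<phi> x"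
        by (intro isCont_tendsto_compose[of x \<phi>]) simp_all
    qed
    show "AE z in lborel. norm (\<phi> (x + r k *\<^sub>R z) * complex_of_real (gauss z)) \<le> B * gauss z" for k
      by (rule AE_I2) (auto simp: norm_mult gauss_bounds intro!: mult_right_mono B)
  qed simp_all
  then have "a \<longlonglongrightarrow> complex_of_real ?c * (LINT z|lborel. \<phi> x * complex_of_real (gauss (z :: real^'n)))"
    by (simp add: a_eq[abs_def])
  moreover have "complex_of_real ?c * (LINT z|lborel. \<phi> x * complex_of_real (gauss (z :: real^'n)))
      = complex_of_real ((2 * pi) ^ CARD('n)) * \<phi> x"
  proof -
    have "?c * ?c = (2 * pi) ^ CARD('n)"
      unfolding power_mult_distrib[symmetric] by simp
    then have "complex_of_real ((2 * pi) ^ CARD('n)) = complex_of_real ?c * complex_of_real ?c"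
      by (simp only: of_real_mult[symmetric])
    moreover have "(LINT z|lborel. \<phi> x * complex_of_real (gauss (z :: real^'n))) = \<phi> x * complex_of_real ?c"
      by (simp only: integral_mult_right_zero integral_complex_of_real gauss_integral)
    ultimately show ?thesis by (simp only: mult_ac)
  qed
  ultimately show ?thesis using LIMSEQ_unique[OF lim1] by simp
qed

section \<open>A locally integrable function is determined by its integrals against test functions\<close>

text \<open>The positive and the negative part of \<open>h\<close> are the densities of two finite measures that agree on boxes,
  hence on all Borel sets.\<close>

lemma AE_eq_0_if_box_integrals_eq_0:
  fixes h :: "'a::euclidean_space \<Rightarrow> real"
  assumes h: "integrable lborel h"
    and z: "\<And>a b. (LINT x|lborel. indicator (box a b) x * h x) = 0"
  shows "AE x in lborel. h x = 0"
proof -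
  have [measurable]: "h \<in> borel_measurable borel" using borel_measurable_integrable[OF h] by simp
  have fin: "(\<integral>\<^sup>+x. ennreal (h x) \<partial>lborel) < \<infinity>" "(\<integral>\<^sup>+x. ennreal (- h x) \<partial>lborel) < \<infinity>"
    using h by (auto simp: real_integrable_def less_top)
  have "density lborel (\<lambda>x. ennreal (h x)) = density lborel (\<lambda>x. ennreal (- h x))" (is "?M = ?N")
  proof (rule measure_eqI_generator_eq)
    let ?E = "range (\<lambda>(a, b). box a b::'a set)"
    show "Int_stable ?E"
      by (auto simp: Int_stable_def box_Int_box)
    show "?E \<subseteq> Pow UNIV" "sets ?M = sigma_sets UNIV ?E" "sets ?N = sigma_sets UNIV ?E"
      by (simp_all add: borel_eq_box)
    let ?A = "\<lambda>n::nat. box (- (real n *\<^sub>R One)) (real n *\<^sub>R One) :: 'a set"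
    show "range ?A \<subseteq> ?E" "(\<Union>i. ?A i) = UNIV"
      unfolding UN_box_eq_UNIV by auto
    have em: "emeasure (density lborel (\<lambda>x. ennreal (s * h x))) X = (\<integral>\<^sup>+x. ennreal (s * (indicator X x * h x)) \<partial>lborel)"
      if "X \<in> sets borel" for X s
    proof -
      have "ennreal (s * h x) * indicator X x = ennreal (s * (indicator X x * h x))" for x
        by (cases "x \<in> X") auto
      then show ?thesis using that by (simp add: emeasure_density)
    qed
    show "emeasure ?M (?A i) \<noteq> \<infinity>" for i
    proof -
      have "emeasure ?M (?A i) \<le> emeasure ?M (space ?M)" by (rule emeasure_space)
      also have "\<dots> < \<infinity>" using fin by (simp add: emeasure_density)
      finally show ?thesis by simp
    qed
    show "emeasure ?M X = emeasure ?N X" if "X \<in> ?E" for X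
    proof -
      from that obtain p where "X = (\<lambda>(a, b). box a b) p" by blast
      then obtain a b where X: "X = box a b" by (cases p) simp
      then have Xs[measurable]: "X \<in> sets borel" by simp
      have i: "integrable lborel (\<lambda>x. indicator X x * h x)"
        using integrable_mult_indicator[OF _ h, of X] by simp
      have eq: "P = N" if "0 = enn2real P - enn2real N" "P \<noteq> \<infinity>" "N \<noteq> \<infinity>" for P N
        using that by (cases P; cases N) auto
      have ne: "(\<integral>\<^sup>+x. ennreal (indicator X x * h x) \<partial>lborel) \<noteq> \<infinity>" "(\<integral>\<^sup>+x. ennreal (- (indicator X x * h x)) \<partial>lborel) \<noteq> \<infinity>"
        using i by (auto simp: real_integrable_def)
      have "0 = enn2real (\<integral>\<^sup>+x. ennreal (indicator X x * h x) \<partial>lborel) - enn2real (\<integral>\<^sup>+x. ennreal (- (indicator X x * h x)) \<partial>lborel)"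
        using real_lebesgue_integral_def[OF i] z[of a b] by (simp add: X)
      then have "(\<integral>\<^sup>+x. ennreal (indicator X x * h x) \<partial>lborel) = (\<integral>\<^sup>+x. ennreal (- (indicator X x * h x)) \<partial>lborel)"
        using ne eq by blast
      then show ?thesis using em[OF Xs, of 1] em[OF Xs, of "-1"] by simp
    qed
  qed
  then have "AE x in lborel. ennreal (h x) = ennreal (- h x)"
    using fin by (subst (asm) finite_density_unique) auto
  then show ?thesis
  proof eventually_elim
    case (elim x)
    have "h x \<le> 0 \<longleftrightarrow> - h x \<le> 0"
      unfolding ennreal_eq_0_iff[symmetric] elim ..
    then show ?case by linarith
  qed
qed

text \<open>Test functions that converge boundedly to the indicator of an open box: the slopes of the transitions
  tend to infinity while the support stays in the closed box.\<close>

definition box_approx :: "nat \<Rightarrow> real^'n::finite \<Rightarrow> real^'n \<Rightarrow> real^'n \<Rightarrow> complex" where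
  "box_approx n a b x = (\<Prod>i\<in>UNIV. complex_of_real (step (real n * x $ i + (- (real n * a $ i)))) *
     complex_of_real (step ((- real n) * x $ i + real n * b $ i)))"

lemma box_approx_bound: "norm (box_approx n a b x) \<le> 1"
  unfolding box_approx_def prod_norm[symmetric]
  by (intro prod_le_1) (auto simp: norm_mult step_bounds intro!: mult_le_one)

lemma box_approx_outside: "x \<notin> box a b \<Longrightarrow> box_approx n a b x = 0"
proof -
  assume "x \<notin> box a b"
  then obtain i where i: "x $ i \<le> a $ i \<or> b $ i \<le> x $ i" by (force simp: mem_box_cart not_less)
  have "real n * x $ i + (- (real n * a $ i)) \<le> 0 \<or> (- real n) * x $ i + real n * b $ i \<le> 0"
    using i by (auto intro: mult_left_mono)
  then have "complex_of_real (step (real n * x $ i + (- (real n * a $ i)))) *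
     complex_of_real (step ((- real n) * x $ i + real n * b $ i)) = 0"
    by (auto simp: step_0)
  then show ?thesis unfolding box_approx_def by (intro prod_zero) auto
qed

lemma test_box_approx: "box_approx n a b \<in> test_functions"
proof (rule testI)
  show "smooth (box_approx n a b)"
    unfolding box_approx_def[abs_def] by (intro smooth_prod smooth_mult smooth_step)
  show "compact (cbox a b)" by simp
  show "box_approx n a b x = 0" if "x \<notin> cbox a b" for x
    using that box_subset_cbox[of a b] by (intro box_approx_outside) auto
qed

lemma box_approx_tendsto: "(\<lambda>n. box_approx n a b x) \<longlonglongrightarrow> indicator (box a b) x"
proof (cases "x \<in> box a b")
  case True
  have "\<forall>\<^sub>F n in sequentially. complex_of_real (step (real n * x $ i + (- (real n * a $ i)))) *
     complex_of_real (step ((- real n) * x $ i + real n * b $ i)) = 1" for i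
  proof -
    have p: "0 < x $ i - a $ i" "0 < b $ i - x $ i" using True by (auto simp: mem_box_cart)
    obtain N1 where N1: "1 < real N1 * (x $ i - a $ i)" using ex_less_of_nat_mult[OF p(1)] by blast
    obtain N2 where N2: "1 < real N2 * (b $ i - x $ i)" using ex_less_of_nat_mult[OF p(2)] by blast
    show ?thesis
    proof (rule eventually_sequentiallyI[of "max N1 N2"])
      fix n assume n: "max N1 N2 \<le> n"
      have "1 \<le> real n * (x $ i - a $ i)"
        by (intro order_trans[OF less_imp_le[OF N1]] mult_right_mono) (use p n in auto)
      moreover have "1 \<le> real n * (b $ i - x $ i)"
        by (intro order_trans[OF less_imp_le[OF N2]] mult_right_mono) (use p n in auto)
      ultimately have "1 \<le> real n * x $ i + (- (real n * a $ i))" "1 \<le> (- real n) * x $ i + real n * b $ i"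
        by (simp_all add: algebra_simps)
      then show "complex_of_real (step (real n * x $ i + (- (real n * a $ i)))) *
         complex_of_real (step ((- real n) * x $ i + real n * b $ i)) = 1" by (simp only: step_1 of_real_1 mult_1)
    qed
  qed
  then have "\<forall>\<^sub>F n in sequentially. \<forall>i\<in>UNIV. complex_of_real (step (real n * x $ i + (- (real n * a $ i)))) *
     complex_of_real (step ((- real n) * x $ i + real n * b $ i)) = 1"
    by (intro eventually_ball_finite) auto
  then have "\<forall>\<^sub>F n in sequentially. box_approx n a b x = 1"
    by eventually_elim (simp only: box_approx_def prod.neutral)
  then show ?thesis using True by (simp add: tendsto_eventually)
next
  case False then show ?thesis by (simp add: box_approx_outside)
qed

lemma AE_eq_0_if_test_integrals_eq_0:
  fixes f :: "real^'n::finite \<Rightarrow> complex"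
  assumes li: "\<And>K. compact K \<Longrightarrow> f absolutely_integrable_on K"
    and z: "\<And>\<phi>. \<phi> \<in> test_functions \<Longrightarrow> (LINT x|lebesgue. f x * \<phi> x) = 0"
  shows "AE x in lebesgue. f x = 0"
proof -
  have box0: "(LINT x|lebesgue. indicator (box a b) x *\<^sub>R f x) = 0" for a b
  proof -
    have i: "integrable lebesgue (\<lambda>x. indicator (cbox a b) x *\<^sub>R f x)"
      using li[of "cbox a b"] by (simp add: set_integrable_def)
    have [measurable]: "box_approx n a b \<in> borel_measurable lebesgue" for n
      using smooth_borel_measurable[OF test_smooth[OF test_box_approx]] by (intro measurable_completion) simp
    have "(\<lambda>n. LINT x|lebesgue. (indicator (cbox a b) x *\<^sub>R f x) * box_approx n a b x) \<longlonglongrightarrow>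
      (LINT x|lebesgue. (indicator (cbox a b) x *\<^sub>R f x) * indicator (box a b) x)"
    proof (rule integral_dominated_convergence)
      show "integrable lebesgue (\<lambda>x. norm (indicator (cbox a b) x *\<^sub>R f x))" by (intro integrable_norm i)
      show "AE x in lebesgue. (\<lambda>n. (indicator (cbox a b) x *\<^sub>R f x) * box_approx n a b x) \<longlonglongrightarrow>
        (indicator (cbox a b) x *\<^sub>R f x) * indicator (box a b) x"
        by (intro AE_I2 tendsto_mult tendsto_const box_approx_tendsto)
      show "AE x in lebesgue. norm ((indicator (cbox a b) x *\<^sub>R f x) * box_approx n a b x) \<le> norm (indicator (cbox a b) x *\<^sub>R f x)" for n
        unfolding norm_mult by (intro AE_I2 mult_left_le box_approx_bound) simp
      show "(\<lambda>x. (indicator (cbox a b) x *\<^sub>R f x) * indicator (box a b) x) \<in> borel_measurable lebesgue"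
        by (rule borel_measurable_times[OF borel_measurable_integrable[OF i] borel_measurable_indicator]) simp
      show "(\<lambda>x. (indicator (cbox a b) x *\<^sub>R f x) * box_approx n a b x) \<in> borel_measurable lebesgue" for n
        by (rule borel_measurable_times[OF borel_measurable_integrable[OF i]]) measurable
    qed
    moreover have "(indicator (cbox a b) x *\<^sub>R f x) * box_approx n a b x = f x * box_approx n a b x" for n x
      using box_subset_cbox[of a b] box_approx_outside[of x a b n] by (cases "x \<in> cbox a b") auto
    moreover have "(indicator (cbox a b) x *\<^sub>R f x) * indicator (box a b) x = indicator (box a b) x *\<^sub>R f x" for x
      using box_subset_cbox[of a b] by (auto simp: indicator_def)
    ultimately show ?thesis
      using z[OF test_box_approx] LIMSEQ_unique[OF _ tendsto_const] by simp
  qed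
  \<comment> \<open>real and imaginary part separately, on bounded boxes and with a Borel representative\<close>
  have re: "AE x in lborel. x \<in> box (- v) v \<longrightarrow> g (f x) = 0"
    if g: "bounded_linear g" for g :: "complex \<Rightarrow> real" and v :: "real^'n"
  proof -
    have i: "integrable lebesgue (\<lambda>x. indicator (box (- v) v) x *\<^sub>R f x)"
    proof -
      have "integrable lebesgue (\<lambda>x. indicator (box (- v) v) x *\<^sub>R (indicator (cbox (- v) v) x *\<^sub>R f x))"
        by (rule integrable_mult_indicator) (use li[of "cbox (- v) v"] in \<open>auto simp: set_integrable_def\<close>)
      also have "(\<lambda>x. indicator (box (- v) v) x *\<^sub>R (indicator (cbox (- v) v) x *\<^sub>R f x)) = (\<lambda>x. indicator (box (- v) v) x *\<^sub>R f x)"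
        using box_subset_cbox[of "- v" v] by (auto simp: indicator_def fun_eq_iff)
      finally show ?thesis .
    qed
    define h where "h x = g (indicator (box (- v) v) x *\<^sub>R f x)" for x
    have hi: "integrable lebesgue h" unfolding h_def by (rule integrable_bounded_linear[OF g i])
    obtain h' where h'[measurable]: "h' \<in> borel_measurable lborel" and ae: "AE x in lborel. h x = h' x"
      using completion_ex_borel_measurable_real[OF borel_measurable_integrable[OF hi]] by blast
    have ae': "AE x in lebesgue. h x = h' x" using ae by (rule AE_completion)
    have m1: "h' \<in> borel_measurable lebesgue" by (rule measurable_completion[OF h'])
    have m2: "h \<in> borel_measurable lebesgue" by (rule borel_measurable_integrable[OF hi])
    have hi': "integrable lborel h'"
      using hi integrable_cong_AE[of h lebesgue h'] m1 m2 ae' by (simp add: integrable_completion)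
    have "AE x in lborel. h' x = 0"
    proof (rule AE_eq_0_if_box_integrals_eq_0[OF hi'])
      fix a b :: "real^'n"
      have "(LINT x|lborel. indicator (box a b) x * h' x) = (LINT x|lebesgue. indicator (box a b) x * h' x)"
        by (rule integral_completion[symmetric]) simp
      also have "\<dots> = (LINT x|lebesgue. indicator (box a b) x * h x)"
      proof (rule integral_cong_AE)
        show "(\<lambda>x. indicator (box a b) x * h' x) \<in> borel_measurable lebesgue"
          "(\<lambda>x. indicator (box a b) x * h x) \<in> borel_measurable lebesgue"
          by (rule borel_measurable_times[OF borel_measurable_indicator m1], simp,
              rule borel_measurable_times[OF borel_measurable_indicator m2], simp)
      qed (use ae' in auto)
      also have "\<dots> = (LINT x|lebesgue. g (indicator (box a b \<inter> box (- v) v) x *\<^sub>R f x))"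
        using linear_simps[OF g] by (intro Bochner_Integration.integral_cong refl) (simp add: h_def indicator_def)
      also have "\<dots> = g (LINT x|lebesgue. indicator (box a b \<inter> box (- v) v) x *\<^sub>R f x)"
      proof (rule integral_bounded_linear[OF g])
        have "integrable lebesgue (\<lambda>x. indicator (box a b) x *\<^sub>R (indicator (box (- v) v) x *\<^sub>R f x))"
          by (intro integrable_mult_indicator i) simp
        then show "integrable lebesgue (\<lambda>x. indicator (box a b \<inter> box (- v) v) x *\<^sub>R f x)"
          by (simp add: indicator_inter_arith)
      qed
      also have "\<dots> = 0" by (simp add: box_Int_box box0 linear_simps[OF g])
      finally show "(LINT x|lborel. indicator (box a b) x * h' x) = 0" .
    qed
    with ae show ?thesis
      by eventually_elim (auto simp: h_def)
  qed
  have "AE x in lborel. x \<in> box (- (real n *\<^sub>R One)) (real n *\<^sub>R One) \<longrightarrow> f x = 0" for n :: nat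
    using re[OF bounded_linear_Re, of "real n *\<^sub>R One"] re[OF bounded_linear_Im, of "real n *\<^sub>R One"]
    by eventually_elim (auto simp: complex_eq_iff)
  then have "AE x in lborel. \<forall>n::nat. x \<in> box (- (real n *\<^sub>R One)) (real n *\<^sub>R One) \<longrightarrow> f x = 0"
    unfolding AE_all_countable by blast
  then have "AE x in lborel. f x = 0"
  proof eventually_elim
    case (elim x)
    have "x \<in> (\<Union>n::nat. box (- (real n *\<^sub>R One)) (real n *\<^sub>R One))"
      unfolding UN_box_eq_UNIV by simp
    with elim show ?case by blast
  qed
  then show ?thesis by (rule AE_completion)
qed

lemma locally_integrable_measurable:
  fixes f :: "real^'n::finite \<Rightarrow> complex"
  assumes li: "\<And>K. compact K \<Longrightarrow> f absolutely_integrable_on K"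
  shows "f \<in> borel_measurable lebesgue"
proof (rule borel_measurable_LIMSEQ_metric)
  show "(\<lambda>x. indicator (cball 0 (real n)) x *\<^sub>R f x) \<in> borel_measurable lebesgue" for n
    using borel_measurable_integrable[OF li[of "cball 0 (real n)", unfolded set_integrable_def]] by simp
  fix x :: "real^'n"
  obtain N :: nat where N: "norm x \<le> real N" using real_arch_simple by blast
  have "\<forall>\<^sub>F n in sequentially. indicator (cball 0 (real n)) x *\<^sub>R f x = f x"
    by (rule eventually_sequentiallyI[of N]) (use N in \<open>auto simp: indicator_def\<close>)
  then show "(\<lambda>n. indicator (cball 0 (real n)) x *\<^sub>R f x) \<longlonglongrightarrow> f x" by (rule tendsto_eventually)
qed

lemma test_mult_integrable:
  assumes li: "\<And>K. compact K \<Longrightarrow> f absolutely_integrable_on K" and \<phi>: "\<phi> \<in> test_functions"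
  shows "integrable lebesgue (\<lambda>x. f x * \<phi> x)"
proof -
  note [measurable] = locally_integrable_measurable[OF li]
  have m[measurable]: "\<phi> \<in> borel_measurable lebesgue"
    using smooth_borel_measurable[OF test_smooth[OF \<phi>]] by (intro measurable_completion) simp
  obtain B where B: "0 \<le> B" "\<And>x. norm (\<phi> x) \<le> B" using test_bounded[OF \<phi>] by metis
  have "integrable lebesgue (\<lambda>x. B *\<^sub>R (indicator (supp \<phi>) x *\<^sub>R f x))"
    using li[OF test_compact[OF \<phi>]] by (intro integrable_scaleR_right) (simp add: set_integrable_def)
  then show ?thesis
  proof (rule Bochner_Integration.integrable_bound)
    show "AE x in lebesgue. norm (f x * \<phi> x) \<le> norm (B *\<^sub>R (indicator (supp \<phi>) x *\<^sub>R f x))"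
    proof (rule AE_I2)
      fix x show "norm (f x * \<phi> x) \<le> norm (B *\<^sub>R (indicator (supp \<phi>) x *\<^sub>R f x))"
        using B notin_supp[of x \<phi>] by (cases "x \<in> supp \<phi>") (auto simp: norm_mult mult.commute intro: mult_right_mono)
    qed
  qed simp
qed

lemma given_by_unique:
  assumes f: "given_by u f" and g: "given_by u g"
  shows "AE x in lebesgue. f x = g x"
proof -
  have li: "f absolutely_integrable_on K" "g absolutely_integrable_on K" if "compact K" for K
    using that f g by (auto simp: given_by_def)
  have "AE x in lebesgue. f x - g x = 0"
  proof (rule AE_eq_0_if_test_integrals_eq_0)
    fix \<phi> :: "real^'a \<Rightarrow> complex" assume \<phi>: "\<phi> \<in> test_functions"
    have "(LINT x|lebesgue. f x * \<phi> x) = (LINT x|lebesgue. g x * \<phi> x)"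
      using f g \<phi> unfolding given_by_def by metis
    then show "(LINT x|lebesgue. (f x - g x) * \<phi> x) = 0"
      using test_mult_integrable[OF li(1) \<phi>] test_mult_integrable[OF li(2) \<phi>]
      by (simp add: left_diff_distrib)
  qed (intro set_integral_diff li)
  then show ?thesis by simp
qed

section \<open>The Fourier transform of a localized distribution\<close>

text \<open>The Fourier transform of \<open>\<psi> u\<close>, defined pointwise, which is possible because \<open>\<psi> u\<close> has compact support.\<close>

definition loc_ft :: "((real^'n::finite \<Rightarrow> complex) \<Rightarrow> complex) \<Rightarrow> (real^'n \<Rightarrow> complex) \<Rightarrow> real^'n \<Rightarrow> complex" where
  "loc_ft u \<psi> \<xi> = u (\<lambda>x. \<psi> x * chr \<xi> x)"

lemma norm_monom_i: "norm (monom_i \<alpha> \<xi>) \<le> bracket \<xi> ^ length \<alpha>"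
proof (induction \<alpha>)
  case (Cons i \<alpha>)
  have "\<bar>\<xi> $ i\<bar> \<le> bracket \<xi>" using component_le_norm_cart[of \<xi> i] norm_le_bracket[of \<xi>] by linarith
  then have "\<bar>\<xi> $ i\<bar> * norm (monom_i \<alpha> \<xi>) \<le> bracket \<xi> * bracket \<xi> ^ length \<alpha>"
    by (intro mult_mono Cons) auto
  then show ?case by (simp add: monom_i_def norm_mult)
qed (simp add: monom_i_def)

lemma norm_monom_i_le: "length \<alpha> \<le> m \<Longrightarrow> norm (monom_i \<alpha> \<xi>) \<le> bracket \<xi> ^ m"
  using norm_monom_i[of \<alpha> \<xi>] bracket_power_mono[of "length \<alpha>" m \<xi>] by linarith

lemma continuous_monom_i: "continuous_on S (monom_i \<alpha>)"
proof (induction \<alpha>)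
  case (Cons i \<alpha>)
  have "monom_i (i # \<alpha>) = (\<lambda>\<xi>. - (\<i> * complex_of_real (\<xi> $ i)) * monom_i \<alpha> \<xi>)"
    by (simp add: monom_i_def fun_eq_iff)
  then show ?case using Cons by (auto intro!: continuous_intros)
qed (simp add: monom_i_def)

lemma monom_i_measurable [measurable]: "monom_i \<alpha> \<in> borel_measurable borel"
  by (rule borel_measurable_continuous_onI[OF continuous_monom_i])

text \<open>An upper bound, uniform for \<open>\<bar>x\<bar> \<le> r\<close>, for the difference of the derivatives of two characters up to order
  \<open>m\<close>; it controls how much \<open>loc_ft\<close> can vary.\<close>

definition chr_dist :: "nat \<Rightarrow> real \<Rightarrow> real^'n::finite \<Rightarrow> real^'n \<Rightarrow> real" where
  "chr_dist m r \<xi> \<eta> = (\<Sum>\<alpha> :: 'n list | length \<alpha> \<le> m.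
     norm (monom_i \<alpha> \<xi> - monom_i \<alpha> \<eta>) + norm (monom_i \<alpha> \<eta>) * (r * norm (\<xi> - \<eta>)))"

lemma chr_dist_measurable [measurable]:
  assumes [measurable]: "f \<in> borel_measurable M" "g \<in> borel_measurable M"
  shows "(\<lambda>x. chr_dist m r (f x) (g x)) \<in> borel_measurable M"
  unfolding chr_dist_def by measurable

lemma norm_chr_diff: "norm (chr \<xi> x - chr \<eta> x) \<le> norm x * norm (\<xi> - \<eta>)"
proof -
  have "chr \<xi> x - chr \<eta> x = chr \<eta> x * (chr (\<xi> - \<eta>) x - 1)"
    using chr_add[of \<eta> "\<xi> - \<eta>" x] by (simp add: algebra_simps)
  then have "norm (chr \<xi> x - chr \<eta> x) = norm (iexp (- (x \<bullet> (\<xi> - \<eta>))) - 1)"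
    by (simp add: norm_mult chr_def)
  also have "\<dots> \<le> \<bar>x \<bullet> (\<xi> - \<eta>)\<bar>" using iexp_approx1[of "- (x \<bullet> (\<xi> - \<eta>))" 0] by simp
  also have "\<dots> \<le> norm x * norm (\<xi> - \<eta>)" by (rule Cauchy_Schwarz_ineq2)
  finally show ?thesis .
qed

lemma monom_chr_diff:
  assumes "length \<alpha> \<le> m" "norm x \<le> r"
  shows "norm (monom_i \<alpha> \<xi> * chr \<xi> x - monom_i \<alpha> \<eta> * chr \<eta> x) \<le> chr_dist m r \<xi> \<eta>"
proof -
  have "monom_i \<alpha> \<xi> * chr \<xi> x - monom_i \<alpha> \<eta> * chr \<eta> x =
     (monom_i \<alpha> \<xi> - monom_i \<alpha> \<eta>) * chr \<xi> x + monom_i \<alpha> \<eta> * (chr \<xi> x - chr \<eta> x)"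
    by (simp add: algebra_simps)
  also have "norm \<dots> \<le> norm (monom_i \<alpha> \<xi> - monom_i \<alpha> \<eta>) + norm (monom_i \<alpha> \<eta>) * (r * norm (\<xi> - \<eta>))"
    by (rule norm_triangle_mono)
       (auto simp: norm_mult intro!: mult_left_mono order_trans[OF norm_chr_diff] mult_right_mono assms)
  also have "\<dots> \<le> chr_dist m r \<xi> \<eta>"
    unfolding chr_dist_def
    using assms finite_multi_indices order_trans[OF norm_ge_zero assms(2)]
    by (intro member_le_sum[where f="\<lambda>\<alpha>. norm (monom_i \<alpha> \<xi> - monom_i \<alpha> \<eta>) + norm (monom_i \<alpha> \<eta>) * (r * norm (\<xi> - \<eta>))"])
       auto
  finally show ?thesis .
qed

lemma chr_dist_tendsto_0:
  assumes "(f \<longlongrightarrow> \<xi>) F" shows "((\<lambda>t. chr_dist m r \<xi> (f t)) \<longlongrightarrow> 0) F"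
proof -
  have m: "((\<lambda>t. monom_i \<alpha> (f t)) \<longlongrightarrow> monom_i \<alpha> \<xi>) F" for \<alpha>
    using continuous_monom_i[of UNIV \<alpha>] assms
    by (intro isCont_tendsto_compose[of \<xi> "monom_i \<alpha>"]) (auto simp: continuous_on_eq_continuous_at)
  have "((\<lambda>t. chr_dist m r \<xi> (f t)) \<longlongrightarrow> chr_dist m r \<xi> \<xi>) F"
    unfolding chr_dist_def by (intro tendsto_intros m assms)
  then show ?thesis by (simp add: chr_dist_def)
qed

lemma chr_dist_bound:
  assumes r: "0 \<le> r" and \<eta>: "norm \<eta> \<le> 2 * norm \<xi>"
  shows "chr_dist m r \<xi> \<eta> \<le> real (card {\<alpha> :: 'n::finite list. length \<alpha> \<le> m}) * ((2 + 3 * r) * 3 ^ m) * bracket (\<xi> :: real^'n) ^ (m + 1)"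
proof -
  have "bracket \<eta> \<le> bracket (2 *\<^sub>R \<xi>)" by (rule bracket_mono) (use \<eta> in simp)
  also have "\<dots> \<le> 3 * bracket \<xi>" using bracket_scaleR_le[of 2 \<xi>] by simp
  finally have b: "bracket \<eta> \<le> 3 * bracket \<xi>" .
  have "norm (monom_i \<alpha> \<xi> - monom_i \<alpha> \<eta>) + norm (monom_i \<alpha> \<eta>) * (r * norm (\<xi> - \<eta>)) \<le> (2 + 3 * r) * 3 ^ m * bracket \<xi> ^ (m + 1)"
    if "length \<alpha> \<le> m" for \<alpha> :: "'n list"
  proof -
    let ?b = "bracket \<xi>"
    have 1: "norm (monom_i \<alpha> \<xi>) \<le> ?b ^ m" by (rule norm_monom_i_le[OF that])
    have "norm (monom_i \<alpha> \<eta>) \<le> bracket \<eta> ^ m" by (rule norm_monom_i_le[OF that])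
    also have "\<dots> \<le> (3 * ?b) ^ m" by (intro power_mono b) simp
    finally have 2: "norm (monom_i \<alpha> \<eta>) \<le> 3 ^ m * ?b ^ m" by (simp add: power_mult_distrib)
    have 3: "norm (\<xi> - \<eta>) \<le> 3 * ?b" using norm_triangle_ineq4[of \<xi> \<eta>] \<eta> norm_le_bracket[of \<xi>] by linarith
    have p: "?b ^ m \<le> 3 ^ m * ?b ^ m" using mult_right_mono[of 1 "3 ^ m" "?b ^ m"] by simp
    have q: "?b ^ m \<le> ?b ^ (m + 1)" by (rule bracket_power_mono) simp
    have "norm (monom_i \<alpha> \<xi> - monom_i \<alpha> \<eta>) \<le> 2 * (3 ^ m * ?b ^ m)"
      using norm_triangle_ineq4[of "monom_i \<alpha> \<xi>" "monom_i \<alpha> \<eta>"] 1 2 p by linarith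
    also have "\<dots> \<le> 2 * (3 ^ m * ?b ^ (m + 1))" using q by (intro mult_left_mono) auto
    finally have A: "norm (monom_i \<alpha> \<xi> - monom_i \<alpha> \<eta>) \<le> 2 * (3 ^ m * ?b ^ (m + 1))" .
    have "norm (monom_i \<alpha> \<eta>) * (r * norm (\<xi> - \<eta>)) \<le> (3 ^ m * ?b ^ m) * (r * (3 * ?b))"
      using r by (intro mult_mono mult_left_mono 2 3) auto
    also have "\<dots> = 3 * r * (3 ^ m * ?b ^ (m + 1))" by simp
    finally show ?thesis using A by (simp add: algebra_simps)
  qed
  then have "chr_dist m r \<xi> \<eta> \<le> (\<Sum>\<alpha> :: 'n list | length \<alpha> \<le> m. (2 + 3 * r) * 3 ^ m * bracket \<xi> ^ (m + 1))"
    unfolding chr_dist_def by (intro sum_mono) simp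
  then show ?thesis by simp
qed

lemma chr_dist_nonneg: "0 \<le> r \<Longrightarrow> 0 \<le> chr_dist m r \<xi> \<eta>"
  unfolding chr_dist_def by (intro sum_nonneg) auto

lemma loc_ft_estimates:
  assumes u: "u \<in> distributions" and \<psi>: "\<psi> \<in> test_functions"
  obtains C m r where "0 \<le> C" "0 \<le> r" "\<And>\<xi>. norm (loc_ft u \<psi> \<xi>) \<le> C * bracket \<xi> ^ m"
    "\<And>\<xi> \<eta>. norm (loc_ft u \<psi> \<xi> - loc_ft u \<psi> \<eta>) \<le> C * chr_dist m r \<xi> \<eta>"
    "\<And>h B. smooth h \<Longrightarrow> 0 \<le> B \<Longrightarrow>
     (\<And>\<alpha> x. length \<alpha> \<le> m \<Longrightarrow> norm x \<le> r \<Longrightarrow> norm (iter_partial \<alpha> h x) \<le> B) \<Longrightarrow> norm (u (\<lambda>x. \<psi> x * h x)) \<le> C * B"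
proof -
  obtain r where r: "0 < r" "\<And>x. x \<in> supp \<psi> \<Longrightarrow> norm x \<le> r"
    using compact_imp_bounded[OF test_compact[OF \<psi>]] bounded_pos by metis
  show thesis
  proof (rule localized_bound[OF u \<psi>])
    fix C m assume C: "0 \<le> C" and bd: "\<And>h B. smooth h \<Longrightarrow> 0 \<le> B \<Longrightarrow>
     (\<And>\<alpha> x. length \<alpha> \<le> m \<Longrightarrow> x \<in> supp \<psi> \<Longrightarrow> norm (iter_partial \<alpha> h x) \<le> B) \<Longrightarrow> norm (u (\<lambda>x. \<psi> x * h x)) \<le> C * B"
    show thesis
    proof (rule that[of C r m])
      show "norm (loc_ft u \<psi> \<xi>) \<le> C * bracket \<xi> ^ m" for \<xi>
        unfolding loc_ft_def
        by (rule bd[OF smooth_chr]) (auto simp: iter_partial_chr norm_mult norm_monom_i_le)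
      show "norm (loc_ft u \<psi> \<xi> - loc_ft u \<psi> \<eta>) \<le> C * chr_dist m r \<xi> \<eta>" for \<xi> \<eta>
      proof -
        have "loc_ft u \<psi> \<xi> - loc_ft u \<psi> \<eta> = u (\<lambda>x. \<psi> x * (chr \<xi> x - chr \<eta> x))"
          unfolding loc_ft_def right_diff_distrib
          by (rule distribution_diff[symmetric, OF u]) (intro test_mult \<psi> smooth_chr)+
        also have "norm \<dots> \<le> C * chr_dist m r \<xi> \<eta>"
          by (rule bd[OF smooth_diff[OF smooth_chr smooth_chr]])
             (use r in \<open>auto simp: chr_dist_nonneg iter_partial_diff smooth_chr iter_partial_chr intro!: monom_chr_diff\<close>)
        finally show ?thesis .
      qed
      show "norm (u (\<lambda>x. \<psi> x * h x)) \<le> C * B" if "smooth h" "0 \<le> B"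
        "\<And>\<alpha> x. length \<alpha> \<le> m \<Longrightarrow> norm x \<le> r \<Longrightarrow> norm (iter_partial \<alpha> h x) \<le> B" for h B
        by (rule bd[OF that(1,2)]) (use that(3) r in auto)
    qed (use C r in auto)
  qed
qed

lemma loc_ft_bound:
  assumes "u \<in> distributions" "\<psi> \<in> test_functions"
  obtains C m where "0 \<le> C" "\<And>\<xi>. norm (loc_ft u \<psi> \<xi>) \<le> C * bracket \<xi> ^ m"
  by (rule loc_ft_estimates[OF assms]) (rule that)

lemma continuous_loc_ft:
  assumes "u \<in> distributions" "\<psi> \<in> test_functions"
  shows "continuous_on S (loc_ft u \<psi>)"
proof (rule loc_ft_estimates[OF assms])
  fix C :: real and m r
  assume bd: "\<And>\<xi> \<eta>. norm (loc_ft u \<psi> \<xi> - loc_ft u \<psi> \<eta>) \<le> C * chr_dist m r \<xi> \<eta>"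
  have "(loc_ft u \<psi> \<longlongrightarrow> loc_ft u \<psi> \<xi>) (at \<xi> within S)" for \<xi>
  proof -
    have lim: "((\<lambda>\<eta>. C * chr_dist m r \<xi> \<eta>) \<longlongrightarrow> 0) (at \<xi> within S)"
      by (rule tendsto_mult_right_zero[OF chr_dist_tendsto_0[OF tendsto_ident_at]])
    have "((\<lambda>\<eta>. loc_ft u \<psi> \<xi> - loc_ft u \<psi> \<eta>) \<longlongrightarrow> 0) (at \<xi> within S)"
      by (rule Lim_null_comparison[OF always_eventually lim]) (rule allI, rule bd)
    from tendsto_diff[OF tendsto_const[of "loc_ft u \<psi> \<xi>"] this] show ?thesis by simp
  qed
  then show ?thesis by (simp add: continuous_on_def)
qed

lemma loc_ft_measurable: "u \<in> distributions \<Longrightarrow> \<psi> \<in> test_functions \<Longrightarrow> loc_ft u \<psi> \<in> borel_measurable borel"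
  by (intro borel_measurable_continuous_onI continuous_loc_ft)

lemma integral_simple_function_comp:
  fixes g :: "'a \<Rightarrow> complex" and F :: "'b \<Rightarrow> complex"
  assumes g: "integrable M g" and q: "simple_function M q"
  shows "integrable M (\<lambda>x. F (q x) * g x)"
    and "(LINT x|M. F (q x) * g x) = (\<Sum>c\<in>q ` space M. F c * (LINT x|M. indicator (q -` {c} \<inter> space M) x *\<^sub>R g x))"
proof -
  have fin: "finite (q ` space M)" using q by (rule simple_functionD(1))
  have i: "integrable M (\<lambda>x. F c * (indicator (q -` {c} \<inter> space M) x *\<^sub>R g x))" for c
    using g simple_functionD(2)[OF q, of "{c}"] by (intro integrable_mult_right integrable_mult_indicator) auto
  have e: "F (q x) * g x = (\<Sum>c\<in>q ` space M. F c * (indicator (q -` {c} \<inter> space M) x *\<^sub>R g x))" if "x \<in> space M" for x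
  proof -
    have "(\<Sum>c\<in>q ` space M. F c * (indicator (q -` {c} \<inter> space M) x *\<^sub>R g x)) =
       (\<Sum>c\<in>q ` space M. if c = q x then F c * g x else 0)"
      using that by (intro sum.cong refl) (auto simp: indicator_def)
    also have "\<dots> = F (q x) * g x" using fin that by (simp add: sum.delta)
    finally show ?thesis by simp
  qed
  have "integrable M (\<lambda>x. \<Sum>c\<in>q ` space M. F c * (indicator (q -` {c} \<inter> space M) x *\<^sub>R g x))"
    by (intro Bochner_Integration.integrable_sum i)
  then show "integrable M (\<lambda>x. F (q x) * g x)"
    by (subst Bochner_Integration.integrable_cong[OF refl e]) auto
  have "(LINT x|M. F (q x) * g x) = (LINT x|M. (\<Sum>c\<in>q ` space M. F c * (indicator (q -` {c} \<inter> space M) x *\<^sub>R g x)))"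
    by (intro Bochner_Integration.integral_cong refl e)
  also have "\<dots> = (\<Sum>c\<in>q ` space M. LINT x|M. F c * (indicator (q -` {c} \<inter> space M) x *\<^sub>R g x))"
    by (rule Bochner_Integration.integral_sum) (rule i)
  finally show "(LINT x|M. F (q x) * g x) = (\<Sum>c\<in>q ` space M. F c * (LINT x|M. indicator (q -` {c} \<inter> space M) x *\<^sub>R g x))"
    by (simp only: integral_mult_right_zero)
qed

text \<open>The point is to interchange a distribution and an integral.  For simple functions \<open>q\<^sub>i\<close> that converge
  pointwise to the identity, replacing \<open>chr \<xi>\<close> by \<open>chr (q\<^sub>i \<xi>)\<close> turns the Fourier integral into a finite sum, for
  which the interchange is linearity.  Dominated convergence makes the error small with all its
  derivatives on the support of \<open>\<psi>\<close>, and continuity of \<open>loc_ft\<close> gives the limit on the other side.\<close>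

theorem distribution_fourier_fun:
  fixes g :: "real^'n::finite \<Rightarrow> complex"
  assumes u: "u \<in> distributions" and \<psi>: "\<psi> \<in> test_functions" and g: "g \<in> schwartz"
  shows "u (\<lambda>x. \<psi> x * fourier_fun g x) = (LINT \<xi>|lborel. loc_ft u \<psi> \<xi> * g \<xi>)"
proof (rule loc_ft_estimates[OF u \<psi>])
  fix C :: real and m r
  assume C: "0 \<le> C" and r: "0 \<le> r" and Ub: "\<And>\<xi>. norm (loc_ft u \<psi> \<xi>) \<le> C * bracket \<xi> ^ m"
    and bd: "\<And>h B. smooth h \<Longrightarrow> 0 \<le> B \<Longrightarrow>
     (\<And>\<alpha> x. length \<alpha> \<le> m \<Longrightarrow> norm x \<le> r \<Longrightarrow> norm (iter_partial \<alpha> h x) \<le> B) \<Longrightarrow> norm (u (\<lambda>x. \<psi> x * h x)) \<le> C * B"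
  let ?U = "loc_ft u \<psi>"
  note [measurable] = schwartz_measurable[OF g] loc_ft_measurable[OF u \<psi>]
  have gi: "integrable lborel g" by (rule schwartz_integrable[OF g])
  obtain q :: "nat \<Rightarrow> real^'n \<Rightarrow> real^'n" where q: "\<And>i. simple_function lborel (q i)"
    "\<And>\<xi>. (\<lambda>i. q i \<xi>) \<longlonglongrightarrow> \<xi>" "\<And>i \<xi>. norm (q i \<xi>) \<le> 2 * norm \<xi>"
    using borel_measurable_implies_sequence_metric[of "\<lambda>\<xi>::real^'n. \<xi>" lborel 0] by (auto simp: dist_norm)
  have [measurable]: "q i \<in> borel_measurable borel" for i
    using borel_measurable_simple_function[OF q(1)] by simp
  have pw: "integrable lborel (\<lambda>\<xi>. K * bracket \<xi> ^ l * norm (g \<xi>))" for K l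
    using integrable_norm[OF schwartz_mult_integrable[OF g, of "\<lambda>\<xi>. complex_of_real (bracket \<xi> ^ l)" 1 l]]
    by (simp add: norm_mult norm_power mult.assoc)
  define a where "a i c = (LINT \<xi>|lborel. indicator (q i -` {c} \<inter> space lborel) \<xi> *\<^sub>R g \<xi>)" for i c
  let ?R = "\<lambda>i. q i ` space lborel"
  define S where "S i x = (\<Sum>c\<in>?R i. a i c * chr c x)" for i x
  have smS: "smooth (S i)" for i
    unfolding S_def[abs_def] by (intro smooth_sum smooth_cmult smooth_chr)
  have uS: "u (\<lambda>x. \<psi> x * S i x) = (LINT \<xi>|lborel. ?U (q i \<xi>) * g \<xi>)" for i
  proof -
    have "(\<lambda>x. \<psi> x * S i x) = (\<lambda>x. \<Sum>c\<in>?R i. a i c * (\<psi> x * chr c x))"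
      unfolding S_def sum_distrib_left by (intro ext sum.cong refl) (simp add: mult_ac)
    then have "u (\<lambda>x. \<psi> x * S i x) = (\<Sum>c\<in>?R i. u (\<lambda>x. a i c * (\<psi> x * chr c x)))"
      using distribution_sum[OF u, of "?R i" "\<lambda>c x. a i c * (\<psi> x * chr c x)"]
      by (simp add: test_cmult test_mult \<psi> smooth_chr)
    also have "\<dots> = (\<Sum>c\<in>?R i. ?U c * a i c)"
      by (intro sum.cong refl, subst distribution_cmult[OF u test_mult[OF \<psi> smooth_chr]]) (simp add: loc_ft_def)
    also have "\<dots> = (LINT \<xi>|lborel. ?U (q i \<xi>) * g \<xi>)"
      unfolding a_def by (rule integral_simple_function_comp(2)[OF gi q(1), symmetric])
    finally show ?thesis .
  qed
  \<comment> \<open>the error of the \<open>i\<close>-th approximation, uniform in the derivatives up to order \<open>m\<close>\<close>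
  define \<epsilon> where "\<epsilon> i = (LINT \<xi>|lborel. chr_dist m r \<xi> (q i \<xi>) * norm (g \<xi>))" for i
  define K where "K = real (card {\<alpha> :: 'n list. length \<alpha> \<le> m}) * ((2 + 3 * r) * 3 ^ m)"
  have dK: "chr_dist m r \<xi> (q i \<xi>) \<le> K * bracket \<xi> ^ (m + 1)" for i \<xi>
    unfolding K_def by (rule chr_dist_bound[OF r q(3)])
  have di: "integrable lborel (\<lambda>\<xi>. chr_dist m r \<xi> (q i \<xi>) * norm (g \<xi>))" for i
  proof (rule Bochner_Integration.integrable_bound[OF pw[of K "m + 1"]])
    show "AE \<xi> in lborel. norm (chr_dist m r \<xi> (q i \<xi>) * norm (g \<xi>)) \<le> norm (K * bracket \<xi> ^ (m + 1) * norm (g \<xi>))"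
    proof (rule AE_I2)
      fix \<xi>
      have "norm (chr_dist m r \<xi> (q i \<xi>) * norm (g \<xi>)) = chr_dist m r \<xi> (q i \<xi>) * norm (g \<xi>)"
        using chr_dist_nonneg[OF r, of m \<xi> "q i \<xi>"] by simp
      also have "\<dots> \<le> K * bracket \<xi> ^ (m + 1) * norm (g \<xi>)" by (intro mult_right_mono dK) simp
      finally show "norm (chr_dist m r \<xi> (q i \<xi>) * norm (g \<xi>)) \<le> norm (K * bracket \<xi> ^ (m + 1) * norm (g \<xi>))"
        unfolding real_norm_def by (rule order_trans[OF _ abs_ge_self])
    qed
  qed simp
  have e0: "\<epsilon> \<longlonglongrightarrow> 0"
  proof -
    have "(\<lambda>i. LINT \<xi>|lborel. chr_dist m r \<xi> (q i \<xi>) * norm (g \<xi>)) \<longlonglongrightarrow> (LINT \<xi>|(lborel :: (real^'n) measure). 0)"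
    proof (rule integral_dominated_convergence[OF _ _ pw[of K "m + 1"]])
      show "AE \<xi> in lborel. (\<lambda>i. chr_dist m r \<xi> (q i \<xi>) * norm (g \<xi>)) \<longlonglongrightarrow> 0"
        using tendsto_mult_left_zero[OF chr_dist_tendsto_0[OF q(2)]] by (intro AE_I2)
      show "AE \<xi> in lborel. norm (chr_dist m r \<xi> (q i \<xi>) * norm (g \<xi>)) \<le> K * bracket \<xi> ^ (m + 1) * norm (g \<xi>)" for i
      proof (rule AE_I2)
        fix \<xi>
        have "norm (chr_dist m r \<xi> (q i \<xi>) * norm (g \<xi>)) = chr_dist m r \<xi> (q i \<xi>) * norm (g \<xi>)"
          using chr_dist_nonneg[OF r, of m \<xi> "q i \<xi>"] by simp
        also have "\<dots> \<le> K * bracket \<xi> ^ (m + 1) * norm (g \<xi>)" by (intro mult_right_mono dK) simp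
        finally show "norm (chr_dist m r \<xi> (q i \<xi>) * norm (g \<xi>)) \<le> K * bracket \<xi> ^ (m + 1) * norm (g \<xi>)" .
      qed
    qed auto
    then show ?thesis by (simp add: \<epsilon>_def[abs_def])
  qed
  have e_nonneg: "0 \<le> \<epsilon> i" for i
    unfolding \<epsilon>_def by (intro Bochner_Integration.integral_nonneg mult_nonneg_nonneg chr_dist_nonneg r) simp
  have est: "norm (u (\<lambda>x. \<psi> x * fourier_fun g x) - u (\<lambda>x. \<psi> x * S i x)) \<le> C * \<epsilon> i" for i
  proof -
    have "u (\<lambda>x. \<psi> x * fourier_fun g x) - u (\<lambda>x. \<psi> x * S i x) = u (\<lambda>x. \<psi> x * (fourier_fun g x - S i x))"
      unfolding right_diff_distrib
      by (rule distribution_diff[symmetric, OF u]) (intro test_mult \<psi> smooth_fourier_fun g smS)+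
    also have "norm \<dots> \<le> C * \<epsilon> i"
    proof (rule bd[OF smooth_diff[OF smooth_fourier_fun[OF g] smS] e_nonneg])
      fix \<alpha> :: "'n list" and x :: "real^'n" assume \<alpha>: "length \<alpha> \<le> m" and x: "norm x \<le> r"
      have X: "xmults \<alpha> g \<in> schwartz" by (rule schwartz_op_schwartz[OF schwartz_op_xmults g])
      have 1: "iter_partial \<alpha> (fourier_fun g) x = (LINT \<xi>|lborel. (monom_i \<alpha> \<xi> * chr \<xi> x) * g \<xi>)"
        unfolding iter_partial_fourier_fun[OF g] fourier_fun_lborel[OF schwartz_measurable[OF X]]
        by (intro Bochner_Integration.integral_cong refl) (simp add: xmults_def chr_commute[of x] mult_ac)
      have i1: "integrable lborel (\<lambda>\<xi>. (monom_i \<alpha> \<xi> * chr \<xi> x) * g \<xi>)"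
        by (rule schwartz_mult_integrable[OF g, of _ 1 m])
           (auto simp: norm_mult norm_monom_i_le[OF \<alpha>] chr_commute[of _ x])
      have "iter_partial \<alpha> (S i) x = (\<Sum>c\<in>?R i. a i c * (monom_i \<alpha> c * chr c x))"
        unfolding S_def[abs_def]
        by (subst iter_partial_sum, intro smooth_cmult smooth_chr, intro sum.cong refl)
           (simp add: iter_partial_cmult smooth_chr iter_partial_chr)
      also have "\<dots> = (\<Sum>c\<in>?R i. (monom_i \<alpha> c * chr c x) * a i c)" by (simp add: mult_ac)
      also have "\<dots> = (LINT \<xi>|lborel. (monom_i \<alpha> (q i \<xi>) * chr (q i \<xi>) x) * g \<xi>)"
        unfolding a_def by (rule integral_simple_function_comp(2)[OF gi q(1), symmetric])
      finally have 2: "iter_partial \<alpha> (S i) x = (LINT \<xi>|lborel. (monom_i \<alpha> (q i \<xi>) * chr (q i \<xi>) x) * g \<xi>)" .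
      have i2: "integrable lborel (\<lambda>\<xi>. (monom_i \<alpha> (q i \<xi>) * chr (q i \<xi>) x) * g \<xi>)"
        by (rule integral_simple_function_comp(1)[OF gi q(1)])
      have "iter_partial \<alpha> (\<lambda>x. fourier_fun g x - S i x) x =
        (LINT \<xi>|lborel. (monom_i \<alpha> \<xi> * chr \<xi> x) * g \<xi> - (monom_i \<alpha> (q i \<xi>) * chr (q i \<xi>) x) * g \<xi>)"
        by (simp only: iter_partial_diff[OF smooth_fourier_fun[OF g] smS] 1 2 Bochner_Integration.integral_diff[OF i1 i2])
      also have "norm \<dots> \<le> \<epsilon> i"
        unfolding \<epsilon>_def
      proof (rule Bochner_Integration.integral_norm_bound_integral[OF Bochner_Integration.integrable_diff[OF i1 i2] di])
        fix \<xi>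
        show "norm ((monom_i \<alpha> \<xi> * chr \<xi> x) * g \<xi> - (monom_i \<alpha> (q i \<xi>) * chr (q i \<xi>) x) * g \<xi>) \<le> chr_dist m r \<xi> (q i \<xi>) * norm (g \<xi>)"
          unfolding left_diff_distrib[symmetric] norm_mult[of "_ - _"]
          by (intro mult_right_mono monom_chr_diff \<alpha> x) simp
      qed
      finally show "norm (iter_partial \<alpha> (\<lambda>x. fourier_fun g x - S i x) x) \<le> \<epsilon> i" .
    qed
    finally show ?thesis .
  qed
  have "(\<lambda>i. u (\<lambda>x. \<psi> x * fourier_fun g x) - u (\<lambda>x. \<psi> x * S i x)) \<longlonglongrightarrow> 0"
    by (rule Lim_null_comparison[OF always_eventually tendsto_mult_right_zero[OF e0, of C]]) (rule allI, rule est)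
  from tendsto_diff[OF tendsto_const[of "u (\<lambda>x. \<psi> x * fourier_fun g x)"] this]
  have "(\<lambda>i. LINT \<xi>|lborel. ?U (q i \<xi>) * g \<xi>) \<longlonglongrightarrow> u (\<lambda>x. \<psi> x * fourier_fun g x)"
    by (simp add: uS)
  moreover have "(\<lambda>i. LINT \<xi>|lborel. ?U (q i \<xi>) * g \<xi>) \<longlonglongrightarrow> (LINT \<xi>|lborel. ?U \<xi> * g \<xi>)"
  proof (rule integral_dominated_convergence[OF _ _ pw[of "C * 3 ^ m" m]])
    show "AE \<xi> in lborel. (\<lambda>i. ?U (q i \<xi>) * g \<xi>) \<longlonglongrightarrow> ?U \<xi> * g \<xi>"
    proof (intro AE_I2 tendsto_mult tendsto_const)
      fix \<xi> show "(\<lambda>i. ?U (q i \<xi>)) \<longlonglongrightarrow> ?U \<xi>"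
        using continuous_loc_ft[OF u \<psi>, of UNIV] q(2)[of \<xi>]
        by (intro isCont_tendsto_compose[of \<xi> ?U]) (auto simp: continuous_on_eq_continuous_at)
    qed
    show "AE \<xi> in lborel. norm (?U (q i \<xi>) * g \<xi>) \<le> C * 3 ^ m * bracket \<xi> ^ m * norm (g \<xi>)" for i
    proof (rule AE_I2)
      fix \<xi>
      have "bracket (q i \<xi>) \<le> bracket (2 *\<^sub>R \<xi>)" by (rule bracket_mono) (use q(3)[of i \<xi>] in simp)
      also have "\<dots> \<le> 3 * bracket \<xi>" using bracket_scaleR_le[of 2 \<xi>] by simp
      finally have "bracket (q i \<xi>) ^ m \<le> (3 * bracket \<xi>) ^ m" by (rule power_mono) simp
      then have "C * bracket (q i \<xi>) ^ m \<le> C * 3 ^ m * bracket \<xi> ^ m"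
        unfolding power_mult_distrib mult.assoc by (rule mult_left_mono[OF _ C])
      with Ub[of "q i \<xi>"] have "norm (?U (q i \<xi>)) \<le> C * 3 ^ m * bracket \<xi> ^ m" by linarith
      then show "norm (?U (q i \<xi>) * g \<xi>) \<le> C * 3 ^ m * bracket \<xi> ^ m * norm (g \<xi>)"
        unfolding norm_mult by (rule mult_right_mono) simp
    qed
  qed auto
  ultimately show ?thesis by (rule LIMSEQ_unique)
qed

lemma continuous_absolutely_integrable_on_compact:
  fixes f :: "real^'n::finite \<Rightarrow> complex"
  assumes f: "continuous_on UNIV f" and K: "compact K"
  shows "f absolutely_integrable_on K"
proof -
  have "set_integrable lborel K f"
    unfolding set_integrable_def
    using borel_integrable_compact[OF K continuous_on_subset[OF f subset_UNIV]] .
  then show ?thesis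
    unfolding set_integrable_def
    using borel_measurable_continuous_onI[OF f] compact_imp_closed[OF K] by (simp add: integrable_completion)
qed

lemma given_by_loc_ft:
  assumes u: "u \<in> distributions" and \<psi>: "\<psi> \<in> test_functions"
  shows "given_by (fourier (localize \<psi> u)) (loc_ft u \<psi>)"
  unfolding given_by_def
proof (intro conjI allI impI ballI)
  show "loc_ft u \<psi> absolutely_integrable_on K" if "compact K" for K
    by (rule continuous_absolutely_integrable_on_compact[OF continuous_loc_ft[OF u \<psi>] that])
  fix \<phi> :: "real^'a \<Rightarrow> complex" assume "\<phi> \<in> test_functions"
  then have \<phi>: "\<phi> \<in> schwartz" by (rule test_schwartz)
  note [measurable] = schwartz_measurable[OF \<phi>] loc_ft_measurable[OF u \<psi>]
  have "fourier (localize \<psi> u) \<phi> = u (\<lambda>x. \<psi> x * fourier_fun \<phi> x)"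
    by (simp add: fourier_def localize_def \<phi> fourier_fun_schwartz)
  also have "\<dots> = (LINT \<xi>|lborel. loc_ft u \<psi> \<xi> * \<phi> \<xi>)"
    by (rule distribution_fourier_fun[OF u \<psi> \<phi>])
  also have "\<dots> = (LINT \<xi>|lebesgue. loc_ft u \<psi> \<xi> * \<phi> \<xi>)"
    by (rule integral_completion[symmetric]) simp
  finally show "fourier (localize \<psi> u) \<phi> = (LINT \<xi>|lebesgue. loc_ft u \<psi> \<xi> * \<phi> \<xi>)" .
qed

text \<open>The Schwartz function whose Fourier transform is \<open>x \<mapsto> \<phi> x * chr \<xi> x\<close>.\<close>

definition inv_ft :: "(real^'n::finite \<Rightarrow> complex) \<Rightarrow> real^'n \<Rightarrow> real^'n \<Rightarrow> complex" where
  "inv_ft \<phi> \<xi> \<zeta> = complex_of_real (1 / (2 * pi) ^ CARD('n)) * fourier_fun \<phi> (\<xi> - \<zeta>)"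

lemma inv_ft_schwartz:
  assumes "\<phi> \<in> schwartz" shows "inv_ft \<phi> \<xi> \<in> schwartz"
proof -
  have e: "inv_ft \<phi> \<xi> = (\<lambda>\<zeta>. complex_of_real (1 / (2 * pi) ^ CARD('a)) * fourier_fun \<phi> ((-1) *\<^sub>R \<zeta> + \<xi>))"
    by (simp add: inv_ft_def fun_eq_iff)
  show ?thesis unfolding e by (intro schwartz_cmult schwartz_affine fourier_fun_schwartz assms) simp
qed

lemma fourier_fun_inv_ft:
  fixes \<phi> :: "real^'n::finite \<Rightarrow> complex"
  assumes \<phi>: "\<phi> \<in> schwartz"
  shows "fourier_fun (inv_ft \<phi> \<xi>) x = \<phi> x * chr \<xi> x"
proof -
  note [measurable] = schwartz_measurable[OF inv_ft_schwartz[OF \<phi>]] schwartz_measurable[OF fourier_fun_schwartz[OF \<phi>]]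
  let ?k = "complex_of_real (1 / (2 * pi) ^ CARD('n))"
  have "fourier_fun (inv_ft \<phi> \<xi>) x = (LINT \<zeta>|lborel. chr x \<zeta> * inv_ft \<phi> \<xi> \<zeta>)"
    by (rule fourier_fun_lborel) simp
  also have "\<dots> = (LINT \<zeta>|lborel. chr x (\<xi> + (-1) *\<^sub>R \<zeta>) * inv_ft \<phi> \<xi> (\<xi> + (-1) *\<^sub>R \<zeta>))"
    using lborel_integral_affine(1)[of "\<lambda>\<zeta>. chr x \<zeta> * inv_ft \<phi> \<xi> \<zeta>" "-1" \<xi>] by simp
  also have "\<dots> = (LINT \<zeta>|lborel. (?k * chr \<xi> x) * (chr (- x) \<zeta> * fourier_fun \<phi> \<zeta>))"
  proof (intro Bochner_Integration.integral_cong refl)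
    fix \<zeta>
    have "chr x (\<xi> + (-1) *\<^sub>R \<zeta>) = chr \<xi> x * chr (- x) \<zeta>"
      using chr_add_left[of x \<xi> "- \<zeta>"] by (simp add: chr_commute[of x \<xi>] chr_def[of x "- \<zeta>"] chr_def[of "- x" \<zeta>])
    then show "chr x (\<xi> + (-1) *\<^sub>R \<zeta>) * inv_ft \<phi> \<xi> (\<xi> + (-1) *\<^sub>R \<zeta>) = (?k * chr \<xi> x) * (chr (- x) \<zeta> * fourier_fun \<phi> \<zeta>)"
      by (simp add: inv_ft_def)
  qed
  also have "\<dots> = (?k * chr \<xi> x) * (complex_of_real ((2 * pi) ^ CARD('n)) * \<phi> x)"
    by (simp only: integral_mult_right_zero fourier_inversion[OF \<phi>])
  also have "\<dots> = (?k * complex_of_real ((2 * pi) ^ CARD('n))) * (\<phi> x * chr \<xi> x)" by (simp only: mult_ac)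
  also have "?k * complex_of_real ((2 * pi) ^ CARD('n)) = 1"
    unfolding of_real_mult[symmetric] by simp
  finally show ?thesis by simp
qed

lemma inv_ft_shift: "inv_ft \<phi> 0 (\<xi> + \<eta>) = inv_ft \<phi> (- \<eta>) \<xi>"
  by (simp add: inv_ft_def algebra_simps)

lemma inv_ft_lincomb:
  assumes "f \<in> schwartz" "g \<in> schwartz"
  shows "inv_ft (\<lambda>x. a * f x + b * g x) \<xi> \<zeta> = a * inv_ft f \<xi> \<zeta> + b * inv_ft g \<xi> \<zeta>"
  by (simp add: inv_ft_def fourier_fun_add fourier_fun_cmult schwartz_cmult assms add_divide_distrib)

lemma inv_ft_fourier_fun:
  fixes \<phi> :: "real^'n::finite \<Rightarrow> complex"
  assumes \<phi>: "\<phi> \<in> schwartz" shows "inv_ft (fourier_fun \<phi>) 0 \<xi> = \<phi> \<xi>"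
proof -
  have "fourier_fun (fourier_fun \<phi>) (0 - \<xi>) = (LINT \<zeta>|lborel. chr (- \<xi>) \<zeta> * fourier_fun \<phi> \<zeta>)"
    by (simp add: fourier_fun_lborel[OF schwartz_measurable[OF fourier_fun_schwartz[OF \<phi>]]])
  also have "\<dots> = complex_of_real ((2 * pi) ^ CARD('n)) * \<phi> \<xi>" by (rule fourier_inversion[OF \<phi>])
  finally have "inv_ft (fourier_fun \<phi>) 0 \<xi> = complex_of_real (1 / (2 * pi) ^ CARD('n)) * complex_of_real ((2 * pi) ^ CARD('n)) * \<phi> \<xi>"
    by (simp only: inv_ft_def mult.assoc)
  then show ?thesis unfolding of_real_mult[symmetric] by simp
qed

text \<open>Multiplication becomes convolution: \<open>\<phi>\<close> times a character is a Fourier transform, to which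
  \<open>distribution_fourier_fun\<close> applies.\<close>

lemma loc_ft_mult:
  assumes u: "u \<in> distributions" and \<psi>: "\<psi> \<in> test_functions" and \<phi>: "\<phi> \<in> schwartz"
  shows "loc_ft u (\<lambda>x. \<psi> x * \<phi> x) \<xi> = (LINT \<zeta>|lborel. loc_ft u \<psi> \<zeta> * inv_ft \<phi> \<xi> \<zeta>)"
  using distribution_fourier_fun[OF u \<psi> inv_ft_schwartz[OF \<phi>], of \<xi>]
  by (simp add: fourier_fun_inv_ft[OF \<phi>] loc_ft_def mult.assoc)

section \<open>Convolution inequalities\<close>

lemma lborel_distr_reflect: "distr lborel borel (\<lambda>x. \<xi> - x) = (lborel :: 'a::euclidean_space measure)"
  using lborel_affine[of "-1" \<xi>] by (simp add: density_1)

lemma AE_lborel_reflect: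
  assumes "AE x in lborel. P (x :: 'a::euclidean_space)" shows "AE x in lborel. P (\<xi> - x)"
proof (rule AE_distrD[where P=P and f="\<lambda>x. \<xi> - x"])
  show "(\<lambda>x. \<xi> - x) \<in> lborel \<rightarrow>\<^sub>M borel" by simp
  show "AE x in distr lborel borel (\<lambda>x. \<xi> - x). P x" unfolding lborel_distr_reflect by (rule assms)
qed

text \<open>Weights are only Lebesgue measurable, and then \<open>f (\<xi> - \<eta>)\<close> need not be measurable for the product of the
  Lebesgue sigma-algebras.  Replacing the functions by Borel functions changes none of the values of the
  convolution and makes Tonelli's theorem available.\<close>

lemma nn_conv_borel:
  fixes f g :: "real^'n::finite \<Rightarrow> ennreal"
  assumes "f \<in> borel_measurable lebesgue" "g \<in> borel_measurable lebesgue"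
  obtains f' g' where "f' \<in> borel_measurable borel" "g' \<in> borel_measurable borel"
    "AE x in lborel. f x = f' x" "AE x in lborel. g x = g' x"
    "\<And>\<xi>. nn_conv f g \<xi> = (\<integral>\<^sup>+\<eta>. f' (\<xi> - \<eta>) * g' \<eta> \<partial>lborel)"
proof -
  obtain f' where f': "f' \<in> borel_measurable lborel" "AE x in lborel. f x = f' x"
    using completion_ex_borel_measurable[OF assms(1)] by blast
  obtain g' where g': "g' \<in> borel_measurable lborel" "AE x in lborel. g x = g' x"
    using completion_ex_borel_measurable[OF assms(2)] by blast
  have "nn_conv f g \<xi> = (\<integral>\<^sup>+\<eta>. f' (\<xi> - \<eta>) * g' \<eta> \<partial>lborel)" for \<xi>
    unfolding nn_conv_def nn_integral_completion
  proof (rule nn_integral_cong_AE)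
    show "AE \<eta> in lborel. f (\<xi> - \<eta>) * g \<eta> = f' (\<xi> - \<eta>) * g' \<eta>"
      using AE_lborel_reflect[OF f'(2), of \<xi>] g'(2) by eventually_elim simp
  qed
  then show thesis using f' g' by (intro that[of f' g']) simp_all
qed

lemma nn_conv_measurable:
  assumes "f \<in> borel_measurable lebesgue" "g \<in> borel_measurable lebesgue"
  shows "nn_conv f g \<in> borel_measurable borel"
proof (rule nn_conv_borel[OF assms])
  fix f' g' :: "real^'a \<Rightarrow> ennreal"
  assume [measurable]: "f' \<in> borel_measurable borel" "g' \<in> borel_measurable borel"
    and e: "\<And>\<xi>. nn_conv f g \<xi> = (\<integral>\<^sup>+\<eta>. f' (\<xi> - \<eta>) * g' \<eta> \<partial>lborel)"
  have "(\<lambda>\<xi>. \<integral>\<^sup>+\<eta>. f' (\<xi> - \<eta>) * g' \<eta> \<partial>lborel) \<in> borel_measurable borel"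
    by (rule lborel.borel_measurable_nn_integral) measurable
  then show ?thesis by (simp add: e[abs_def])
qed

lemma nn_integral_nn_conv:
  assumes "f \<in> borel_measurable lebesgue" "g \<in> borel_measurable lebesgue"
  shows "(\<integral>\<^sup>+\<xi>. nn_conv f g \<xi> \<partial>lborel) = (\<integral>\<^sup>+\<xi>. f \<xi> \<partial>lborel) * (\<integral>\<^sup>+\<xi>. g \<xi> \<partial>lborel)"
proof (rule nn_conv_borel[OF assms])
  fix f' g' :: "real^'a \<Rightarrow> ennreal"
  assume m[measurable]: "f' \<in> borel_measurable borel" "g' \<in> borel_measurable borel"
    and ae: "AE x in lborel. f x = f' x" "AE x in lborel. g x = g' x"
    and e: "\<And>\<xi>. nn_conv f g \<xi> = (\<integral>\<^sup>+\<eta>. f' (\<xi> - \<eta>) * g' \<eta> \<partial>lborel)"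
  have "(\<integral>\<^sup>+\<xi>. nn_conv f g \<xi> \<partial>lborel) = (\<integral>\<^sup>+\<xi>. \<integral>\<^sup>+\<eta>. f' (\<xi> - \<eta>) * g' \<eta> \<partial>lborel \<partial>lborel)"
    by (simp add: e)
  also have "\<dots> = (\<integral>\<^sup>+\<eta>. \<integral>\<^sup>+\<xi>. f' (\<xi> - \<eta>) * g' \<eta> \<partial>lborel \<partial>lborel)"
    by (rule lborel_pair.Fubini') measurable
  also have "\<dots> = (\<integral>\<^sup>+\<eta>. (\<integral>\<^sup>+\<xi>. f' \<xi> \<partial>lborel) * g' \<eta> \<partial>lborel)"
  proof (intro nn_integral_cong)
    fix \<eta>
    have "(\<integral>\<^sup>+\<xi>. f' (\<xi> - \<eta>) * g' \<eta> \<partial>lborel) = (\<integral>\<^sup>+\<xi>. f' (\<xi> - \<eta>) \<partial>lborel) * g' \<eta>"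
      by (rule nn_integral_multc) measurable
    also have "(\<integral>\<^sup>+\<xi>. f' (\<xi> - \<eta>) \<partial>lborel) = (\<integral>\<^sup>+\<xi>. f' \<xi> \<partial>distr lborel borel ((+) (- \<eta>)))"
      by (subst nn_integral_distr) auto
    finally show "(\<integral>\<^sup>+\<xi>. f' (\<xi> - \<eta>) * g' \<eta> \<partial>lborel) = (\<integral>\<^sup>+\<xi>. f' \<xi> \<partial>lborel) * g' \<eta>"
      by (simp add: lborel_distr_plus)
  qed
  also have "\<dots> = (\<integral>\<^sup>+\<xi>. f' \<xi> \<partial>lborel) * (\<integral>\<^sup>+\<xi>. g' \<xi> \<partial>lborel)"
    by (rule nn_integral_cmult) simp
  also have "(\<integral>\<^sup>+\<xi>. f' \<xi> \<partial>lborel) = (\<integral>\<^sup>+\<xi>. f \<xi> \<partial>lborel)"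
    using ae(1) by (intro nn_integral_cong_AE) auto
  also have "(\<integral>\<^sup>+\<xi>. g' \<xi> \<partial>lborel) = (\<integral>\<^sup>+\<xi>. g \<xi> \<partial>lborel)"
    using ae(2) by (intro nn_integral_cong_AE) auto
  finally show ?thesis .
qed

lemma lebesgue_measurable_reflect:
  fixes f :: "real^'n::finite \<Rightarrow> 'b::topological_space"
  assumes f: "f \<in> borel_measurable lebesgue"
  shows "(\<lambda>\<eta>. f (\<xi> - \<eta>)) \<in> borel_measurable lebesgue"
proof -
  have "(\<lambda>\<eta>. \<xi> + (\<Sum>j\<in>Basis. (-1 * (\<eta> \<bullet> j)) *\<^sub>R j)) \<in> lebesgue \<rightarrow>\<^sub>M lebesgue"
    by (rule lebesgue_affine_measurable) simp
  moreover have "(\<lambda>\<eta>. \<xi> + (\<Sum>j\<in>Basis. (-1 * (\<eta> \<bullet> j)) *\<^sub>R j)) = (\<lambda>\<eta>. \<xi> - \<eta>)"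
    by (simp add: fun_eq_iff sum_negf euclidean_representation)
  ultimately have "(\<lambda>\<eta>. \<xi> - \<eta>) \<in> lebesgue \<rightarrow>\<^sub>M lebesgue" by simp
  from measurable_compose[OF this f] show ?thesis .
qed

text \<open>The square of the weighted norm, with values in \<open>[0, \<infinity>]\<close>.\<close>

definition energy :: "(real^'n::finite \<Rightarrow> real) \<Rightarrow> (real^'n \<Rightarrow> complex) \<Rightarrow> ennreal" where
  "energy k F = (\<integral>\<^sup>+\<xi>. ennreal ((k \<xi> * norm (F \<xi>))\<^sup>2) \<partial>lborel)"

text \<open>The Cauchy-Schwarz inequality in the convolution integral; this is where the hypothesis on the weights
  enters.\<close>

lemma weighted_convolution:
  fixes k k1 k2 :: "real^'n::finite \<Rightarrow> real" and F1 F2 :: "real^'n \<Rightarrow> complex"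
  assumes m: "k1 \<in> borel_measurable lebesgue" "k2 \<in> borel_measurable lebesgue"
      "F1 \<in> borel_measurable lebesgue" "F2 \<in> borel_measurable lebesgue"
    and pos: "\<And>\<xi>. 0 < k \<xi>" "\<And>\<xi>. 0 < k1 \<xi>" "\<And>\<xi>. 0 < k2 \<xi>"
    and hyp: "\<And>\<xi>. nn_conv (\<lambda>\<eta>. ennreal (1 / (k1 \<eta>)\<^sup>2)) (\<lambda>\<eta>. ennreal (1 / (k2 \<eta>)\<^sup>2)) \<xi> \<le> ennreal (C\<^sup>2 / (k \<xi>)\<^sup>2)"
  shows "(\<integral>\<^sup>+\<xi>. ennreal ((k \<xi>)\<^sup>2) * (nn_conv (\<lambda>\<eta>. ennreal (norm (F1 \<eta>))) (\<lambda>\<eta>. ennreal (norm (F2 \<eta>))) \<xi>)\<^sup>2 \<partial>lborel)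
    \<le> ennreal (C\<^sup>2) * (energy k1 F1 * energy k2 F2)"
proof -
  note [measurable] = m
  let ?e1 = "\<lambda>\<eta>. ennreal ((k1 \<eta> * norm (F1 \<eta>))\<^sup>2)" and ?e2 = "\<lambda>\<eta>. ennreal ((k2 \<eta> * norm (F2 \<eta>))\<^sup>2)"
  have em: "?e1 \<in> borel_measurable lebesgue" "?e2 \<in> borel_measurable lebesgue" by measurable
  have pt: "ennreal ((k \<xi>)\<^sup>2) * (nn_conv (\<lambda>\<eta>. ennreal (norm (F1 \<eta>))) (\<lambda>\<eta>. ennreal (norm (F2 \<eta>))) \<xi>)\<^sup>2 \<le> ennreal (C\<^sup>2) * nn_conv ?e1 ?e2 \<xi>" for \<xi>
  proof -
    note [measurable] = lebesgue_measurable_reflect[OF m(1), of \<xi>] lebesgue_measurable_reflect[OF m(3), of \<xi>]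
    \<comment> \<open>the two factors of the Cauchy-Schwarz inequality\<close>
    let ?a = "\<lambda>\<eta>. ennreal (1 / (k1 (\<xi> - \<eta>) * k2 \<eta>))"
    let ?b = "\<lambda>\<eta>. ennreal (k1 (\<xi> - \<eta>) * norm (F1 (\<xi> - \<eta>)) * (k2 \<eta> * norm (F2 \<eta>)))"
    have ab: "?a \<in> borel_measurable lebesgue" "?b \<in> borel_measurable lebesgue" by measurable
    have "nn_conv (\<lambda>\<eta>. ennreal (norm (F1 \<eta>))) (\<lambda>\<eta>. ennreal (norm (F2 \<eta>))) \<xi> = (\<integral>\<^sup>+\<eta>. ?a \<eta> * ?b \<eta> \<partial>lebesgue)"
      unfolding nn_conv_def
    proof (intro nn_integral_cong)
      fix \<eta>
      have "norm (F1 (\<xi> - \<eta>)) * norm (F2 \<eta>) = 1 / (k1 (\<xi> - \<eta>) * k2 \<eta>) * (k1 (\<xi> - \<eta>) * norm (F1 (\<xi> - \<eta>)) * (k2 \<eta> * norm (F2 \<eta>)))"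
        using pos(2)[of "\<xi> - \<eta>"] pos(3)[of \<eta>] by simp
      then show "ennreal (norm (F1 (\<xi> - \<eta>))) * ennreal (norm (F2 \<eta>)) = ?a \<eta> * ?b \<eta>"
        using pos(2)[of "\<xi> - \<eta>"] pos(3)[of \<eta>]
        by (simp only: ennreal_mult[symmetric] norm_ge_zero less_imp_le mult_nonneg_nonneg divide_nonneg_nonneg zero_le_one)
    qed
    then have "(nn_conv (\<lambda>\<eta>. ennreal (norm (F1 \<eta>))) (\<lambda>\<eta>. ennreal (norm (F2 \<eta>))) \<xi>)\<^sup>2 \<le>
        (\<integral>\<^sup>+\<eta>. (?a \<eta>)\<^sup>2 \<partial>lebesgue) * (\<integral>\<^sup>+\<eta>. (?b \<eta>)\<^sup>2 \<partial>lebesgue)"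
      using Cauchy_Schwarz_nn_integral[OF ab] by simp
    also have "(\<integral>\<^sup>+\<eta>. (?a \<eta>)\<^sup>2 \<partial>lebesgue) = nn_conv (\<lambda>\<eta>. ennreal (1 / (k1 \<eta>)\<^sup>2)) (\<lambda>\<eta>. ennreal (1 / (k2 \<eta>)\<^sup>2)) \<xi>"
      unfolding nn_conv_def
    proof (intro nn_integral_cong)
      fix \<eta> show "(?a \<eta>)\<^sup>2 = ennreal (1 / (k1 (\<xi> - \<eta>))\<^sup>2) * ennreal (1 / (k2 \<eta>)\<^sup>2)"
        using pos(2)[of "\<xi> - \<eta>"] pos(3)[of \<eta>]
        by (simp add: ennreal_power less_imp_le power_divide power_mult_distrib flip: ennreal_mult)
    qed
    also have "(\<integral>\<^sup>+\<eta>. (?b \<eta>)\<^sup>2 \<partial>lebesgue) = nn_conv ?e1 ?e2 \<xi>"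
      unfolding nn_conv_def
    proof (intro nn_integral_cong)
      fix \<eta> show "(?b \<eta>)\<^sup>2 = ?e1 (\<xi> - \<eta>) * ?e2 \<eta>"
        using pos(2)[of "\<xi> - \<eta>"] pos(3)[of \<eta>]
        by (simp add: ennreal_power less_imp_le power_mult_distrib flip: ennreal_mult)
    qed
    finally have "(nn_conv (\<lambda>\<eta>. ennreal (norm (F1 \<eta>))) (\<lambda>\<eta>. ennreal (norm (F2 \<eta>))) \<xi>)\<^sup>2 \<le>
       ennreal (C\<^sup>2 / (k \<xi>)\<^sup>2) * nn_conv ?e1 ?e2 \<xi>"
      by (rule order_trans) (intro mult_right_mono hyp, simp)
    then have "ennreal ((k \<xi>)\<^sup>2) * (nn_conv (\<lambda>\<eta>. ennreal (norm (F1 \<eta>))) (\<lambda>\<eta>. ennreal (norm (F2 \<eta>))) \<xi>)\<^sup>2 \<le>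
       ennreal ((k \<xi>)\<^sup>2) * (ennreal (C\<^sup>2 / (k \<xi>)\<^sup>2) * nn_conv ?e1 ?e2 \<xi>)"
      by (rule mult_left_mono) simp
    also have "\<dots> = ennreal ((k \<xi>)\<^sup>2 * (C\<^sup>2 / (k \<xi>)\<^sup>2)) * nn_conv ?e1 ?e2 \<xi>"
      by (subst ennreal_mult, simp, simp, simp only: mult.assoc)
    also have "(k \<xi>)\<^sup>2 * (C\<^sup>2 / (k \<xi>)\<^sup>2) = C\<^sup>2" using pos(1)[of \<xi>] by simp
    finally show ?thesis .
  qed
  have "(\<integral>\<^sup>+\<xi>. ennreal ((k \<xi>)\<^sup>2) * (nn_conv (\<lambda>\<eta>. ennreal (norm (F1 \<eta>))) (\<lambda>\<eta>. ennreal (norm (F2 \<eta>))) \<xi>)\<^sup>2 \<partial>lborel)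
     \<le> (\<integral>\<^sup>+\<xi>. ennreal (C\<^sup>2) * nn_conv ?e1 ?e2 \<xi> \<partial>lborel)"
    by (intro nn_integral_mono pt)
  also have "\<dots> = ennreal (C\<^sup>2) * (\<integral>\<^sup>+\<xi>. nn_conv ?e1 ?e2 \<xi> \<partial>lborel)"
    by (rule nn_integral_cmult) (use nn_conv_measurable[OF em] in simp)
  also have "(\<integral>\<^sup>+\<xi>. nn_conv ?e1 ?e2 \<xi> \<partial>lborel) = energy k1 F1 * energy k2 F2"
    unfolding energy_def by (rule nn_integral_nn_conv[OF em])
  finally show ?thesis .
qed

lemma K_polD:
  assumes "k \<in> K_pol"
  shows "k \<in> borel_measurable lebesgue" "\<And>\<xi>. 0 < k \<xi>"
  using assms by (auto simp: K_pol_def)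

lemma K_pol_moderate:
  assumes "k \<in> K_pol"
  obtains C and N :: nat where "0 < C" "\<And>\<xi> \<eta>. k (\<xi> + \<eta>) \<le> C * bracket \<xi> ^ N * k \<eta>"
proof -
  obtain C M where CM: "0 < C" "0 < M" "\<And>\<xi> \<eta>. k (\<xi> + \<eta>) \<le> C * bracket \<xi> powr M * k \<eta>"
    using assms unfolding K_pol_def by blast
  obtain N :: nat where N: "M \<le> real N" using real_arch_simple by blast
  have "k (\<xi> + \<eta>) \<le> C * bracket \<xi> ^ N * k \<eta>" for \<xi> \<eta>
  proof -
    have "bracket \<xi> powr M \<le> bracket \<xi> powr real N" using N bracket_ge_1[of \<xi>] by (rule powr_mono)
    also have "\<dots> = bracket \<xi> ^ N" by (simp add: powr_realpow)
    finally have "C * bracket \<xi> powr M * k \<eta> \<le> C * bracket \<xi> ^ N * k \<eta>"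
      using CM(1) K_polD(2)[OF assms, of \<eta>] by (intro mult_left_mono mult_right_mono) auto
    with CM(3) show ?thesis by (rule order_trans)
  qed
  with CM(1) show thesis by (rule that)
qed

text \<open>A weighted Young inequality: as \<open>k\<close> is moderate, \<open>k \<bar>W\<bar>\<close> is dominated by the convolution of \<open>k \<bar>U\<bar>\<close> with a
  rapidly decreasing function.\<close>

lemma energy_module:
  fixes U W :: "real^'n::finite \<Rightarrow> complex"
  assumes k: "k \<in> K_pol" and U: "U \<in> borel_measurable borel" and \<phi>: "\<phi> \<in> schwartz"
    and W: "\<And>\<xi>. W \<xi> = (LINT \<zeta>|lborel. U \<zeta> * inv_ft \<phi> \<xi> \<zeta>)"
    and fin: "energy k U < \<infinity>"
  shows "energy k W < \<infinity>"
proof (rule K_pol_moderate[OF k])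
  fix C :: real and N assume C: "0 < C" and mod: "\<And>\<xi> \<eta>. k (\<xi> + \<eta>) \<le> C * bracket \<xi> ^ N * k \<eta>"
  note kp = K_polD(2)[OF k]
  note [measurable] = K_polD(1)[OF k]
  have [measurable]: "U \<in> borel_measurable lebesgue" using U by (intro measurable_completion) simp
  define a where "a \<zeta> = C * bracket \<zeta> ^ N * norm (complex_of_real (1 / (2 * pi) ^ CARD('n)) * fourier_fun \<phi> \<zeta>)" for \<zeta> :: "real^'n"
  have am: "a \<in> borel_measurable borel" unfolding a_def using schwartz_measurable[OF fourier_fun_schwartz[OF \<phi>]] by measurable
  have a0: "0 \<le> a \<zeta>" for \<zeta> using C by (simp add: a_def)
  have ai: "integrable lborel a"
  proof -
    have i: "integrable lborel (\<lambda>\<zeta>. complex_of_real (C * bracket \<zeta> ^ N) * (complex_of_real (1 / (2 * pi) ^ CARD('n)) * fourier_fun \<phi> \<zeta>))"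
      by (rule schwartz_mult_integrable[OF schwartz_cmult[OF fourier_fun_schwartz[OF \<phi>]], of _ C N])
         (use C in \<open>auto simp: norm_mult norm_power\<close>)
    have e: "norm (complex_of_real (C * bracket \<zeta> ^ N) * X) = C * bracket \<zeta> ^ N * norm X" for X and \<zeta> :: "real^'n"
      using C by (simp add: norm_mult norm_power)
    show ?thesis unfolding a_def[abs_def] by (rule integrable_norm[OF i, unfolded e])
  qed
  define A where "A = (\<integral>\<^sup>+\<zeta>. ennreal (a \<zeta>) \<partial>lborel)"
  have A: "A < \<infinity>" using ai a0 by (simp add: A_def integrable_iff_bounded)
  have aml[measurable]: "a \<in> borel_measurable lebesgue" using am by (intro measurable_completion) simp
  let ?e = "\<lambda>\<zeta>. ennreal ((k \<zeta> * norm (U \<zeta>))\<^sup>2)"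
  have em: "?e \<in> borel_measurable lebesgue" "(\<lambda>\<zeta>. ennreal (a \<zeta>)) \<in> borel_measurable lebesgue" by measurable
  have "ennreal ((k \<xi> * norm (W \<xi>))\<^sup>2) \<le> A * nn_conv (\<lambda>\<zeta>. ennreal (a \<zeta>)) ?e \<xi>" for \<xi>
  proof -
    note arm[measurable] = lebesgue_measurable_reflect[OF aml, of \<xi>]
    have pt: "k \<xi> * norm (U \<zeta> * inv_ft \<phi> \<xi> \<zeta>) \<le> a (\<xi> - \<zeta>) * (k \<zeta> * norm (U \<zeta>))" for \<zeta>
    proof -
      have "k \<xi> \<le> C * bracket (\<xi> - \<zeta>) ^ N * k \<zeta>" using mod[of "\<xi> - \<zeta>" \<zeta>] by simp
      then have "k \<xi> * norm (U \<zeta> * inv_ft \<phi> \<xi> \<zeta>) \<le> C * bracket (\<xi> - \<zeta>) ^ N * k \<zeta> * norm (U \<zeta> * inv_ft \<phi> \<xi> \<zeta>)"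
        by (rule mult_right_mono) simp
      then show ?thesis by (simp only: a_def inv_ft_def norm_mult mult_ac)
    qed
    have "ennreal (norm (W \<xi>)) \<le> (\<integral>\<^sup>+\<zeta>. ennreal (norm (U \<zeta> * inv_ft \<phi> \<xi> \<zeta>)) \<partial>lborel)"
      unfolding W
      by (cases "integrable lborel (\<lambda>\<zeta>. U \<zeta> * inv_ft \<phi> \<xi> \<zeta>)")
         (simp_all add: integral_norm_bound_ennreal not_integrable_integral_eq)
    then have "ennreal (k \<xi> * norm (W \<xi>)) \<le> ennreal (k \<xi>) * (\<integral>\<^sup>+\<zeta>. ennreal (norm (U \<zeta> * inv_ft \<phi> \<xi> \<zeta>)) \<partial>lborel)"
      using kp[of \<xi>] by (simp add: ennreal_mult mult_left_mono)
    also have "\<dots> = (\<integral>\<^sup>+\<zeta>. ennreal (k \<xi>) * ennreal (norm (U \<zeta> * inv_ft \<phi> \<xi> \<zeta>)) \<partial>lborel)"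
      by (rule nn_integral_cmult[symmetric])
         (use U schwartz_measurable[OF inv_ft_schwartz[OF \<phi>]] in measurable)
    \<comment> \<open>the kernel \<open>a\<close> is split into two square roots for the Cauchy-Schwarz inequality\<close>
    also have "\<dots> \<le> (\<integral>\<^sup>+\<zeta>. ennreal (sqrt (a (\<xi> - \<zeta>))) * ennreal (sqrt (a (\<xi> - \<zeta>)) * (k \<zeta> * norm (U \<zeta>))) \<partial>lborel)"
    proof (intro nn_integral_mono)
      fix \<zeta>
      have "ennreal (k \<xi>) * ennreal (norm (U \<zeta> * inv_ft \<phi> \<xi> \<zeta>)) \<le> ennreal (a (\<xi> - \<zeta>) * (k \<zeta> * norm (U \<zeta>)))"
        using pt[of \<zeta>] kp[of \<xi>] by (simp add: ennreal_leI less_imp_le flip: ennreal_mult)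
      also have "a (\<xi> - \<zeta>) * (k \<zeta> * norm (U \<zeta>)) = sqrt (a (\<xi> - \<zeta>)) * (sqrt (a (\<xi> - \<zeta>)) * (k \<zeta> * norm (U \<zeta>)))"
        using a0[of "\<xi> - \<zeta>"] by (simp flip: mult.assoc)
      finally show "ennreal (k \<xi>) * ennreal (norm (U \<zeta> * inv_ft \<phi> \<xi> \<zeta>)) \<le> ennreal (sqrt (a (\<xi> - \<zeta>))) * ennreal (sqrt (a (\<xi> - \<zeta>)) * (k \<zeta> * norm (U \<zeta>)))"
        using a0[of "\<xi> - \<zeta>"] kp[of \<zeta>] by (simp add: ennreal_mult less_imp_le)
    qed
    finally have "(ennreal (k \<xi> * norm (W \<xi>)))\<^sup>2 \<le>
       (\<integral>\<^sup>+\<zeta>. ennreal (sqrt (a (\<xi> - \<zeta>))) * ennreal (sqrt (a (\<xi> - \<zeta>)) * (k \<zeta> * norm (U \<zeta>))) \<partial>lborel)\<^sup>2"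
      by (rule power_mono_ennreal)
    also have "\<dots> \<le> (\<integral>\<^sup>+\<zeta>. (ennreal (sqrt (a (\<xi> - \<zeta>))))\<^sup>2 \<partial>lebesgue) * (\<integral>\<^sup>+\<zeta>. (ennreal (sqrt (a (\<xi> - \<zeta>)) * (k \<zeta> * norm (U \<zeta>))))\<^sup>2 \<partial>lebesgue)"
      unfolding nn_integral_completion[symmetric, where M=lborel and f="\<lambda>\<zeta>. ennreal (sqrt (a (\<xi> - \<zeta>))) * ennreal (sqrt (a (\<xi> - \<zeta>)) * (k \<zeta> * norm (U \<zeta>)))"]
      by (rule Cauchy_Schwarz_nn_integral) measurable
    also have "(\<integral>\<^sup>+\<zeta>. (ennreal (sqrt (a (\<xi> - \<zeta>))))\<^sup>2 \<partial>lebesgue) = (\<integral>\<^sup>+\<zeta>. ennreal (a (\<xi> - \<zeta>)) \<partial>lborel)"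
      unfolding nn_integral_completion using a0 by (intro nn_integral_cong) (simp add: ennreal_power)
    also have "\<dots> = (\<integral>\<^sup>+\<zeta>. ennreal (a \<zeta>) \<partial>distr lborel borel (\<lambda>\<zeta>. \<xi> - \<zeta>))"
      using am by (subst nn_integral_distr) auto
    also have "\<dots> = A" by (simp add: lborel_distr_reflect A_def)
    also have "(\<integral>\<^sup>+\<zeta>. (ennreal (sqrt (a (\<xi> - \<zeta>)) * (k \<zeta> * norm (U \<zeta>))))\<^sup>2 \<partial>lebesgue) = nn_conv (\<lambda>\<zeta>. ennreal (a \<zeta>)) ?e \<xi>"
      unfolding nn_conv_def
    proof (intro nn_integral_cong)
      fix \<zeta>
      show "(ennreal (sqrt (a (\<xi> - \<zeta>)) * (k \<zeta> * norm (U \<zeta>))))\<^sup>2 = ennreal (a (\<xi> - \<zeta>)) * ?e \<zeta>"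
        using a0[of "\<xi> - \<zeta>"] kp[of \<zeta>] by (simp add: ennreal_power power_mult_distrib less_imp_le flip: ennreal_mult)
    qed
    finally show ?thesis using kp[of \<xi>] by (simp add: ennreal_power less_imp_le)
  qed
  then have "energy k W \<le> (\<integral>\<^sup>+\<xi>. A * nn_conv (\<lambda>\<zeta>. ennreal (a \<zeta>)) ?e \<xi> \<partial>lborel)"
    unfolding energy_def by (intro nn_integral_mono)
  also have "\<dots> = A * (\<integral>\<^sup>+\<xi>. nn_conv (\<lambda>\<zeta>. ennreal (a \<zeta>)) ?e \<xi> \<partial>lborel)"
    by (rule nn_integral_cmult) (use nn_conv_measurable[OF em(2,1)] in simp)
  also have "\<dots> = A * (A * energy k U)"
    unfolding nn_integral_nn_conv[OF em(2,1)] by (simp add: A_def energy_def)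
  also have "\<dots> < \<infinity>" using A fin by (simp add: ennreal_mult_less_top)
  finally show ?thesis .
qed

lemma energy_add_finite:
  assumes k: "k \<in> K_pol" and m: "F \<in> borel_measurable borel" "G \<in> borel_measurable borel"
    and "energy k F < \<infinity>" "energy k G < \<infinity>"
  shows "energy k (\<lambda>\<xi>. F \<xi> + G \<xi>) < \<infinity>"
proof -
  note kp = K_polD(2)[OF k]
  note [measurable] = K_polD(1)[OF k]
  have [measurable]: "F \<in> borel_measurable lebesgue" "G \<in> borel_measurable lebesgue"
    using m by (intro measurable_completion; simp)+
  have "ennreal ((k \<xi> * norm (F \<xi> + G \<xi>))\<^sup>2) \<le> 2 * ennreal ((k \<xi> * norm (F \<xi>))\<^sup>2) + 2 * ennreal ((k \<xi> * norm (G \<xi>))\<^sup>2)" for \<xi>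
  proof -
    have "(k \<xi> * norm (F \<xi> + G \<xi>))\<^sup>2 \<le> (k \<xi> * norm (F \<xi>) + k \<xi> * norm (G \<xi>))\<^sup>2"
      unfolding distrib_left[symmetric] using kp[of \<xi>] by (intro power_mono mult_left_mono norm_triangle_ineq) auto
    also have "\<dots> \<le> 2 * (k \<xi> * norm (F \<xi>))\<^sup>2 + 2 * (k \<xi> * norm (G \<xi>))\<^sup>2"
      using zero_le_power2[of "k \<xi> * norm (F \<xi>) - k \<xi> * norm (G \<xi>)"] by (simp add: power2_sum power2_diff)
    finally have "ennreal ((k \<xi> * norm (F \<xi> + G \<xi>))\<^sup>2) \<le> ennreal (2 * (k \<xi> * norm (F \<xi>))\<^sup>2 + 2 * (k \<xi> * norm (G \<xi>))\<^sup>2)"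
      by (rule ennreal_leI)
    then show ?thesis by (simp add: ennreal_mult)
  qed
  then have "energy k (\<lambda>\<xi>. F \<xi> + G \<xi>) \<le> (\<integral>\<^sup>+\<xi>. 2 * ennreal ((k \<xi> * norm (F \<xi>))\<^sup>2) + 2 * ennreal ((k \<xi> * norm (G \<xi>))\<^sup>2) \<partial>lebesgue)"
    unfolding energy_def nn_integral_completion[symmetric, where M=lborel and f="\<lambda>\<xi>. ennreal ((k \<xi> * norm (F \<xi> + G \<xi>))\<^sup>2)"]
    by (intro nn_integral_mono)
  also have "\<dots> = 2 * energy k F + 2 * energy k G"
    by (subst nn_integral_add, measurable, subst nn_integral_cmult, measurable, subst nn_integral_cmult, measurable,
        simp only: energy_def nn_integral_completion)
  also have "\<dots> < \<infinity>" using assms(4,5) by (simp add: ennreal_mult_less_top)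
  finally show ?thesis .
qed

section \<open>Localizations of finite energy\<close>

lemma loc_ft_sum:
  assumes u: "u \<in> distributions" and f: "\<And>j. j \<in> J \<Longrightarrow> f j \<in> test_functions"
  shows "loc_ft u (\<lambda>x. \<Sum>j\<in>J. f j x) \<xi> = (\<Sum>j\<in>J. loc_ft u (f j) \<xi>)"
  unfolding loc_ft_def sum_distrib_right
  by (rule distribution_sum[OF u]) (intro test_mult f smooth_chr)

lemma energy_loc_ft_mult:
  assumes "k \<in> K_pol" "u \<in> distributions" "\<psi> \<in> test_functions" "\<phi> \<in> schwartz"
    and "energy k (loc_ft u \<psi>) < \<infinity>"
  shows "energy k (loc_ft u (\<lambda>x. \<psi> x * \<phi> x)) < \<infinity>"
  by (rule energy_module[OF assms(1) loc_ft_measurable[OF assms(2,3)] assms(4) loc_ft_mult[OF assms(2-4)] assms(5)])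

lemma energy_loc_ft_sum:
  assumes k: "k \<in> K_pol" and u: "u \<in> distributions" and J: "finite J"
    and f: "\<And>j. j \<in> J \<Longrightarrow> f j \<in> test_functions" "\<And>j. j \<in> J \<Longrightarrow> energy k (loc_ft u (f j)) < \<infinity>"
  shows "energy k (\<lambda>\<xi>. \<Sum>j\<in>J. loc_ft u (f j) \<xi>) < \<infinity>"
  using J f
proof (induction J)
  case empty then show ?case by (simp add: energy_def)
next
  case (insert j J)
  have "energy k (\<lambda>\<xi>. loc_ft u (f j) \<xi> + (\<Sum>j\<in>J. loc_ft u (f j) \<xi>)) < \<infinity>"
    by (rule energy_add_finite[OF k])
       (use insert in \<open>auto intro!: borel_measurable_sum loc_ft_measurable u\<close>)
  then show ?case using insert by simp
qed

lemma AE_lebesgue_dense: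
  fixes S :: "(real^'n::finite) set"
  assumes "AE y in lebesgue. P y" "open S" "S \<noteq> {}"
  obtains y where "y \<in> S" "P y"
proof -
  obtain N where N': "{y \<in> space lebesgue. \<not> P y} \<subseteq> N" "emeasure lebesgue N = 0" "N \<in> sets lebesgue"
    by (rule AE_E[OF assms(1)])
  then have N: "{y. \<not> P y} \<subseteq> N" "N \<in> null_sets lebesgue" by (auto intro: null_setsI)
  have "\<not> S \<subseteq> N"
  proof
    assume "S \<subseteq> N"
    with N have "negligible S" using negligible_subset negligible_iff_null_sets by blast
    with open_not_negligible[OF assms(2,3)] show False by blast
  qed
  with N that show thesis by blast
qed

text \<open>The points \<open>y\<close> with a finite norm are dense, so finitely many of the translates \<open>\<theta>\<^sub>y\<close> have no common zero on
  the support of \<open>\<psi>\<close>.  With \<open>s\<close> the sum of the \<open>\<bar>\<theta>\<^sub>y\<bar>\<^sup>2\<close>, the functions \<open>h\<^sub>y = \<psi> cnj \<theta>\<^sub>y / s\<close> are smooth and \<open>\<psi>\<close> is the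
  sum of the \<open>\<theta>\<^sub>y h\<^sub>y\<close>.\<close>

theorem energy_finite_everywhere:
  assumes k: "k \<in> K_pol" and u: "u \<in> distributions"
    and \<theta>: "\<theta> \<in> test_functions" "\<theta> \<noteq> (\<lambda>x. 0)"
    and fin: "AE y in lebesgue. energy k (loc_ft u (translate y \<theta>)) < \<infinity>"
    and \<psi>: "\<psi> \<in> test_functions"
  shows "energy k (loc_ft u \<psi>) < \<infinity>"
proof -
  define G where "G = {y. energy k (loc_ft u (translate y \<theta>)) < \<infinity>}"
  define V where "V y = {x. translate y \<theta> x \<noteq> 0}" for y
  have tt: "translate y \<theta> \<in> test_functions" for y by (rule test_translate[OF \<theta>(1)])
  have oV: "open (V y)" for y
    unfolding V_def by (rule open_Collect_neq[OF smooth_continuous_on[OF test_smooth[OF tt]] continuous_on_const])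
  have cover: "\<exists>y\<in>G. x \<in> V y" for x
  proof -
    obtain z where z: "\<theta> z \<noteq> 0" using \<theta>(2) by blast
    have "open {y. \<theta> (x - y) \<noteq> 0}"
    proof (rule open_Collect_neq[OF _ continuous_on_const])
      show "continuous_on UNIV (\<lambda>y. \<theta> (x - y))"
        by (rule continuous_on_compose2[OF smooth_continuous_on[OF test_smooth[OF \<theta>(1)], of UNIV]])
           (auto intro: continuous_intros)
    qed
    moreover have "x - z \<in> {y. \<theta> (x - y) \<noteq> 0}" using z by simp
    ultimately obtain y where "y \<in> {y. \<theta> (x - y) \<noteq> 0}" "energy k (loc_ft u (translate y \<theta>)) < \<infinity>"
      using AE_lebesgue_dense[OF fin] by blast
    then show ?thesis by (auto simp: G_def V_def translate_def)
  qed
  obtain Y where Y: "Y \<subseteq> G" "finite Y" "supp \<psi> \<subseteq> (\<Union>y\<in>Y. V y)"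
  proof (rule compactE_image[OF test_compact[OF \<psi>], of G V])
    show "supp \<psi> \<subseteq> (\<Union>y\<in>G. V y)" using cover by blast
  qed (use oV that in auto)
  define s where "s x = (\<Sum>y\<in>Y. translate y \<theta> x * cnj (translate y \<theta> x))" for x
  have sm: "smooth s"
    unfolding s_def[abs_def] by (intro smooth_sum smooth_mult smooth_cnj test_smooth tt)
  have s0: "s x \<noteq> 0" if x: "x \<in> supp \<psi>" for x
  proof -
    obtain y where y: "y \<in> Y" "translate y \<theta> x \<noteq> 0" using Y(3) x by (auto simp: V_def)
    have "s x = complex_of_real (\<Sum>y\<in>Y. (norm (translate y \<theta> x))\<^sup>2)"
      unfolding s_def of_real_sum by (intro sum.cong refl) (simp only: complex_norm_square)
    moreover have "0 < (\<Sum>y\<in>Y. (norm (translate y \<theta> x))\<^sup>2)"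
      by (rule sum_pos2[OF Y(2) y(1)]) (use y(2) in auto)
    ultimately show ?thesis by (metis of_real_eq_0_iff less_irrefl)
  qed
  define h where "h y x = \<psi> x * cnj (translate y \<theta> x) / s x" for y x
  have h: "h y \<in> test_functions" for y
  proof (rule testI[OF _ test_compact[OF \<psi>]])
    have "supp (\<lambda>x. \<psi> x * cnj (translate y \<theta> x)) \<subseteq> {x. s x \<noteq> 0}"
      by (rule subset_trans[OF supp_mult_left]) (use s0 in auto)
    then show "smooth (h y)"
      unfolding h_def[abs_def]
      by (intro smooth_divide sm smooth_mult smooth_cnj test_smooth tt \<psi>)
  qed (simp add: h_def notin_supp)
  have "\<psi> = (\<lambda>x. \<Sum>y\<in>Y. translate y \<theta> x * h y x)"
  proof
    fix x
    have "(\<Sum>y\<in>Y. translate y \<theta> x * h y x) = \<psi> x * (s x / s x)"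
      unfolding h_def s_def[of x] sum_divide_distrib sum_distrib_left by (intro sum.cong refl) simp
    also have "\<dots> = \<psi> x" using s0[of x] notin_supp[of x \<psi>] by (cases "x \<in> supp \<psi>") auto
    finally show "\<psi> x = (\<Sum>y\<in>Y. translate y \<theta> x * h y x)" ..
  qed
  then have "loc_ft u \<psi> = (\<lambda>\<xi>. \<Sum>y\<in>Y. loc_ft u (\<lambda>x. translate y \<theta> x * h y x) \<xi>)"
    using loc_ft_sum[OF u, of Y "\<lambda>y x. translate y \<theta> x * h y x"] test_mult[OF tt test_smooth[OF h]] by auto
  moreover have "energy k (\<lambda>\<xi>. \<Sum>y\<in>Y. loc_ft u (\<lambda>x. translate y \<theta> x * h y x) \<xi>) < \<infinity>"
    by (rule energy_loc_ft_sum[OF k u Y(2) test_mult[OF tt test_smooth[OF h]]])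
       (rule energy_loc_ft_mult[OF k u tt test_schwartz[OF h]], use Y(1) in \<open>auto simp: G_def\<close>)
  ultimately show ?thesis by simp
qed

section \<open>Pairings with convolutions\<close>

lemma conv_lborel:
  assumes [measurable]: "F1 \<in> borel_measurable borel" "F2 \<in> borel_measurable borel"
  shows "conv F1 F2 \<xi> = (LINT \<eta>|lborel. F1 (\<xi> - \<eta>) * F2 \<eta>)"
  unfolding conv_def by (rule integral_completion) measurable

lemma conv_measurable:
  assumes [measurable]: "F1 \<in> borel_measurable borel" "F2 \<in> borel_measurable borel"
  shows "conv F1 F2 \<in> borel_measurable borel"
proof -
  have "(\<lambda>\<xi>. LINT \<eta>|lborel. F1 (\<xi> - \<eta>) * F2 \<eta>) \<in> borel_measurable borel"
    by (rule lborel.borel_measurable_lebesgue_integral) measurable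
  then show ?thesis by (simp add: conv_lborel[OF assms] cong: measurable_cong)
qed

lemma conv_commute:
  assumes [measurable]: "F1 \<in> borel_measurable borel" "F2 \<in> borel_measurable borel"
  shows "conv F1 F2 \<xi> = conv F2 F1 \<xi>"
proof -
  have "(LINT \<eta>|lborel. F1 (\<xi> - \<eta>) * F2 \<eta>) = (LINT \<eta>|lborel. F1 (\<xi> - (\<xi> + (-1) *\<^sub>R \<eta>)) * F2 (\<xi> + (-1) *\<^sub>R \<eta>))"
    using lborel_integral_affine(1)[of "\<lambda>\<eta>. F1 (\<xi> - \<eta>) * F2 \<eta>" "-1" \<xi>] by simp
  then show ?thesis by (simp add: conv_lborel[OF assms] conv_lborel[OF assms(2,1)] mult.commute)
qed

abbreviation nconv :: "(real^'n::finite \<Rightarrow> complex) \<Rightarrow> (real^'n \<Rightarrow> complex) \<Rightarrow> real^'n \<Rightarrow> ennreal" where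
  "nconv F1 F2 \<equiv> nn_conv (\<lambda>\<eta>. ennreal (norm (F1 \<eta>))) (\<lambda>\<eta>. ennreal (norm (F2 \<eta>)))"

lemma nconv_lborel: "nconv F1 F2 \<xi> = (\<integral>\<^sup>+\<eta>. ennreal (norm (F1 (\<xi> - \<eta>) * F2 \<eta>)) \<partial>lborel)"
  by (simp add: nn_conv_def nn_integral_completion norm_mult ennreal_mult)

lemma nconv_measurable:
  assumes "F1 \<in> borel_measurable borel" "F2 \<in> borel_measurable borel"
  shows "nconv F1 F2 \<in> borel_measurable borel"
proof -
  have [measurable]: "F1 \<in> borel_measurable lebesgue" "F2 \<in> borel_measurable lebesgue"
    using assms by (intro measurable_completion; simp)+
  show ?thesis by (rule nn_conv_measurable) measurable
qed

lemma nconv_commute: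
  assumes [measurable]: "F1 \<in> borel_measurable borel" "F2 \<in> borel_measurable borel"
  shows "nconv F1 F2 \<xi> = nconv F2 F1 \<xi>"
proof -
  have "nconv F1 F2 \<xi> = (\<integral>\<^sup>+\<eta>. ennreal (norm (F1 (\<xi> - \<eta>) * F2 \<eta>)) \<partial>distr lborel borel (\<lambda>\<eta>. \<xi> - \<eta>))"
    by (simp add: nconv_lborel lborel_distr_reflect)
  also have "\<dots> = nconv F2 F1 \<xi>"
    by (subst nn_integral_distr) (auto simp: nconv_lborel mult.commute)
  finally show ?thesis .
qed

lemma norm_conv_le:
  assumes "F1 \<in> borel_measurable borel" "F2 \<in> borel_measurable borel"
  shows "ennreal (norm (conv F1 F2 \<xi>)) \<le> nconv F1 F2 \<xi>"
  unfolding conv_lborel[OF assms] nconv_lborel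
  by (cases "integrable lborel (\<lambda>\<eta>. F1 (\<xi> - \<eta>) * F2 \<eta>)")
     (simp_all add: integral_norm_bound_ennreal not_integrable_integral_eq)

text \<open>Fubini's theorem and a translation move the convolution from \<open>F1\<close> and \<open>F2\<close> to the function that they are
  tested with.\<close>

lemma conv_pairing:
  fixes F1 F2 g :: "real^'n::finite \<Rightarrow> complex"
  assumes [measurable]: "F1 \<in> borel_measurable borel" "F2 \<in> borel_measurable borel" "g \<in> borel_measurable borel"
    and fin: "(\<integral>\<^sup>+\<xi>. nconv F1 F2 \<xi> * ennreal (norm (g \<xi>)) \<partial>lborel) < \<infinity>"
  shows "(LINT \<xi>|lborel. conv F1 F2 \<xi> * g \<xi>) = (LINT \<eta>|lborel. F2 \<eta> * (LINT \<xi>|lborel. F1 \<xi> * g (\<xi> + \<eta>)))"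
proof -
  let ?f = "\<lambda>\<xi> \<eta>. F1 (\<xi> - \<eta>) * F2 \<eta> * g \<xi>"
  have i: "integrable (lborel \<Otimes>\<^sub>M lborel) (case_prod ?f)"
    unfolding integrable_iff_bounded
  proof (intro conjI)
    show "case_prod ?f \<in> borel_measurable (lborel \<Otimes>\<^sub>M lborel)" by measurable
    have "(\<integral>\<^sup>+z. ennreal (norm (case_prod ?f z)) \<partial>(lborel \<Otimes>\<^sub>M lborel)) = (\<integral>\<^sup>+\<xi>. \<integral>\<^sup>+\<eta>. ennreal (norm (case_prod ?f (\<xi>, \<eta>))) \<partial>lborel \<partial>lborel)"
      by (rule lborel.nn_integral_fst[symmetric]) measurable
    also have "\<dots> = (\<integral>\<^sup>+\<xi>. nconv F1 F2 \<xi> * ennreal (norm (g \<xi>)) \<partial>lborel)"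
      unfolding nconv_lborel
      by (intro nn_integral_cong, subst nn_integral_multc[symmetric], measurable)
         (simp add: norm_mult ennreal_mult)
    finally show "(\<integral>\<^sup>+z. ennreal (norm (case_prod ?f z)) \<partial>(lborel \<Otimes>\<^sub>M lborel)) < \<infinity>" using fin by simp
  qed
  have "(LINT \<xi>|lborel. conv F1 F2 \<xi> * g \<xi>) = (LINT \<xi>|lborel. LINT \<eta>|lborel. ?f \<xi> \<eta>)"
    by (simp add: conv_lborel)
  also have "\<dots> = (LINT \<eta>|lborel. LINT \<xi>|lborel. ?f \<xi> \<eta>)"
    by (rule lborel_pair.Fubini_integral[OF i, symmetric])
  also have "\<dots> = (LINT \<eta>|lborel. F2 \<eta> * (LINT \<xi>|lborel. F1 \<xi> * g (\<xi> + \<eta>)))"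
  proof (intro Bochner_Integration.integral_cong refl)
    fix \<eta>
    have "(LINT \<xi>|lborel. ?f \<xi> \<eta>) = (LINT \<xi>|lborel. F2 \<eta> * (F1 (\<xi> - \<eta>) * g \<xi>))" by (simp add: mult_ac)
    also have "\<dots> = F2 \<eta> * (LINT \<xi>|lborel. F1 (\<xi> - \<eta>) * g \<xi>)" by simp
    also have "(LINT \<xi>|lborel. F1 (\<xi> - \<eta>) * g \<xi>) = (LINT \<xi>|lborel. F1 ((\<xi> + \<eta>) - \<eta>) * g (\<xi> + \<eta>))"
      by (rule lborel_integral_translate(1)[symmetric]) measurable
    finally show "(LINT \<xi>|lborel. ?f \<xi> \<eta>) = F2 \<eta> * (LINT \<xi>|lborel. F1 \<xi> * g (\<xi> + \<eta>))" by simp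
  qed
  finally show ?thesis .
qed

text \<open>A moderate weight satisfies \<open>1 / k \<le> D \<langle>\<xi>\<rangle>\<^sup>N\<close>, so functions in the weighted \<open>L\<^sup>2\<close> space are integrable after
  division by a power of the bracket.\<close>

lemma weighted_L2_decay:
  fixes k :: "real^'n::finite \<Rightarrow> real"
  assumes k: "k \<in> K_pol"
  obtains M :: nat where "\<And>G. G \<in> borel_measurable borel \<Longrightarrow>
     (\<integral>\<^sup>+\<xi>. ennreal ((k \<xi>)\<^sup>2) * (G \<xi>)\<^sup>2 \<partial>lborel) < \<infinity> \<Longrightarrow> (\<integral>\<^sup>+\<xi>. G \<xi> * ennreal (1 / bracket \<xi> ^ M) \<partial>lborel) < \<infinity>"
proof (rule K_pol_moderate[OF k])
  fix C :: real and N assume C: "0 < C" and mod: "\<And>\<xi> \<eta>. k (\<xi> + \<eta>) \<le> C * bracket \<xi> ^ N * k \<eta>"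
  note kp = K_polD(2)[OF k]
  note [measurable] = K_polD(1)[OF k]
  define D where "D = C / k 0"
  have D: "0 < D" using C kp[of 0] by (simp add: D_def)
  have inv: "1 / k \<xi> \<le> D * bracket \<xi> ^ N" for \<xi>
    using mod[of "- \<xi>" \<xi>] kp[of 0] kp[of \<xi>] by (simp add: D_def field_simps)
  \<comment> \<open>\<open>N\<close> powers of the bracket compensate for \<open>1 / k\<close>; the square of the remaining ones is integrable\<close>
  let ?M = "N + CARD('n)"
  let ?h = "\<lambda>\<xi>. ennreal (1 / (k \<xi> * bracket \<xi> ^ ?M))"
  have bm[measurable]: "bracket \<in> borel_measurable lebesgue" by (rule measurable_completion) simp
  have "(\<integral>\<^sup>+\<xi>. (?h \<xi>)\<^sup>2 \<partial>lborel) \<le> (\<integral>\<^sup>+\<xi>. ennreal (D\<^sup>2 * (1 / bracket \<xi> ^ (2 * CARD('n)))) \<partial>(lborel :: (real^'n) measure))"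
  proof (intro nn_integral_mono)
    fix \<xi> :: "real^'n"
    have "1 / (k \<xi> * bracket \<xi> ^ ?M) = (1 / k \<xi>) * (1 / bracket \<xi> ^ ?M)" by simp
    also have "\<dots> \<le> (D * bracket \<xi> ^ N) * (1 / bracket \<xi> ^ ?M)"
      by (intro mult_right_mono inv) simp
    also have "\<dots> = D * (1 / bracket \<xi> ^ CARD('n))"
      using less_imp_neq[OF bracket_pos[of \<xi>]] by (simp add: power_add)
    finally have "(1 / (k \<xi> * bracket \<xi> ^ ?M))\<^sup>2 \<le> (D * (1 / bracket \<xi> ^ CARD('n)))\<^sup>2"
      using kp[of \<xi>] by (intro power_mono) auto
    also have "\<dots> = D\<^sup>2 * (1 / bracket \<xi> ^ (2 * CARD('n)))"
      by (simp add: power_mult_distrib power_divide power_mult[symmetric] mult.commute)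
    finally show "(?h \<xi>)\<^sup>2 \<le> ennreal (D\<^sup>2 * (1 / bracket \<xi> ^ (2 * CARD('n))))"
      using kp[of \<xi>] by (simp add: ennreal_power less_imp_le ennreal_leI)
  qed
  also have "\<dots> < \<infinity>"
  proof -
    have "integrable lborel (\<lambda>\<xi>::real^'n. D\<^sup>2 * (1 / bracket \<xi> ^ (2 * CARD('n))))"
      by (intro integrable_mult_right bracket_integrable)
    then show ?thesis by (simp add: integrable_iff_bounded)
  qed
  finally have hfin: "(\<integral>\<^sup>+\<xi>. (?h \<xi>)\<^sup>2 \<partial>lborel) < \<infinity>" .
  show thesis
  proof (rule that[of ?M])
    fix G :: "real^'n \<Rightarrow> ennreal" assume G: "G \<in> borel_measurable borel"
      and fin: "(\<integral>\<^sup>+\<xi>. ennreal ((k \<xi>)\<^sup>2) * (G \<xi>)\<^sup>2 \<partial>lborel) < \<infinity>"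
    have [measurable]: "G \<in> borel_measurable lebesgue" using G by (intro measurable_completion) simp
    have "(\<integral>\<^sup>+\<xi>. G \<xi> * ennreal (1 / bracket \<xi> ^ ?M) \<partial>lborel) = (\<integral>\<^sup>+\<xi>. (ennreal (k \<xi>) * G \<xi>) * ?h \<xi> \<partial>lebesgue)"
      unfolding nn_integral_completion
    proof (intro nn_integral_cong)
      fix \<xi> :: "real^'n"
      have "1 / bracket \<xi> ^ ?M = k \<xi> * (1 / (k \<xi> * bracket \<xi> ^ ?M))" using kp[of \<xi>] by simp
      then have "ennreal (1 / bracket \<xi> ^ ?M) = ennreal (k \<xi>) * ?h \<xi>"
        using kp[of \<xi>] by (metis ennreal_mult' less_imp_le)
      then show "G \<xi> * ennreal (1 / bracket \<xi> ^ ?M) = (ennreal (k \<xi>) * G \<xi>) * ?h \<xi>" by (simp only: mult_ac)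
    qed
    also have "\<dots>\<^sup>2 \<le> (\<integral>\<^sup>+\<xi>. (ennreal (k \<xi>) * G \<xi>)\<^sup>2 \<partial>lebesgue) * (\<integral>\<^sup>+\<xi>. (?h \<xi>)\<^sup>2 \<partial>lebesgue)"
      by (rule Cauchy_Schwarz_nn_integral) measurable
    also have "(\<integral>\<^sup>+\<xi>. (ennreal (k \<xi>) * G \<xi>)\<^sup>2 \<partial>lebesgue) = (\<integral>\<^sup>+\<xi>. ennreal ((k \<xi>)\<^sup>2) * (G \<xi>)\<^sup>2 \<partial>lborel)"
      unfolding nn_integral_completion using kp
      by (intro nn_integral_cong) (simp add: power_mult_distrib ennreal_power less_imp_le)
    also have "\<dots> * (\<integral>\<^sup>+\<xi>. (?h \<xi>)\<^sup>2 \<partial>lebesgue) < \<infinity>"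
      using fin hfin by (simp only: nn_integral_completion infinity_ennreal_def ennreal_mult_less_top) blast
    finally show "(\<integral>\<^sup>+\<xi>. G \<xi> * ennreal (1 / bracket \<xi> ^ ?M) \<partial>lborel) < \<infinity>"
      by (simp add: power_less_top_ennreal)
  qed
qed

section \<open>Tempered distributions are determined by their Fourier transforms on test functions\<close>

text \<open>Outside the ball of radius \<open>R\<close> one of the powers of the bracket can be traded for the factor \<open>1 / R\<close>, and
  inside the ball the function vanishes.  The derivatives of the dilated cutoffs are bounded uniformly in
  \<open>R \<ge> 1\<close>.\<close>

lemma schwartz_bound_one_minus_cutoff:
  assumes g: "g \<in> schwartz"
  obtains K where "\<And>R. 1 \<le> R \<Longrightarrow> schwartz_bound m (K / R) (\<lambda>x. g x - cutoff R x * g x)"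
proof -
  let ?\<chi> = "\<lambda>x :: real^'a. 1 - plateau x"
  have s\<chi>: "smooth ?\<chi>" by (intro smooth_diff smooth_const test_smooth test_plateau)
  have "\<forall>\<alpha> :: 'a list. \<exists>A. \<forall>x. norm (iter_partial \<alpha> ?\<chi> x) \<le> A"
  proof
    fix \<alpha> :: "'a list"
    obtain A where A: "\<And>x. norm (iter_partial \<alpha> plateau x) \<le> A"
      using test_bounded[OF test_iter_partial[OF test_plateau, of \<alpha>]] that by blast
    have c: "norm (iter_partial \<alpha> (\<lambda>x. 1) x) \<le> 1" for x :: "real^'a"
      by (simp add: iter_partial_const)
    have "norm (iter_partial \<alpha> ?\<chi> x) \<le> 1 + A" for x
      unfolding iter_partial_diff[OF smooth_const test_smooth[OF test_plateau]]
      by (rule order_trans[OF norm_triangle_ineq4 add_mono[OF c A]])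
    then show "\<exists>A. \<forall>x. norm (iter_partial \<alpha> ?\<chi> x) \<le> A" by blast
  qed
  then obtain A where "\<forall>\<alpha>. \<forall>x. norm (iter_partial \<alpha> ?\<chi> x) \<le> A \<alpha>" unfolding choice_iff ..
  then have A: "\<And>\<alpha> x. norm (iter_partial \<alpha> ?\<chi> x) \<le> A \<alpha>" by blast
  have A0: "0 \<le> A \<alpha>" for \<alpha> using order_trans[OF norm_ge_zero A[of \<alpha> 0]] .
  define A' where "A' = (\<Sum>\<alpha> | length \<alpha> \<le> m. A \<alpha>)"
  have A'0: "0 \<le> A'" unfolding A'_def by (intro sum_nonneg A0)
  obtain B where B: "schwartz_bound (m + 1) B g" using schwartz_obtain_bound[OF g] .
  have B0: "0 \<le> B" by (rule schwartz_bound_nonneg[OF B])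
  show thesis
  proof (rule that[of "2 ^ m * (A' * B)"])
    fix R :: real assume R: "1 \<le> R"
    define h where "h = (\<lambda>x. ?\<chi> ((1 / R) *\<^sub>R x + 0))"
    have sh: "smooth h" unfolding h_def by (rule iter_partial_affine(2)[OF s\<chi>])
    have hA: "norm (iter_partial \<beta> h x) \<le> A'" if "length \<beta> \<le> m" for \<beta> x
    proof -
      have "norm (iter_partial \<beta> h x) = (1 / R) ^ length \<beta> * norm (iter_partial \<beta> ?\<chi> ((1 / R) *\<^sub>R x + 0))"
        unfolding h_def iter_partial_affine(1)[OF s\<chi>] using R by (simp add: norm_mult norm_power norm_divide)
      also have "\<dots> \<le> 1 * A \<beta>"
        using R by (intro mult_mono A power_le_one) auto
      also have "\<dots> \<le> A'"
        unfolding A'_def using that A0 finite_multi_indices by (auto intro!: member_le_sum)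
      finally show ?thesis .
    qed
    have e: "(\<lambda>x. g x - cutoff R x * g x) = (\<lambda>x. h x * g x)"
      by (simp add: h_def cutoff_def fun_eq_iff algebra_simps)
    show "schwartz_bound m (2 ^ m * (A' * B) / R) (\<lambda>x. g x - cutoff R x * g x)"
      unfolding e schwartz_bound_def
    proof (intro allI impI)
      fix \<alpha> :: "'a list" and x assume \<alpha>: "length \<alpha> \<le> m"
      show "bracket x ^ m * norm (iter_partial \<alpha> (\<lambda>x. h x * g x) x) \<le> 2 ^ m * (A' * B) / R"
      proof (cases "norm x < R")
        case True
        have "supp (\<lambda>x. h x * g x) \<subseteq> {x. R \<le> norm x}"
        proof (subst supp_subset_iff)
          show "closed {x::real^'a. R \<le> norm x}" by (intro closed_Collect_le continuous_intros)
          show "\<forall>x. x \<notin> {x. R \<le> norm x} \<longrightarrow> h x * g x = 0"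
            using R by (auto simp: h_def plateau_eq_1)
        qed
        with True have "iter_partial \<alpha> (\<lambda>x. h x * g x) x = 0"
          using supp_iter_partial[of \<alpha> "\<lambda>x. h x * g x"] notin_supp by force
        then show ?thesis using A'0 B0 R by simp
      next
        case False
        have "norm (iter_partial \<alpha> (\<lambda>x. h x * g x) x) \<le> 2 ^ length \<alpha> * (A' * (B / bracket x ^ (m + 1)))"
        proof (rule leibniz_pointwise[OF sh schwartz_smooth[OF g]])
          show "norm (iter_partial \<beta> g x) \<le> B / bracket x ^ (m + 1)" if "length \<beta> \<le> length \<alpha>" for \<beta>
            using schwartz_boundD[OF B, of \<beta> x] that \<alpha> by (simp add: pos_le_divide_eq mult.commute)
        qed (use hA \<alpha> in auto)
        also have "\<dots> \<le> 2 ^ m * (A' * (B / bracket x ^ (m + 1)))"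
          using \<alpha> A'0 B0 by (intro mult_right_mono power_increasing) auto
        finally have "bracket x ^ m * norm (iter_partial \<alpha> (\<lambda>x. h x * g x) x) \<le> bracket x ^ m * (2 ^ m * (A' * (B / bracket x ^ (m + 1))))"
          by (rule mult_left_mono) simp
        also have "\<dots> = 2 ^ m * (A' * B) / bracket x"
          using less_imp_neq[OF bracket_pos[of x]] by simp
        also have "\<dots> \<le> 2 ^ m * (A' * B) / R"
        proof (rule divide_left_mono)
          show "R \<le> bracket x" using False norm_le_bracket[of x] by linarith
        qed (use A'0 B0 R bracket_pos[of x] in auto)
        finally show ?thesis .
      qed
    qed
  qed
qed

text \<open>Every Schwartz function is the Fourier transform of a Schwartz function \<open>g\<close>, and \<open>g\<close> is the limit of the
  test functions \<open>cutoff R * g\<close>.\<close>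

lemma tempered_eqI:
  assumes v: "v \<in> tempered" and v': "v' \<in> tempered"
    and eq: "\<And>\<phi>. \<phi> \<in> test_functions \<Longrightarrow> fourier v \<phi> = fourier v' \<phi>"
    and \<phi>: "\<phi> \<in> schwartz"
  shows "v \<phi> = v' \<phi>"
proof -
  define g where "g = inv_ft \<phi> 0"
  have g: "g \<in> schwartz" unfolding g_def by (rule inv_ft_schwartz[OF \<phi>])
  have \<phi>g: "\<phi> = fourier_fun g" unfolding g_def by (simp add: fourier_fun_inv_ft[OF \<phi>] fun_eq_iff)
  have key: "\<exists>K. \<forall>R\<ge>1. norm (w \<phi> - w (fourier_fun (\<lambda>x. cutoff R x * g x))) \<le> K / R" if w: "w \<in> tempered" for w
  proof (rule tempered_bound[OF w])
    fix C m assume C: "0 \<le> C" and wb: "\<And>\<phi> B. \<phi> \<in> schwartz \<Longrightarrow> schwartz_bound m B \<phi> \<Longrightarrow> norm (w \<phi>) \<le> C * B"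
    show ?thesis
    proof (rule schwartz_op_bound[OF schwartz_op_fourier_fun, of m])
      fix C' m' assume C': "\<And>(\<phi> :: real^'a \<Rightarrow> complex) B. \<phi> \<in> schwartz \<Longrightarrow> schwartz_bound m' B \<phi> \<Longrightarrow> schwartz_bound m (C' * B) (fourier_fun \<phi>)"
      show ?thesis
      proof (rule schwartz_bound_one_minus_cutoff[OF g, of m'])
        fix K assume K: "\<And>R. 1 \<le> R \<Longrightarrow> schwartz_bound m' (K / R) (\<lambda>x. g x - cutoff R x * g x)"
        show ?thesis
        proof (intro exI[of _ "C * C' * K"] allI impI)
          fix R :: real assume R: "1 \<le> R"
          have cg: "(\<lambda>x. cutoff R x * g x) \<in> schwartz"
            using test_mult[OF test_cutoff schwartz_smooth[OF g], of R] R by (intro test_schwartz) simp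
          have d: "(\<lambda>x. g x - cutoff R x * g x) \<in> schwartz" by (rule schwartz_diff[OF g cg])
          have "fourier_fun (\<lambda>x. g x - cutoff R x * g x) = (\<lambda>\<xi>. 1 * fourier_fun g \<xi> + (-1) * fourier_fun (\<lambda>x. cutoff R x * g x) \<xi>)"
            by (simp add: fourier_fun_diff[OF g cg] fun_eq_iff)
          then have "w (fourier_fun (\<lambda>x. g x - cutoff R x * g x)) = w \<phi> - w (fourier_fun (\<lambda>x. cutoff R x * g x))"
            using tempered_lincomb[OF w fourier_fun_schwartz[OF g] fourier_fun_schwartz[OF cg], of 1 "-1"] by (simp add: \<phi>g)
          moreover have "norm (w (fourier_fun (\<lambda>x. g x - cutoff R x * g x))) \<le> C * (C' * (K / R))"
            by (rule wb[OF fourier_fun_schwartz[OF d] C'[OF d K[OF R]]])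
          ultimately show "norm (w \<phi> - w (fourier_fun (\<lambda>x. cutoff R x * g x))) \<le> C * C' * K / R" by simp
        qed
      qed
    qed
  qed
  obtain K K' where K: "\<And>R. 1 \<le> R \<Longrightarrow> norm (v \<phi> - v (fourier_fun (\<lambda>x. cutoff R x * g x))) \<le> K / R"
    and K': "\<And>R. 1 \<le> R \<Longrightarrow> norm (v' \<phi> - v' (fourier_fun (\<lambda>x. cutoff R x * g x))) \<le> K' / R"
    using key[OF v] key[OF v'] by blast
  have bd: "norm (v \<phi> - v' \<phi>) \<le> (K + K') * inverse (real (Suc n))" for n
  proof -
    let ?R = "real (Suc n)"
    have t: "(\<lambda>x. cutoff ?R x * g x) \<in> test_functions" by (rule test_mult[OF test_cutoff schwartz_smooth[OF g]]) simp
    have "v (fourier_fun (\<lambda>x. cutoff ?R x * g x)) = v' (fourier_fun (\<lambda>x. cutoff ?R x * g x))"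
      using eq[OF t] test_schwartz[OF t] by (simp add: fourier_def)
    then have "norm (v \<phi> - v' \<phi>) = norm ((v \<phi> - v (fourier_fun (\<lambda>x. cutoff ?R x * g x))) - (v' \<phi> - v' (fourier_fun (\<lambda>x. cutoff ?R x * g x))))"
      by simp
    also have "\<dots> \<le> K / ?R + K' / ?R"
      by (rule order_trans[OF norm_triangle_ineq4 add_mono[OF K K']]) auto
    finally show ?thesis by (simp add: divide_inverse distrib_right)
  qed
  have "(\<lambda>n. (K + K') * inverse (real (Suc n))) \<longlonglongrightarrow> (K + K') * 0"
    by (intro tendsto_mult tendsto_const LIMSEQ_inverse_real_of_nat)
  then have "norm (v \<phi> - v' \<phi>) \<le> (K + K') * 0"
    by (rule LIMSEQ_le_const) (use bd in blast)
  then show ?thesis by simp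
qed

lemma AE_lebesgue_reflect:
  assumes "AE x in lebesgue. P (x :: real^'n::finite)" shows "AE x in lebesgue. P (\<xi> - x)"
proof -
  have "AE x in lborel. P x" using assms by (simp add: AE_completion_iff)
  from AE_completion[OF AE_lborel_reflect[OF this]] show ?thesis .
qed

lemma conv_cong_AE:
  fixes f g f' g' :: "real^'n::finite \<Rightarrow> complex"
  assumes m: "f \<in> borel_measurable lebesgue" "g \<in> borel_measurable lebesgue"
      "f' \<in> borel_measurable lebesgue" "g' \<in> borel_measurable lebesgue"
    and ae: "AE x in lebesgue. f x = f' x" "AE x in lebesgue. g x = g' x"
  shows "conv f g \<xi> = conv f' g' \<xi>"
  unfolding conv_def
proof (rule integral_cong_AE)
  show "(\<lambda>\<eta>. f (\<xi> - \<eta>) * g \<eta>) \<in> borel_measurable lebesgue" "(\<lambda>\<eta>. f' (\<xi> - \<eta>) * g' \<eta>) \<in> borel_measurable lebesgue"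
    by (intro borel_measurable_times lebesgue_measurable_reflect m)+
  show "AE \<eta> in lebesgue. f (\<xi> - \<eta>) * g \<eta> = f' (\<xi> - \<eta>) * g' \<eta>"
    using AE_lebesgue_reflect[OF ae(1), of \<xi>] ae(2) by eventually_elim simp
qed

lemma tempered_product_unique:
  assumes "is_tempered_product v1 v2 v" "is_tempered_product v1 v2 v'" "\<phi> \<in> schwartz"
  shows "v \<phi> = v' \<phi>"
proof -
  obtain f1 f2 where f: "given_by (fourier v1) f1" "given_by (fourier v2) f2"
    "given_by (fourier v) (\<lambda>\<xi>. complex_of_real (1 / (2 * pi) ^ CARD('a)) * conv f1 f2 \<xi>)" and v: "v \<in> tempered"
    using assms(1) unfolding is_tempered_product_def by blast
  obtain g1 g2 where g: "given_by (fourier v1) g1" "given_by (fourier v2) g2"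
    "given_by (fourier v') (\<lambda>\<xi>. complex_of_real (1 / (2 * pi) ^ CARD('a)) * conv g1 g2 \<xi>)" and v': "v' \<in> tempered"
    using assms(2) unfolding is_tempered_product_def by blast
  have m: "h \<in> borel_measurable lebesgue" if "given_by w h" for w and h :: "real^'a \<Rightarrow> complex"
    using that by (intro locally_integrable_measurable) (simp add: given_by_def)
  have "conv f1 f2 = conv g1 g2"
    by (rule ext, rule conv_cong_AE) (use f g in \<open>auto intro: m given_by_unique\<close>)
  with f(3) g(3) have "fourier v \<phi> = fourier v' \<phi>" if "\<phi> \<in> test_functions" for \<phi>
    using that by (simp add: given_by_def)
  then show ?thesis by (rule tempered_eqI[OF v v' _ assms(3)])
qed

lemma is_product_unique:
  assumes w: "is_product u1 u2 w" and w': "is_product u1 u2 w'"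
  shows "w = w'"
proof (rule extensionalityI)
  show "w \<in> extensional test_functions" "w' \<in> extensional test_functions"
    using w w' by (auto simp: is_product_def distributions_def)
  fix \<phi> :: "real^'a \<Rightarrow> complex" assume \<phi>: "\<phi> \<in> test_functions"
  obtain R U where R: "0 < R" and U: "open U" "supp \<phi> \<subseteq> U" "\<And>x. x \<in> U \<Longrightarrow> cutoff R x = 1"
    using cutoff_near_compact[OF test_compact[OF \<phi>]] by metis
  have ex: "\<exists>U. open U \<and> supp \<phi> \<subseteq> U \<and> (\<forall>x\<in>U. cutoff R x = 1)" using U by blast
  obtain v where v: "is_tempered_product (localize (cutoff R) u1) (localize (cutoff R) u2) v" "w \<phi> = v \<phi>"
    using w \<phi> test_cutoff[OF R] ex unfolding is_product_def by blast
  obtain v' where v': "is_tempered_product (localize (cutoff R) u1) (localize (cutoff R) u2) v'" "w' \<phi> = v' \<phi>"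
    using w' \<phi> test_cutoff[OF R] ex unfolding is_product_def by blast
  show "w \<phi> = w' \<phi>"
    using tempered_product_unique[OF v(1) v'(1) test_schwartz[OF \<phi>]] v(2) v'(2) by simp
qed

section \<open>The product of two distributions\<close>

text \<open>The product of \<open>\<psi>1 u1\<close> and \<open>\<psi>2 u2\<close>, as a functional: its Fourier transform is the normalized convolution, and
  \<open>inv_ft \<phi> 0\<close> is the function whose Fourier transform is \<open>\<phi>\<close>.\<close>

definition pairing :: "((real^'n::finite \<Rightarrow> complex) \<Rightarrow> complex) \<Rightarrow> ((real^'n \<Rightarrow> complex) \<Rightarrow> complex) \<Rightarrow>
    (real^'n \<Rightarrow> complex) \<Rightarrow> (real^'n \<Rightarrow> complex) \<Rightarrow> (real^'n \<Rightarrow> complex) \<Rightarrow> complex" where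
  "pairing u1 u2 \<psi>1 \<psi>2 \<phi> = complex_of_real (1 / (2 * pi) ^ CARD('n)) *
     (LINT \<xi>|lborel. conv (loc_ft u1 \<psi>1) (loc_ft u2 \<psi>2) \<xi> * inv_ft \<phi> 0 \<xi>)"

text \<open>The choice of the localizer is immaterial by \<open>local_product_eq\<close> below.\<close>

definition local_product :: "((real^'n::finite \<Rightarrow> complex) \<Rightarrow> complex) \<Rightarrow> ((real^'n \<Rightarrow> complex) \<Rightarrow> complex) \<Rightarrow>
    (real^'n \<Rightarrow> complex) \<Rightarrow> complex" where
  "local_product u1 u2 = (\<lambda>\<phi>\<in>test_functions.
     let \<psi> = SOME \<psi>. \<psi> \<in> test_functions \<and> (\<forall>x\<in>supp \<phi>. \<psi> x = 1) in pairing u1 u2 \<psi> \<psi> \<phi>)"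

text \<open>The hypotheses under which the product exists.  Those on \<open>u1\<close> and \<open>u2\<close> follow from membership in the
  spaces of the theorem by \<open>energy_finite_everywhere\<close>.\<close>

locale product_setting =
  fixes k k1 k2 :: "real^'n::finite \<Rightarrow> real" and C :: real
    and u1 u2 :: "(real^'n \<Rightarrow> complex) \<Rightarrow> complex"
  assumes k: "k \<in> K_pol" and k1: "k1 \<in> K_pol" and k2: "k2 \<in> K_pol"
    and hyp: "\<And>\<xi>. nn_conv (\<lambda>\<eta>. ennreal (1 / (k1 \<eta>)\<^sup>2)) (\<lambda>\<eta>. ennreal (1 / (k2 \<eta>)\<^sup>2)) \<xi>
            \<le> ennreal (C\<^sup>2 / (k \<xi>)\<^sup>2)"
    and u1: "u1 \<in> distributions" and u2: "u2 \<in> distributions"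
    and fin1: "\<And>\<psi>. \<psi> \<in> test_functions \<Longrightarrow> energy k1 (loc_ft u1 \<psi>) < \<infinity>"
    and fin2: "\<And>\<psi>. \<psi> \<in> test_functions \<Longrightarrow> energy k2 (loc_ft u2 \<psi>) < \<infinity>"
begin

abbreviation "U1 \<equiv> loc_ft u1"
abbreviation "U2 \<equiv> loc_ft u2"

lemma U_measurable:
  "\<psi> \<in> test_functions \<Longrightarrow> U1 \<psi> \<in> borel_measurable borel"
  "\<psi> \<in> test_functions \<Longrightarrow> U2 \<psi> \<in> borel_measurable borel"
  by (rule loc_ft_measurable[OF u1] loc_ft_measurable[OF u2]; assumption)+

lemma weighted_nconv:
  assumes "\<psi>1 \<in> test_functions" "\<psi>2 \<in> test_functions"
  shows "(\<integral>\<^sup>+\<xi>. ennreal ((k \<xi>)\<^sup>2) * (nconv (U1 \<psi>1) (U2 \<psi>2) \<xi>)\<^sup>2 \<partial>lborel)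
     \<le> ennreal (C\<^sup>2) * (energy k1 (U1 \<psi>1) * energy k2 (U2 \<psi>2))"
proof (rule weighted_convolution[OF K_polD(1)[OF k1] K_polD(1)[OF k2] _ _ K_polD(2)[OF k] K_polD(2)[OF k1] K_polD(2)[OF k2] hyp])
  show "U1 \<psi>1 \<in> borel_measurable lebesgue" "U2 \<psi>2 \<in> borel_measurable lebesgue"
    using U_measurable assms by (intro measurable_completion; simp)+
qed

lemma nconv_decay:
  obtains M :: nat where "\<And>\<psi>1 \<psi>2. \<psi>1 \<in> test_functions \<Longrightarrow> \<psi>2 \<in> test_functions \<Longrightarrow>
     (\<integral>\<^sup>+\<xi>. nconv (U1 \<psi>1) (U2 \<psi>2) \<xi> * ennreal (1 / bracket \<xi> ^ M) \<partial>lborel) < \<infinity>"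
proof (rule weighted_L2_decay[OF k])
  fix M assume M: "\<And>G. G \<in> borel_measurable borel \<Longrightarrow>
     (\<integral>\<^sup>+\<xi>. ennreal ((k \<xi>)\<^sup>2) * (G \<xi>)\<^sup>2 \<partial>lborel) < \<infinity> \<Longrightarrow> (\<integral>\<^sup>+\<xi>. G \<xi> * ennreal (1 / bracket \<xi> ^ M) \<partial>lborel) < \<infinity>"
  show thesis
  proof (rule that[of M], rule M)
    fix \<psi>1 \<psi>2 :: "real^'n \<Rightarrow> complex" assume t: "\<psi>1 \<in> test_functions" "\<psi>2 \<in> test_functions"
    show "nconv (U1 \<psi>1) (U2 \<psi>2) \<in> borel_measurable borel"
      by (rule nconv_measurable[OF U_measurable(1)[OF t(1)] U_measurable(2)[OF t(2)]])
    have "ennreal (C\<^sup>2) * (energy k1 (U1 \<psi>1) * energy k2 (U2 \<psi>2)) < \<infinity>"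
      using fin1[OF t(1)] fin2[OF t(2)] by (simp add: ennreal_mult_less_top)
    with weighted_nconv[OF t]
    show "(\<integral>\<^sup>+\<xi>. ennreal ((k \<xi>)\<^sup>2) * (nconv (U1 \<psi>1) (U2 \<psi>2) \<xi>)\<^sup>2 \<partial>lborel) < \<infinity>"
      by (rule le_less_trans)
  qed
qed

text \<open>The constants \<open>J\<close> and \<open>M\<close> are independent of \<open>g\<close>: this is the continuity of the pairing, not only its
  convergence.\<close>

lemma nconv_schwartz:
  assumes t: "\<psi>1 \<in> test_functions" "\<psi>2 \<in> test_functions"
  obtains J :: real and M :: nat where "0 \<le> J" "\<And>g B. g \<in> borel_measurable borel \<Longrightarrow> 0 \<le> B \<Longrightarrow>
    (\<And>\<xi>. bracket \<xi> ^ M * norm (g \<xi>) \<le> B) \<Longrightarrow>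
     (\<integral>\<^sup>+\<xi>. nconv (U1 \<psi>1) (U2 \<psi>2) \<xi> * ennreal (norm (g \<xi> :: complex)) \<partial>lborel) \<le> ennreal (B * J)"
proof (rule nconv_decay)
  fix M assume M: "\<And>\<psi>1 \<psi>2. \<psi>1 \<in> test_functions \<Longrightarrow> \<psi>2 \<in> test_functions \<Longrightarrow>
     (\<integral>\<^sup>+\<xi>. nconv (U1 \<psi>1) (U2 \<psi>2) \<xi> * ennreal (1 / bracket \<xi> ^ M) \<partial>lborel) < \<infinity>"
  note [measurable] = nconv_measurable[OF U_measurable(1)[OF t(1)] U_measurable(2)[OF t(2)]]
  define J where "J = enn2real (\<integral>\<^sup>+\<xi>. nconv (U1 \<psi>1) (U2 \<psi>2) \<xi> * ennreal (1 / bracket \<xi> ^ M) \<partial>lborel)"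
  have J: "(\<integral>\<^sup>+\<xi>. nconv (U1 \<psi>1) (U2 \<psi>2) \<xi> * ennreal (1 / bracket \<xi> ^ M) \<partial>lborel) = ennreal J"
    unfolding J_def using M[OF t] by (intro ennreal_enn2real[symmetric]) simp
  show thesis
  proof (rule that[of J M])
    show "0 \<le> J" by (simp add: J_def)
    fix g :: "real^'n \<Rightarrow> complex" and B assume [measurable]: "g \<in> borel_measurable borel" and B0: "0 \<le> B"
      and B: "\<And>\<xi>. bracket \<xi> ^ M * norm (g \<xi>) \<le> B"
    have "(\<integral>\<^sup>+\<xi>. nconv (U1 \<psi>1) (U2 \<psi>2) \<xi> * ennreal (norm (g \<xi>)) \<partial>lborel) \<le>
       (\<integral>\<^sup>+\<xi>. ennreal B * (nconv (U1 \<psi>1) (U2 \<psi>2) \<xi> * ennreal (1 / bracket \<xi> ^ M)) \<partial>lborel)"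
    proof (intro nn_integral_mono)
      fix \<xi>
      have "norm (g \<xi>) \<le> B * (1 / bracket \<xi> ^ M)" using B[of \<xi>] by (simp add: pos_le_divide_eq mult.commute)
      then have "ennreal (norm (g \<xi>)) \<le> ennreal B * ennreal (1 / bracket \<xi> ^ M)"
        using B0 by (simp add: ennreal_leI flip: ennreal_mult)
      then have "nconv (U1 \<psi>1) (U2 \<psi>2) \<xi> * ennreal (norm (g \<xi>)) \<le> nconv (U1 \<psi>1) (U2 \<psi>2) \<xi> * (ennreal B * ennreal (1 / bracket \<xi> ^ M))"
        by (rule mult_left_mono) simp
      then show "nconv (U1 \<psi>1) (U2 \<psi>2) \<xi> * ennreal (norm (g \<xi>)) \<le> ennreal B * (nconv (U1 \<psi>1) (U2 \<psi>2) \<xi> * ennreal (1 / bracket \<xi> ^ M))"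
        by (simp only: mult_ac)
    qed
    also have "\<dots> = ennreal B * ennreal J"
      by (subst nn_integral_cmult) (simp_all add: J)
    also have "\<dots> = ennreal (B * J)" using B0 by (simp add: ennreal_mult J_def)
    finally show "(\<integral>\<^sup>+\<xi>. nconv (U1 \<psi>1) (U2 \<psi>2) \<xi> * ennreal (norm (g \<xi>)) \<partial>lborel) \<le> ennreal (B * J)" .
  qed
qed

lemma nconv_schwartz_finite:
  assumes t: "\<psi>1 \<in> test_functions" "\<psi>2 \<in> test_functions" and g: "g \<in> schwartz"
  shows "(\<integral>\<^sup>+\<xi>. nconv (U1 \<psi>1) (U2 \<psi>2) \<xi> * ennreal (norm (g \<xi>)) \<partial>lborel) < \<infinity>"
proof (rule nconv_schwartz[OF t])
  fix J :: real and M assume J: "\<And>(g :: real^'n \<Rightarrow> complex) B. g \<in> borel_measurable borel \<Longrightarrow> 0 \<le> B \<Longrightarrow>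
    (\<And>\<xi>. bracket \<xi> ^ M * norm (g \<xi>) \<le> B) \<Longrightarrow>
     (\<integral>\<^sup>+\<xi>. nconv (U1 \<psi>1) (U2 \<psi>2) \<xi> * ennreal (norm (g \<xi>)) \<partial>lborel) \<le> ennreal (B * J)"
  obtain B where B: "schwartz_bound M B g" using schwartz_obtain_bound[OF g] .
  have "(\<integral>\<^sup>+\<xi>. nconv (U1 \<psi>1) (U2 \<psi>2) \<xi> * ennreal (norm (g \<xi>)) \<partial>lborel) \<le> ennreal (B * J)"
    by (rule J[OF schwartz_measurable[OF g] schwartz_bound_nonneg[OF B]]) (use schwartz_boundD[OF B, of "[]"] in simp)
  then show ?thesis by (rule le_less_trans) simp
qed

lemma conv_mult_integrable:
  assumes t: "\<psi>1 \<in> test_functions" "\<psi>2 \<in> test_functions" and g: "g \<in> schwartz"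
  shows "integrable lborel (\<lambda>\<xi>. conv (U1 \<psi>1) (U2 \<psi>2) \<xi> * g \<xi>)"
proof -
  note m = U_measurable(1)[OF t(1)] U_measurable(2)[OF t(2)]
  note [measurable] = conv_measurable[OF m] schwartz_measurable[OF g]
  have "(\<integral>\<^sup>+\<xi>. ennreal (norm (conv (U1 \<psi>1) (U2 \<psi>2) \<xi> * g \<xi>)) \<partial>lborel) \<le> (\<integral>\<^sup>+\<xi>. nconv (U1 \<psi>1) (U2 \<psi>2) \<xi> * ennreal (norm (g \<xi>)) \<partial>lborel)"
    by (intro nn_integral_mono) (simp add: norm_mult ennreal_mult mult_right_mono norm_conv_le[OF m])
  also have "\<dots> < \<infinity>" by (rule nconv_schwartz_finite[OF t g])
  finally show ?thesis by (simp add: integrable_iff_bounded)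
qed

lemma pairing_eq1:
  assumes t: "\<psi>1 \<in> test_functions" "\<psi>2 \<in> test_functions" and \<phi>: "\<phi> \<in> schwartz"
  shows "pairing u1 u2 \<psi>1 \<psi>2 \<phi> = complex_of_real (1 / (2 * pi) ^ CARD('n)) *
     (LINT \<eta>|lborel. U2 \<psi>2 \<eta> * U1 (\<lambda>x. \<psi>1 x * \<phi> x) (- \<eta>))"
proof -
  note m = U_measurable(1)[OF t(1)] U_measurable(2)[OF t(2)]
  note g = inv_ft_schwartz[OF \<phi>, of 0]
  show ?thesis
    unfolding pairing_def conv_pairing[OF m schwartz_measurable[OF g] nconv_schwartz_finite[OF t g]]
      inv_ft_shift loc_ft_mult[OF u1 t(1) \<phi>, symmetric] ..
qed

lemma pairing_eq2:
  assumes t: "\<psi>1 \<in> test_functions" "\<psi>2 \<in> test_functions" and \<phi>: "\<phi> \<in> schwartz"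
  shows "pairing u1 u2 \<psi>1 \<psi>2 \<phi> = complex_of_real (1 / (2 * pi) ^ CARD('n)) *
     (LINT \<eta>|lborel. U1 \<psi>1 \<eta> * U2 (\<lambda>x. \<psi>2 x * \<phi> x) (- \<eta>))"
proof -
  note m = U_measurable(1)[OF t(1)] U_measurable(2)[OF t(2)]
  note g = inv_ft_schwartz[OF \<phi>, of 0]
  have fin: "(\<integral>\<^sup>+\<xi>. nconv (U2 \<psi>2) (U1 \<psi>1) \<xi> * ennreal (norm (inv_ft \<phi> 0 \<xi>)) \<partial>lborel) < \<infinity>"
    using nconv_schwartz_finite[OF t g] by (simp only: nconv_commute[OF m])
  show ?thesis
    unfolding pairing_def conv_commute[OF m] conv_pairing[OF m(2,1) schwartz_measurable[OF g] fin]
      inv_ft_shift loc_ft_mult[OF u2 t(2) \<phi>, symmetric] ..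
qed

text \<open>Replace the two localizers one after the other: the first formula depends on \<open>\<psi>1\<close> only through \<open>\<psi>1 \<phi>\<close>, the
  second one on \<open>\<psi>2\<close> only through \<open>\<psi>2 \<phi>\<close>.\<close>

lemma pairing_cong:
  assumes t: "\<psi>1 \<in> test_functions" "\<psi>2 \<in> test_functions" "\<psi>1' \<in> test_functions" "\<psi>2' \<in> test_functions"
    and \<phi>: "\<phi> \<in> schwartz"
    and e: "\<And>x. \<psi>1 x * \<phi> x = \<psi>1' x * \<phi> x" "\<And>x. \<psi>2 x * \<phi> x = \<psi>2' x * \<phi> x"
  shows "pairing u1 u2 \<psi>1 \<psi>2 \<phi> = pairing u1 u2 \<psi>1' \<psi>2' \<phi>"
proof -
  have "pairing u1 u2 \<psi>1 \<psi>2 \<phi> = pairing u1 u2 \<psi>1' \<psi>2 \<phi>"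
    by (simp only: pairing_eq1[OF t(1,2) \<phi>] pairing_eq1[OF t(3,2) \<phi>] e(1))
  also have "\<dots> = pairing u1 u2 \<psi>1' \<psi>2' \<phi>"
    by (simp only: pairing_eq2[OF t(3,2) \<phi>] pairing_eq2[OF t(3,4) \<phi>] e(2))
  finally show ?thesis .
qed

lemma pairing_lincomb:
  assumes t: "\<psi>1 \<in> test_functions" "\<psi>2 \<in> test_functions" and f: "f \<in> schwartz" and g: "g \<in> schwartz"
  shows "pairing u1 u2 \<psi>1 \<psi>2 (\<lambda>x. a * f x + b * g x) = a * pairing u1 u2 \<psi>1 \<psi>2 f + b * pairing u1 u2 \<psi>1 \<psi>2 g"
proof -
  let ?F = "conv (U1 \<psi>1) (U2 \<psi>2)"
  note i = conv_mult_integrable[OF t inv_ft_schwartz[OF f, of 0]] conv_mult_integrable[OF t inv_ft_schwartz[OF g, of 0]]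
  have "(LINT \<xi>|lborel. ?F \<xi> * inv_ft (\<lambda>x. a * f x + b * g x) 0 \<xi>) =
    (LINT \<xi>|lborel. a * (?F \<xi> * inv_ft f 0 \<xi>) + b * (?F \<xi> * inv_ft g 0 \<xi>))"
    unfolding inv_ft_lincomb[OF f g] by (intro Bochner_Integration.integral_cong refl) (simp add: algebra_simps)
  also have "\<dots> = a * (LINT \<xi>|lborel. ?F \<xi> * inv_ft f 0 \<xi>) + b * (LINT \<xi>|lborel. ?F \<xi> * inv_ft g 0 \<xi>)"
    by (subst Bochner_Integration.integral_add[OF integrable_mult_right[OF i(1)] integrable_mult_right[OF i(2)]])
       (simp only: integral_mult_right_zero)
  finally show ?thesis
    unfolding pairing_def by (simp only: distrib_left mult.left_commute)
qed

lemma pairing_bound: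
  assumes t: "\<psi>1 \<in> test_functions" "\<psi>2 \<in> test_functions"
  obtains C0 m where "0 \<le> C0" "\<And>\<phi> B. \<phi> \<in> schwartz \<Longrightarrow> schwartz_bound m B \<phi> \<Longrightarrow> norm (pairing u1 u2 \<psi>1 \<psi>2 \<phi>) \<le> C0 * B"
proof (rule nconv_schwartz[OF t])
  fix J :: real and M assume J0: "0 \<le> J" and J: "\<And>(g :: real^'n \<Rightarrow> complex) B. g \<in> borel_measurable borel \<Longrightarrow> 0 \<le> B \<Longrightarrow>
    (\<And>\<xi>. bracket \<xi> ^ M * norm (g \<xi>) \<le> B) \<Longrightarrow>
     (\<integral>\<^sup>+\<xi>. nconv (U1 \<psi>1) (U2 \<psi>2) \<xi> * ennreal (norm (g \<xi>)) \<partial>lborel) \<le> ennreal (B * J)"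
  let ?c = "1 / (2 * pi) ^ CARD('n)"
  have c0: "0 \<le> ?c" by simp
  note m = U_measurable(1)[OF t(1)] U_measurable(2)[OF t(2)]
  show thesis
  proof (rule schwartz_op_bound[OF schwartz_op_fourier_fun, of M])
    fix D m' assume D0: "0 \<le> D" and D: "\<And>(\<phi> :: real^'n \<Rightarrow> complex) B. \<phi> \<in> schwartz \<Longrightarrow> schwartz_bound m' B \<phi> \<Longrightarrow> schwartz_bound M (D * B) (fourier_fun \<phi>)"
    show thesis
    proof (rule that[of "?c * (?c * D * J)" m'])
      show "0 \<le> ?c * (?c * D * J)" using D0 J0 by simp
      fix \<phi> :: "real^'n \<Rightarrow> complex" and B assume \<phi>: "\<phi> \<in> schwartz" and B: "schwartz_bound m' B \<phi>"
      note g = inv_ft_schwartz[OF \<phi>, of 0]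
      have B0: "0 \<le> B" by (rule schwartz_bound_nonneg[OF B])
      have gB: "bracket \<xi> ^ M * norm (inv_ft \<phi> 0 \<xi>) \<le> ?c * (D * B)" for \<xi>
      proof -
        have "bracket (- \<xi>) ^ M * norm (iter_partial [] (fourier_fun \<phi>) (- \<xi>)) \<le> D * B"
          by (rule schwartz_boundD[OF D[OF \<phi> B]]) simp
        then have "?c * (bracket \<xi> ^ M * norm (fourier_fun \<phi> (- \<xi>))) \<le> ?c * (D * B)"
          by (intro mult_left_mono c0) simp
        moreover have "norm (inv_ft \<phi> 0 \<xi>) = ?c * norm (fourier_fun \<phi> (- \<xi>))"
          unfolding inv_ft_def norm_mult by (simp del: of_real_divide)
        ultimately show ?thesis by (simp only: mult.left_commute)
      qed
      let ?I = "LINT \<xi>|lborel. conv (U1 \<psi>1) (U2 \<psi>2) \<xi> * inv_ft \<phi> 0 \<xi>"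
      have "ennreal (norm ?I) \<le> (\<integral>\<^sup>+\<xi>. ennreal (norm (conv (U1 \<psi>1) (U2 \<psi>2) \<xi> * inv_ft \<phi> 0 \<xi>)) \<partial>lborel)"
        by (rule integral_norm_bound_ennreal[OF conv_mult_integrable[OF t g]])
      also have "\<dots> \<le> (\<integral>\<^sup>+\<xi>. nconv (U1 \<psi>1) (U2 \<psi>2) \<xi> * ennreal (norm (inv_ft \<phi> 0 \<xi>)) \<partial>lborel)"
        by (intro nn_integral_mono) (simp add: norm_mult ennreal_mult mult_right_mono norm_conv_le[OF m])
      also have "\<dots> \<le> ennreal (?c * (D * B) * J)"
        by (rule J[OF schwartz_measurable[OF g] _ gB]) (use D0 B0 in simp)
      finally have "norm ?I \<le> ?c * (D * B) * J"
        using D0 B0 J0 by (simp add: ennreal_le_iff)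
      then have "?c * norm ?I \<le> ?c * (?c * (D * B) * J)" by (rule mult_left_mono[OF _ c0])
      moreover have "norm (pairing u1 u2 \<psi>1 \<psi>2 \<phi>) = ?c * norm ?I"
        unfolding pairing_def norm_mult by (simp del: of_real_divide)
      ultimately show "norm (pairing u1 u2 \<psi>1 \<psi>2 \<phi>) \<le> ?c * (?c * D * J) * B" by (simp only: mult_ac)
    qed
  qed
qed

lemma pairing_tempered_product:
  assumes t: "\<psi>1 \<in> test_functions" "\<psi>2 \<in> test_functions"
  shows "is_tempered_product (localize \<psi>1 u1) (localize \<psi>2 u2) (restrict (pairing u1 u2 \<psi>1 \<psi>2) schwartz)"
    (is "is_tempered_product _ _ ?v")
proof -
  let ?F = "conv (U1 \<psi>1) (U2 \<psi>2)" and ?c = "complex_of_real (1 / (2 * pi) ^ CARD('n))"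
  note m = U_measurable(1)[OF t(1)] U_measurable(2)[OF t(2)]
  note cm[measurable] = conv_measurable[OF m]
  have "?v \<in> tempered"
  proof (rule pairing_bound[OF t])
    fix C0 m' assume C0: "0 \<le> C0" and bd: "\<And>\<phi> B. \<phi> \<in> schwartz \<Longrightarrow> schwartz_bound m' B \<phi> \<Longrightarrow> norm (pairing u1 u2 \<psi>1 \<psi>2 \<phi>) \<le> C0 * B"
    show ?thesis
    proof (rule temperedI[OF _ _ C0])
      show "linear_functional_on schwartz ?v"
        unfolding linear_functional_on_def
        by (auto simp: pairing_lincomb[OF t] schwartz_add schwartz_cmult)
      show "norm (?v \<phi>) \<le> C0 * B" if "\<phi> \<in> schwartz" "schwartz_bound m' B \<phi>" for \<phi> B
        using bd[OF that] that(1) by simp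
    qed simp
  qed
  moreover have "AE \<xi> in lebesgue. integrable lebesgue (\<lambda>\<eta>. U1 \<psi>1 (\<xi> - \<eta>) * U2 \<psi>2 \<eta>)"
  proof (rule nconv_decay)
    fix M assume "\<And>\<psi>1 \<psi>2. \<psi>1 \<in> test_functions \<Longrightarrow> \<psi>2 \<in> test_functions \<Longrightarrow>
      (\<integral>\<^sup>+\<xi>. nconv (U1 \<psi>1) (U2 \<psi>2) \<xi> * ennreal (1 / bracket \<xi> ^ M) \<partial>lborel) < \<infinity>"
    from this[OF t] have fin: "(\<integral>\<^sup>+\<xi>. nconv (U1 \<psi>1) (U2 \<psi>2) \<xi> * ennreal (1 / bracket \<xi> ^ M) \<partial>lborel) \<noteq> \<infinity>" by simp
    note [measurable] = nconv_measurable[OF m]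
    have "AE \<xi> in lborel. nconv (U1 \<psi>1) (U2 \<psi>2) \<xi> * ennreal (1 / bracket \<xi> ^ M) \<noteq> \<infinity>"
      by (rule nn_integral_PInf_AE[OF _ fin]) measurable
    then have "AE \<xi> in lborel. integrable lebesgue (\<lambda>\<eta>. U1 \<psi>1 (\<xi> - \<eta>) * U2 \<psi>2 \<eta>)"
    proof eventually_elim
      case (elim \<xi>)
      then have "nconv (U1 \<psi>1) (U2 \<psi>2) \<xi> < \<infinity>"
        using less_imp_neq[OF bracket_pos[of \<xi>]] by (auto simp: ennreal_mult_eq_top_iff less_top)
      moreover note [measurable] = m
      ultimately have "integrable lborel (\<lambda>\<eta>. U1 \<psi>1 (\<xi> - \<eta>) * U2 \<psi>2 \<eta>)"
        by (simp add: integrable_iff_bounded nconv_lborel)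
      then show ?case by (subst integrable_completion) simp_all
    qed
    then show ?thesis by (rule AE_completion)
  qed
  moreover have "given_by (fourier ?v) (\<lambda>\<xi>. ?c * ?F \<xi>)"
    unfolding given_by_def
  proof (intro conjI allI impI ballI)
    fix K :: "(real^'n) set" assume K: "compact K"
    obtain R U where R: "0 < R" and U: "open U" "K \<subseteq> U" "\<And>x. x \<in> U \<Longrightarrow> cutoff R x = 1"
      using cutoff_near_compact[OF K] by metis
    have "integrable lborel (\<lambda>\<xi>. indicator K \<xi> *\<^sub>R (?c * (?F \<xi> * cutoff R \<xi>)))"
      using conv_mult_integrable[OF t test_schwartz[OF test_cutoff[OF R]]] compact_imp_closed[OF K]
      by (intro integrable_mult_indicator integrable_mult_right) auto
    also have "(\<lambda>\<xi>. indicator K \<xi> *\<^sub>R (?c * (?F \<xi> * cutoff R \<xi>))) = (\<lambda>\<xi>. indicator K \<xi> *\<^sub>R (?c * ?F \<xi>))"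
      using U by (auto simp: fun_eq_iff indicator_def)
    finally show "(\<lambda>\<xi>. ?c * ?F \<xi>) absolutely_integrable_on K"
      unfolding set_integrable_def using compact_imp_closed[OF K]
      by (subst integrable_completion) simp_all
  next
    fix \<phi> :: "real^'n \<Rightarrow> complex" assume "\<phi> \<in> test_functions"
    then have \<phi>: "\<phi> \<in> schwartz" by (rule test_schwartz)
    note [measurable] = schwartz_measurable[OF \<phi>]
    have "fourier ?v \<phi> = pairing u1 u2 \<psi>1 \<psi>2 (fourier_fun \<phi>)"
      by (simp add: fourier_def \<phi> fourier_fun_schwartz)
    also have "\<dots> = (LINT \<xi>|lborel. ?c * ?F \<xi> * \<phi> \<xi>)"
      unfolding pairing_def by (simp only: inv_ft_fourier_fun[OF \<phi>] mult.assoc integral_mult_right_zero)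
    also have "\<dots> = (LINT \<xi>|lebesgue. ?c * ?F \<xi> * \<phi> \<xi>)"
      by (rule integral_completion[symmetric]) simp
    finally show "fourier ?v \<phi> = (LINT \<xi>|lebesgue. ?c * ?F \<xi> * \<phi> \<xi>)" .
  qed
  ultimately show ?thesis
    unfolding is_tempered_product_def
    using given_by_loc_ft[OF u1 t(1)] given_by_loc_ft[OF u2 t(2)] by blast
qed

lemma local_product_eq:
  assumes \<phi>: "\<phi> \<in> test_functions" and \<psi>: "\<psi> \<in> test_functions" "\<And>x. x \<in> supp \<phi> \<Longrightarrow> \<psi> x = 1"
  shows "local_product u1 u2 \<phi> = pairing u1 u2 \<psi> \<psi> \<phi>"
proof -
  define \<psi>' where "\<psi>' = (SOME \<psi>. \<psi> \<in> test_functions \<and> (\<forall>x\<in>supp \<phi>. \<psi> x = 1))"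
  have \<psi>': "\<psi>' \<in> test_functions" "\<forall>x\<in>supp \<phi>. \<psi>' x = 1"
    using someI[of "\<lambda>\<psi>. \<psi> \<in> test_functions \<and> (\<forall>x\<in>supp \<phi>. \<psi> x = 1)" \<psi>] \<psi> by (auto simp: \<psi>'_def)
  have e: "\<psi>' x * \<phi> x = \<psi> x * \<phi> x" for x
    using \<psi>(2) \<psi>'(2) notin_supp[of x \<phi>] by (cases "x \<in> supp \<phi>") auto
  have "local_product u1 u2 \<phi> = pairing u1 u2 \<psi>' \<psi>' \<phi>"
    using \<phi> by (simp add: local_product_def \<psi>'_def Let_def)
  also have "\<dots> = pairing u1 u2 \<psi> \<psi> \<phi>"
    by (rule pairing_cong[OF \<psi>'(1) \<psi>'(1) \<psi>(1) \<psi>(1) test_schwartz[OF \<phi>] e e])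
  finally show ?thesis .
qed

lemma local_product_distribution: "local_product u1 u2 \<in> distributions"
proof (rule distributionI)
  show "local_product u1 u2 \<in> extensional test_functions" by (simp add: local_product_def)
  show "linear_functional_on test_functions (local_product u1 u2)"
    unfolding linear_functional_on_def
  proof (intro ballI allI)
    fix f g :: "real^'n \<Rightarrow> complex" and a b assume fg: "f \<in> test_functions" "g \<in> test_functions"
    let ?h = "\<lambda>x. a * f x + b * g x"
    have h: "?h \<in> test_functions" by (intro test_add test_cmult fg)
    obtain R U where R: "0 < R" and U: "open U" "supp f \<union> supp g \<subseteq> U" "\<And>x. x \<in> U \<Longrightarrow> cutoff R x = 1"
      using cutoff_near_compact[OF compact_Un[OF test_compact[OF fg(1)] test_compact[OF fg(2)]]] by metis
    have "supp ?h \<subseteq> supp f \<union> supp g"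
      by (subst supp_subset_iff) (auto simp: notin_supp)
    then have 1: "cutoff R x = 1" if "x \<in> supp ?h" for x using that U by blast
    have 2: "\<And>x. x \<in> supp f \<Longrightarrow> cutoff R x = 1" "\<And>x. x \<in> supp g \<Longrightarrow> cutoff R x = 1" using U by blast+
    note t = test_cutoff[OF R]
    show "local_product u1 u2 ?h = a * local_product u1 u2 f + b * local_product u1 u2 g"
      using local_product_eq[OF h t 1] local_product_eq[OF fg(1) t 2(1)] local_product_eq[OF fg(2) t 2(2)]
        pairing_lincomb[OF t t test_schwartz[OF fg(1)] test_schwartz[OF fg(2)], of a b] by simp
  qed
  fix K :: "(real^'n) set" assume K: "compact K"
  obtain R U where R: "0 < R" and U: "open U" "K \<subseteq> U" "\<And>x. x \<in> U \<Longrightarrow> cutoff R x = 1"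
    using cutoff_near_compact[OF K] by metis
  note t = test_cutoff[OF R]
  show "\<exists>C m. 0 \<le> C \<and> (\<forall>\<phi> B. \<phi> \<in> test_functions \<longrightarrow> supp \<phi> \<subseteq> K \<longrightarrow>
     (\<forall>\<alpha> x. length \<alpha> \<le> m \<longrightarrow> norm (iter_partial \<alpha> \<phi> x) \<le> B) \<longrightarrow> norm (local_product u1 u2 \<phi>) \<le> C * B)"
  proof (rule pairing_bound[OF t t])
    fix C0 m assume C0: "0 \<le> C0" and bd: "\<And>\<phi> B. \<phi> \<in> schwartz \<Longrightarrow> schwartz_bound m B \<phi> \<Longrightarrow> norm (pairing u1 u2 (cutoff R) (cutoff R) \<phi>) \<le> C0 * B"
    obtain b where b: "0 \<le> b" "\<And>x. x \<in> K \<Longrightarrow> bracket x ^ m \<le> b" using bounded_bracket_power[OF K] by metis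
    show ?thesis
    proof (intro exI[of _ "C0 * b"] exI[of _ m] conjI allI impI)
      fix \<phi> :: "real^'n \<Rightarrow> complex" and B assume \<phi>: "\<phi> \<in> test_functions" "supp \<phi> \<subseteq> K"
        and B: "\<forall>\<alpha> x. length \<alpha> \<le> m \<longrightarrow> norm (iter_partial \<alpha> \<phi> x) \<le> B"
      have 1: "cutoff R x = 1" if "x \<in> supp \<phi>" for x using that \<phi>(2) U by blast
      have B0: "0 \<le> B" using order_trans[OF norm_ge_zero B[rule_format, of "[]" 0]] by simp
      have "schwartz_bound m (b * B) \<phi>"
        unfolding schwartz_bound_def
      proof (intro allI impI)
        fix \<alpha> :: "'n list" and x assume \<alpha>: "length \<alpha> \<le> m"
        show "bracket x ^ m * norm (iter_partial \<alpha> \<phi> x) \<le> b * B"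
        proof (cases "x \<in> K")
          case True then show ?thesis using b B \<alpha> by (intro mult_mono) auto
        next
          case False
          then have "iter_partial \<alpha> \<phi> x = 0" using supp_iter_partial[of \<alpha> \<phi>] \<phi>(2) notin_supp by blast
          then show ?thesis using b(1) B0 by simp
        qed
      qed
      then have "norm (pairing u1 u2 (cutoff R) (cutoff R) \<phi>) \<le> C0 * (b * B)"
        by (rule bd[OF test_schwartz[OF \<phi>(1)]])
      then show "norm (local_product u1 u2 \<phi>) \<le> C0 * b * B"
        using local_product_eq[OF \<phi>(1) t 1] by (simp add: mult.assoc)
    qed (use C0 b in simp)
  qed
qed

lemma is_product_local_product: "is_product u1 u2 (local_product u1 u2)"
  unfolding is_product_def
proof (intro conjI local_product_distribution ballI impI)
  fix \<phi> \<psi> :: "real^'n \<Rightarrow> complex" assume \<phi>: "\<phi> \<in> test_functions" and \<psi>: "\<psi> \<in> test_functions"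
    and "\<exists>U. open U \<and> supp \<phi> \<subseteq> U \<and> (\<forall>x\<in>U. \<psi> x = 1)"
  then have 1: "\<psi> x = 1" if "x \<in> supp \<phi>" for x using that by blast
  show "\<exists>v. is_tempered_product (localize \<psi> u1) (localize \<psi> u2) v \<and> local_product u1 u2 \<phi> = v \<phi>"
    using pairing_tempered_product[OF \<psi> \<psi>] local_product_eq[OF \<phi> \<psi> 1] test_schwartz[OF \<phi>]
    by (intro exI[of _ "restrict (pairing u1 u2 \<psi> \<psi>) schwartz"]) simp
qed

lemma dist_product_eq: "dist_product u1 u2 = local_product u1 u2"
  unfolding dist_product_def
  by (rule the_equality[where P="is_product u1 u2"])
     (use is_product_local_product is_product_unique in auto)

text \<open>Both localizers of the pairing start as a cutoff.  The first formula for the pairing is used twice to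
  turn the first cutoff into \<open>\<theta>1\<close>; then the second formula evaluates the pairing with \<open>\<theta>2\<close> times a character.\<close>

lemma loc_ft_local_product:
  assumes \<theta>: "\<theta>1 \<in> test_functions" "\<theta>2 \<in> test_functions"
  shows "loc_ft (local_product u1 u2) (\<lambda>x. \<theta>1 x * \<theta>2 x) \<xi> =
    complex_of_real (1 / (2 * pi) ^ CARD('n)) * conv (U1 \<theta>1) (U2 \<theta>2) \<xi>"
proof -
  let ?c = "complex_of_real (1 / (2 * pi) ^ CARD('n))"
  note m = U_measurable(1)[OF \<theta>(1)] U_measurable(2)[OF \<theta>(2)]
  let ?\<phi> = "\<lambda>x. \<theta>1 x * \<theta>2 x * chr \<xi> x" and ?\<chi> = "\<lambda>x. \<theta>2 x * chr \<xi> x"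
  have \<phi>: "?\<phi> \<in> test_functions" by (intro test_mult \<theta> test_smooth smooth_chr)
  have \<chi>: "?\<chi> \<in> test_functions" by (intro test_mult \<theta> smooth_chr)
  obtain R U where R: "0 < R" and U: "open U" "supp \<theta>1 \<union> supp \<theta>2 \<subseteq> U" "\<And>x. x \<in> U \<Longrightarrow> cutoff R x = 1"
    using cutoff_near_compact[OF compact_Un[OF test_compact[OF \<theta>(1)] test_compact[OF \<theta>(2)]]] by metis
  note t = test_cutoff[OF R]
  have c1: "cutoff R x * \<theta>1 x = \<theta>1 x" "cutoff R x * \<theta>2 x = \<theta>2 x" for x
    using U notin_supp[of x \<theta>1] notin_supp[of x \<theta>2] by (cases "x \<in> U"; auto)+
  have "supp ?\<phi> \<subseteq> supp \<theta>1" by (subst supp_subset_iff) (auto simp: notin_supp)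
  then have 1: "cutoff R x = 1" if "x \<in> supp ?\<phi>" for x using that U by blast
  have "loc_ft (local_product u1 u2) (\<lambda>x. \<theta>1 x * \<theta>2 x) \<xi> = pairing u1 u2 (cutoff R) (cutoff R) ?\<phi>"
    unfolding loc_ft_def by (rule local_product_eq[OF \<phi> t 1])
  also have "\<dots> = ?c * (LINT \<eta>|lborel. U2 (cutoff R) \<eta> * U1 (\<lambda>x. cutoff R x * ?\<phi> x) (- \<eta>))"
    by (rule pairing_eq1[OF t t test_schwartz[OF \<phi>]])
  also have "(\<lambda>x. cutoff R x * ?\<phi> x) = (\<lambda>x. \<theta>1 x * ?\<chi> x)"
    by (simp add: c1(1) flip: mult.assoc)
  also have "?c * (LINT \<eta>|lborel. U2 (cutoff R) \<eta> * U1 (\<lambda>x. \<theta>1 x * ?\<chi> x) (- \<eta>)) = pairing u1 u2 \<theta>1 (cutoff R) ?\<chi>"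
    by (rule pairing_eq1[OF \<theta>(1) t test_schwartz[OF \<chi>], symmetric])
  also have "\<dots> = ?c * (LINT \<eta>|lborel. U1 \<theta>1 \<eta> * U2 (\<lambda>x. cutoff R x * ?\<chi> x) (- \<eta>))"
    by (rule pairing_eq2[OF \<theta>(1) t test_schwartz[OF \<chi>]])
  also have "(\<lambda>\<eta>. U1 \<theta>1 \<eta> * U2 (\<lambda>x. cutoff R x * ?\<chi> x) (- \<eta>)) = (\<lambda>\<eta>. U2 \<theta>2 (\<xi> - \<eta>) * U1 \<theta>1 \<eta>)"
  proof
    fix \<eta>
    have e: "cutoff R x * ?\<chi> x * chr (- \<eta>) x = \<theta>2 x * chr (\<xi> - \<eta>) x" for x
      using c1(2)[of x] chr_add[of \<xi> "- \<eta>" x] by (simp flip: mult.assoc)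
    show "U1 \<theta>1 \<eta> * U2 (\<lambda>x. cutoff R x * ?\<chi> x) (- \<eta>) = U2 \<theta>2 (\<xi> - \<eta>) * U1 \<theta>1 \<eta>"
      by (subst mult.commute) (simp only: loc_ft_def e)
  qed
  also have "(LINT \<eta>|lborel. U2 \<theta>2 (\<xi> - \<eta>) * U1 \<theta>1 \<eta>) = conv (U1 \<theta>1) (U2 \<theta>2) \<xi>"
    by (simp only: conv_lborel[OF m(2,1)] conv_commute[OF m])
  finally show ?thesis .
qed

lemma energy_local_product:
  assumes \<theta>: "\<theta>1 \<in> test_functions" "\<theta>2 \<in> test_functions"
  shows "energy k (loc_ft (local_product u1 u2) (\<lambda>x. \<theta>1 x * \<theta>2 x)) \<le>
    ennreal (C\<^sup>2) * (energy k1 (U1 \<theta>1) * energy k2 (U2 \<theta>2))"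
proof -
  note m = U_measurable(1)[OF \<theta>(1)] U_measurable(2)[OF \<theta>(2)]
  let ?c = "1 / (2 * pi) ^ CARD('n)"
  \<comment> \<open>the factor \<open>(2 \<pi>)\<^sup>-\<^sup>n\<close> of the product is at most \<open>1\<close> and can be dropped\<close>
  have "1 \<le> 2 * pi" using pi_ge_two by linarith
  then have c1: "0 \<le> ?c" "?c \<le> 1" using one_le_power[of "2 * pi" "CARD('n)"] by auto
  have "energy k (loc_ft (local_product u1 u2) (\<lambda>x. \<theta>1 x * \<theta>2 x)) \<le>
     (\<integral>\<^sup>+\<xi>. ennreal ((k \<xi>)\<^sup>2) * (nconv (U1 \<theta>1) (U2 \<theta>2) \<xi>)\<^sup>2 \<partial>lborel)"
    unfolding energy_def
  proof (intro nn_integral_mono)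
    fix \<xi>
    let ?w = "norm (loc_ft (local_product u1 u2) (\<lambda>x. \<theta>1 x * \<theta>2 x) \<xi>)"
    have "?w = ?c * norm (conv (U1 \<theta>1) (U2 \<theta>2) \<xi>)"
      unfolding loc_ft_local_product[OF \<theta>] norm_mult using c1(1) by (simp del: of_real_divide)
    also have "\<dots> \<le> norm (conv (U1 \<theta>1) (U2 \<theta>2) \<xi>)" using c1 by (intro mult_left_le_one_le) auto
    finally have "ennreal ?w \<le> nconv (U1 \<theta>1) (U2 \<theta>2) \<xi>"
      using norm_conv_le[OF m, of \<xi>] ennreal_leI order_trans by blast
    then have "ennreal ((k \<xi>)\<^sup>2) * (ennreal ?w)\<^sup>2 \<le> ennreal ((k \<xi>)\<^sup>2) * (nconv (U1 \<theta>1) (U2 \<theta>2) \<xi>)\<^sup>2"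
      by (intro mult_left_mono power_mono_ennreal) auto
    then show "ennreal ((k \<xi> * ?w)\<^sup>2) \<le> ennreal ((k \<xi>)\<^sup>2) * (nconv (U1 \<theta>1) (U2 \<theta>2) \<xi>)\<^sup>2"
      by (simp add: power_mult_distrib ennreal_mult ennreal_power)
  qed
  also note weighted_nconv[OF \<theta>]
  finally show ?thesis .
qed

end

section \<open>The norm of a localization\<close>

lemma energy_given_by:
  assumes k: "k \<in> K_pol" and f: "given_by u f" and g: "given_by u g"
  shows "(\<integral>\<^sup>+\<xi>. ennreal ((k \<xi> * norm (f \<xi>))\<^sup>2) \<partial>lebesgue) = energy k g"
  unfolding energy_def nn_integral_completion[symmetric, where M=lborel and f="\<lambda>\<xi>. ennreal ((k \<xi> * norm (g \<xi>))\<^sup>2)"]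
  using given_by_unique[OF f g] by (intro nn_integral_cong_AE) auto

lemma integrable_iff_energy_finite:
  assumes k: "k \<in> K_pol" and f: "given_by u f" and g: "given_by u g"
  shows "integrable lebesgue (\<lambda>\<xi>. (k \<xi> * norm (f \<xi>))\<^sup>2) \<longleftrightarrow> energy k g < \<infinity>"
proof -
  note [measurable] = K_polD(1)[OF k]
  have [measurable]: "f \<in> borel_measurable lebesgue"
    using f by (intro locally_integrable_measurable) (simp add: given_by_def)
  have "(\<lambda>\<xi>. (k \<xi> * norm (f \<xi>))\<^sup>2) \<in> borel_measurable lebesgue" by measurable
  then show ?thesis
    unfolding energy_given_by[OF assms, symmetric] by (simp add: integrable_iff_bounded del: power2_abs)
qed

text \<open>The norm is defined with an arbitrary representative of the Fourier transform; representatives agree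
  almost everywhere, and \<open>loc_ft u \<psi>\<close> is one of them.\<close>

lemma B_norm_squared:
  assumes k: "k \<in> K_pol" and u: "u \<in> distributions" and \<psi>: "\<psi> \<in> test_functions"
  shows "(B_norm k (localize \<psi> u))\<^sup>2 = energy k (loc_ft u \<psi>)"
proof -
  let ?v = "localize \<psi> u"
  have U: "given_by (fourier ?v) (loc_ft u \<psi>)" by (rule given_by_loc_ft[OF u \<psi>])
  define f where "f = (SOME f. given_by (fourier ?v) f)"
  have f: "given_by (fourier ?v) f" unfolding f_def by (rule someI[where P="given_by (fourier ?v)", OF U])
  have iff: "?v \<in> B_space k \<longleftrightarrow> energy k (loc_ft u \<psi>) < \<infinity>"
    using integrable_iff_energy_finite[OF k _ U] U localize_tempered[OF u \<psi>] unfolding B_space_def by blast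
  show ?thesis
  proof (cases "?v \<in> B_space k")
    case True
    then have i: "integrable lebesgue (\<lambda>\<xi>. (k \<xi> * norm (f \<xi>))\<^sup>2)"
      using iff integrable_iff_energy_finite[OF k f U] by blast
    have "(B_norm k ?v)\<^sup>2 = ennreal (LINT \<xi>|lebesgue. (k \<xi> * norm (f \<xi>))\<^sup>2)"
      using True by (simp add: B_norm_def f_def[symmetric] ennreal_power)
    also have "\<dots> = (\<integral>\<^sup>+\<xi>. ennreal ((k \<xi> * norm (f \<xi>))\<^sup>2) \<partial>lebesgue)"
      by (rule nn_integral_eq_integral[OF i, symmetric]) simp
    also have "\<dots> = energy k (loc_ft u \<psi>)" by (rule energy_given_by[OF k f U])
    finally show ?thesis .
  next
    case False
    then have "energy k (loc_ft u \<psi>) = \<infinity>" using iff by (simp add: not_less top_unique)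
    then show ?thesis using False by (simp add: B_norm_def)
  qed
qed

text \<open>Used to express the norm through the energy, which is visibly measurable in a parameter.\<close>

definition esqrt :: "ennreal \<Rightarrow> ennreal" where
  "esqrt e = (if e = \<infinity> then \<infinity> else ennreal (sqrt (enn2real e)))"

lemma esqrt_measurable [measurable]: "esqrt \<in> borel_measurable borel"
  unfolding esqrt_def by measurable

lemma esqrt_power2: "esqrt (x\<^sup>2) = x"
  by (cases x) (auto simp: esqrt_def ennreal_power)

lemma ennreal_power2_le: "x\<^sup>2 \<le> y\<^sup>2 \<Longrightarrow> x \<le> (y :: ennreal)"
  by (cases x; cases y) (auto simp: ennreal_power top_unique power2_le_iff_abs_le)

lemma fourier_fun_translate:
  assumes \<theta>: "\<theta> \<in> schwartz"
  shows "fourier_fun (translate y \<theta>) \<eta> = chr \<eta> y * fourier_fun \<theta> \<eta>"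
proof -
  note [measurable] = schwartz_measurable[OF \<theta>]
  have [measurable]: "translate y \<theta> \<in> borel_measurable borel" unfolding translate_def by measurable
  have "fourier_fun (translate y \<theta>) \<eta> = (LINT x|lborel. chr \<eta> (x + y) * translate y \<theta> (x + y))"
    by (subst fourier_fun_lborel, simp, rule lborel_integral_translate(1)[symmetric]) simp
  also have "\<dots> = (LINT x|lborel. chr \<eta> y * (chr \<eta> x * \<theta> x))"
    by (intro Bochner_Integration.integral_cong refl) (simp add: translate_def chr_add_left mult_ac)
  also have "\<dots> = chr \<eta> y * fourier_fun \<theta> \<eta>" by (simp add: fourier_fun_lborel)
  finally show ?thesis .
qed

text \<open>On bounded sets of \<open>y\<close> the translate is unchanged by multiplication with a large cutoff, and then \<open>loc_ft\<close>
  is an integral whose integrand is an explicit measurable function of \<open>y\<close>, \<open>\<xi>\<close> and \<open>\<zeta>\<close>.\<close>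

lemma loc_ft_translate_measurable:
  fixes \<theta> :: "real^'n::finite \<Rightarrow> complex"
  assumes u: "u \<in> distributions" and \<theta>: "\<theta> \<in> test_functions"
  shows "(\<lambda>z. loc_ft u (translate (fst z) \<theta>) (snd z)) \<in> borel_measurable (borel \<Otimes>\<^sub>M borel)"
proof (rule borel_measurable_LIMSEQ_metric)
  note tt = test_translate[OF \<theta>]
  let ?w = "\<lambda>n z. loc_ft u (\<lambda>x. cutoff (real (Suc n)) x * translate (fst z) \<theta> x) (snd z)"
  note [measurable] = schwartz_measurable[OF fourier_fun_schwartz[OF test_schwartz[OF \<theta>]]]
  show "?w n \<in> borel_measurable (borel \<Otimes>\<^sub>M borel)" for n
  proof -
    have c: "cutoff (real (Suc n)) \<in> test_functions" by (rule test_cutoff) simp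
    note [measurable] = loc_ft_measurable[OF u c]
    have "?w n = (\<lambda>z. LINT \<zeta>|lborel. loc_ft u (cutoff (real (Suc n))) \<zeta> *
       (complex_of_real (1 / (2 * pi) ^ CARD('n)) * (exp (- (\<i> * complex_of_real (fst z \<bullet> (snd z - \<zeta>)))) * fourier_fun \<theta> (snd z - \<zeta>))))"
      by (rule ext, subst loc_ft_mult[OF u c test_schwartz[OF tt]])
         (simp only: inv_ft_def fourier_fun_translate[OF test_schwartz[OF \<theta>]] chr_def)
    moreover have "\<dots> \<in> borel_measurable (borel \<Otimes>\<^sub>M borel)"
      by (rule lborel.borel_measurable_lebesgue_integral) measurable
    ultimately show ?thesis by simp
  qed
  fix z :: "(real^'n) \<times> (real^'n)"
  obtain r where r: "\<And>x. x \<in> supp (translate (fst z) \<theta>) \<Longrightarrow> norm x \<le> r"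
    using compact_imp_bounded[OF test_compact[OF tt]] bounded_iff by metis
  obtain N :: nat where N: "r \<le> real N" using real_arch_simple by blast
  have "\<forall>\<^sub>F n in sequentially. ?w n z = loc_ft u (translate (fst z) \<theta>) (snd z)"
  proof (rule eventually_sequentiallyI[of N])
    fix n assume n: "N \<le> n"
    have e: "cutoff (real (Suc n)) x * translate (fst z) \<theta> x = translate (fst z) \<theta> x" for x
    proof (cases "x \<in> supp (translate (fst z) \<theta>)")
      case True
      then have "norm x \<le> real (Suc n)" using r[of x] N n by linarith
      then have "cutoff (real (Suc n)) x = 1" by (intro cutoff_eq_1) auto
      then show ?thesis by simp
    qed (simp add: notin_supp)
    show "?w n z = loc_ft u (translate (fst z) \<theta>) (snd z)" by (simp only: e)
  qed
  then show "(\<lambda>n. ?w n z) \<longlonglongrightarrow> loc_ft u (translate (fst z) \<theta>) (snd z)" by (rule tendsto_eventually)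
qed

lemma B_norm_translate_measurable:
  fixes \<theta> :: "real^'n::finite \<Rightarrow> complex"
  assumes k: "k \<in> K_pol" and u: "u \<in> distributions" and \<theta>: "\<theta> \<in> test_functions"
  shows "(\<lambda>y. B_norm k (localize (translate y \<theta>) u)) \<in> borel_measurable lebesgue"
proof -
  obtain k' where k'[measurable]: "k' \<in> borel_measurable lborel" and ae: "AE \<xi> in lborel. k \<xi> = k' \<xi>"
    using completion_ex_borel_measurable_real[OF K_polD(1)[OF k]] by blast
  have k'b[measurable]: "k' \<in> borel_measurable borel" using k' by simp
  note [measurable] = loc_ft_translate_measurable[OF u \<theta>]
  have "B_norm k (localize (translate y \<theta>) u) = esqrt (\<integral>\<^sup>+\<xi>. ennreal ((k' \<xi> * norm (loc_ft u (translate y \<theta>) \<xi>))\<^sup>2) \<partial>lborel)" for y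
  proof -
    have "B_norm k (localize (translate y \<theta>) u) = esqrt (energy k (loc_ft u (translate y \<theta>)))"
      by (simp add: B_norm_squared[OF k u test_translate[OF \<theta>], symmetric] esqrt_power2)
    also have "energy k (loc_ft u (translate y \<theta>)) = (\<integral>\<^sup>+\<xi>. ennreal ((k' \<xi> * norm (loc_ft u (translate y \<theta>) \<xi>))\<^sup>2) \<partial>lborel)"
      unfolding energy_def using ae by (intro nn_integral_cong_AE) auto
    finally show ?thesis .
  qed
  moreover have "(\<lambda>y. esqrt (\<integral>\<^sup>+\<xi>. ennreal ((k' \<xi> * norm (loc_ft u (translate y \<theta>) \<xi>))\<^sup>2) \<partial>lborel)) \<in> borel_measurable borel"
  proof (rule measurable_compose[OF _ esqrt_measurable], rule lborel.borel_measurable_nn_integral)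
    have "(\<lambda>z. ennreal ((k' (snd z) * norm (loc_ft u (translate (fst z) \<theta>) (snd z)))\<^sup>2)) \<in> borel_measurable (borel \<Otimes>\<^sub>M borel)"
      by measurable
    moreover have "sets (borel \<Otimes>\<^sub>M lborel) = sets (borel \<Otimes>\<^sub>M borel :: ((real^'n) \<times> (real^'n)) measure)"
      by (rule sets_pair_measure_cong) auto
    ultimately show "(\<lambda>(y, \<xi>). ennreal ((k' \<xi> * norm (loc_ft u (translate y \<theta>) \<xi>))\<^sup>2)) \<in> borel_measurable (borel \<Otimes>\<^sub>M lborel)"
      by (simp add: case_prod_unfold cong: measurable_cong_sets)
  qed
  ultimately show ?thesis by (intro measurable_completion) simp
qed

section \<open>Hoelder's inequality for membership in Lebesgue spaces\<close>

lemma in_Lp_measurable: "in_Lp p g \<Longrightarrow> g \<in> borel_measurable lebesgue"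
  by (simp add: in_Lp_def)

lemma in_Lp_top_iff:
  "in_Lp \<infinity> g \<longleftrightarrow> g \<in> borel_measurable lebesgue \<and> (\<exists>M. AE y in lebesgue. g y \<le> ennreal M)"
proof -
  have "(\<exists>M. AE y in lebesgue. g y \<le> ennreal M)" if "esssup lebesgue g < \<infinity>"
    using esssup_AE[of g lebesgue] that by (cases "esssup lebesgue g") auto
  moreover have "esssup lebesgue g < \<infinity>" if "g \<in> borel_measurable lebesgue" "AE y in lebesgue. g y \<le> ennreal M" for M
    using esssup_I[OF that] by (rule le_less_trans) simp
  ultimately show ?thesis unfolding in_Lp_def by auto
qed

lemma in_Lp_AE_finite: "in_Lp p g \<Longrightarrow> AE y in lebesgue. g y < \<infinity>"
proof (cases "p = \<infinity>")
  case True
  assume "in_Lp p g"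
  then obtain M where "AE y in lebesgue. g y \<le> ennreal M" using True in_Lp_top_iff by blast
  then show ?thesis by eventually_elim (rule le_less_trans, auto)
qed (simp add: in_Lp_def)

lemma nn_integral_reflect:
  fixes f :: "real^'n::finite \<Rightarrow> ennreal"
  assumes "f \<in> borel_measurable lebesgue"
  shows "(\<integral>\<^sup>+y. f (\<xi> - y) \<partial>lebesgue) = (\<integral>\<^sup>+y. f y \<partial>lebesgue)"
proof -
  obtain f' where [measurable]: "f' \<in> borel_measurable lborel" and ae: "AE x in lborel. f x = f' x"
    using completion_ex_borel_measurable[OF assms] by blast
  have "(\<integral>\<^sup>+y. f (\<xi> - y) \<partial>lborel) = (\<integral>\<^sup>+y. f' (\<xi> - y) \<partial>lborel)"
    by (rule nn_integral_cong_AE[OF AE_lborel_reflect[OF ae]])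
  also have "\<dots> = (\<integral>\<^sup>+y. f' y \<partial>distr lborel borel (\<lambda>y. \<xi> - y))"
    by (subst nn_integral_distr) auto
  also have "\<dots> = (\<integral>\<^sup>+y. f y \<partial>lborel)"
    unfolding lborel_distr_reflect using ae by (intro nn_integral_cong_AE) auto
  finally show ?thesis by (simp add: nn_integral_completion)
qed

lemma in_Lp_reflect:
  fixes g :: "real^'n::finite \<Rightarrow> ennreal"
  assumes g: "in_Lp p g" shows "in_Lp p (\<lambda>y. g (\<xi> - y))"
proof (cases "p = \<infinity>")
  case True
  then show ?thesis
    using g AE_lebesgue_reflect lebesgue_measurable_reflect unfolding True in_Lp_top_iff by blast
next
  case False
  note m[measurable] = in_Lp_measurable[OF g]
  have "AE y in lebesgue. g (\<xi> - y) < \<infinity>" by (rule AE_lebesgue_reflect[OF in_Lp_AE_finite[OF g]])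
  moreover have "(\<integral>\<^sup>+y. ennreal (enn2real (g (\<xi> - y)) powr enn2real p) \<partial>lebesgue) = (\<integral>\<^sup>+y. ennreal (enn2real (g y) powr enn2real p) \<partial>lebesgue)"
    by (rule nn_integral_reflect[of "\<lambda>y. ennreal (enn2real (g y) powr enn2real p)"]) measurable
  ultimately show ?thesis
    using g False lebesgue_measurable_reflect[OF m, of \<xi>] by (simp add: in_Lp_def)
qed

lemma in_Lp_translate:
  assumes "in_Lp p g" shows "in_Lp p (\<lambda>y. g (y + a))"
  using in_Lp_reflect[OF in_Lp_reflect[OF assms, of 0], of "- a"] by simp

text \<open>With \<open>m\<close> the larger of the two summands, the left-hand side is at most \<open>m\<close> to the power
  \<open>r / r1 + r / r2 = 1\<close>.  This crude form of Young's inequality suffices as only finiteness of integrals matters.\<close>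

lemma powr_product_le_sum:
  fixes a b :: real
  assumes ab: "0 \<le> a" "0 \<le> b" and r: "0 < r" "0 < r1" "0 < r2" and e: "1 / r1 + 1 / r2 = 1 / r"
  shows "a powr r * b powr r \<le> a powr r1 + b powr r2"
proof -
  define m where "m = max (a powr r1) (b powr r2)"
  have m0: "0 \<le> m" unfolding m_def by (simp add: le_max_iff_disj)
  have "a powr r = (a powr r1) powr (r / r1)" "b powr r = (b powr r2) powr (r / r2)"
    using r by (simp_all add: powr_powr)
  moreover have "(a powr r1) powr (r / r1) \<le> m powr (r / r1)" "(b powr r2) powr (r / r2) \<le> m powr (r / r2)"
    using r by (intro powr_mono2; simp add: m_def)+
  ultimately have "a powr r * b powr r \<le> m powr (r / r1) * m powr (r / r2)"
    by (simp add: mult_mono)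
  also have "\<dots> = m powr (r / r1 + r / r2)" by (simp add: powr_add)
  also have "r / r1 + r / r2 = 1"
  proof -
    have "r / r1 + r / r2 = r * (1 / r1 + 1 / r2)" by (simp add: distrib_left)
    then show ?thesis using e r by simp
  qed
  also have "m powr 1 = m" using m0 by simp
  also have "\<dots> \<le> a powr r1 + b powr r2" by (simp add: m_def)
  finally show ?thesis .
qed

lemma in_Lp_finiteI:
  assumes p: "p \<noteq> \<infinity>" and m: "g \<in> borel_measurable lebesgue" and fin: "AE y in lebesgue. g y < \<infinity>"
    and le: "AE y in lebesgue. enn2real (g y) powr enn2real p \<le> h y"
    and h: "(\<integral>\<^sup>+y. ennreal (h y) \<partial>lebesgue) < \<infinity>"
  shows "in_Lp p g"
proof -
  have "(\<integral>\<^sup>+y. ennreal (enn2real (g y) powr enn2real p) \<partial>lebesgue) \<le> (\<integral>\<^sup>+y. ennreal (h y) \<partial>lebesgue)"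
    using le by (intro nn_integral_mono_AE) (auto intro: ennreal_leI)
  with h have "(\<integral>\<^sup>+y. ennreal (enn2real (g y) powr enn2real p) \<partial>lebesgue) < \<infinity>" by (rule le_less_trans[rotated])
  with p m fin show ?thesis by (simp add: in_Lp_def)
qed

lemma inverse_exponent:
  fixes p :: ennreal assumes "1 \<le> p" "p \<noteq> \<infinity>"
  shows "1 \<le> enn2real p" "1 / p = ennreal (1 / enn2real p)"
proof -
  obtain r where r: "p = ennreal r" "0 \<le> r" using assms(2) by (cases p) auto
  have r1: "1 \<le> r" using assms(1) r by (simp add: ennreal_ge_1)
  then show "1 \<le> enn2real p" using r by simp
  show "1 / p = ennreal (1 / enn2real p)"
    using r r1 divide_ennreal[of 1 r] by simp
qed

lemma in_Lp_holder_one_sided: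
  assumes p: "p \<noteq> \<infinity>" "1 \<le> p" and g1: "in_Lp \<infinity> g1" and g2: "in_Lp p g2"
    and c: "0 \<le> c" and m: "g \<in> borel_measurable lebesgue" and le: "\<And>y. g y \<le> ennreal c * (g1 y * g2 y)"
  shows "in_Lp p g"
proof -
  let ?r = "enn2real p"
  note [measurable] = in_Lp_measurable[OF g2]
  obtain M where M: "AE y in lebesgue. g1 y \<le> ennreal M" using g1 in_Lp_top_iff by blast
  define M' where "M' = max 0 M"
  have cM: "0 \<le> c * M'" using c by (simp add: M'_def)
  have bound: "AE y in lebesgue. g y < \<infinity> \<and> enn2real (g y) powr ?r \<le> (c * M') powr ?r * enn2real (g2 y) powr ?r"
    using M in_Lp_AE_finite[OF g2]
  proof eventually_elim
    case (elim y)
    have "g y \<le> ennreal c * (ennreal M' * g2 y)"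
      using elim(1) by (intro order_trans[OF le] mult_left_mono mult_right_mono) (auto simp: M'_def intro: order_trans ennreal_leI)
    also have "g2 y = ennreal (enn2real (g2 y))" using elim(2) by simp
    also have "ennreal c * (ennreal M' * ennreal (enn2real (g2 y))) = ennreal ((c * M') * enn2real (g2 y))"
      using c by (simp add: ennreal_mult M'_def mult.assoc)
    finally have *: "g y \<le> ennreal ((c * M') * enn2real (g2 y))" .
    then have "enn2real (g y) \<le> (c * M') * enn2real (g2 y)"
      using cM by (intro enn2real_leI) auto
    then have "enn2real (g y) powr ?r \<le> ((c * M') * enn2real (g2 y)) powr ?r"
      by (intro powr_mono2) auto
    also have "\<dots> = (c * M') powr ?r * enn2real (g2 y) powr ?r" using cM by (simp add: powr_mult)
    finally show ?case using le_less_trans[OF *] by simp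
  qed
  show ?thesis
  proof (rule in_Lp_finiteI[OF p(1) m])
    show "AE y in lebesgue. g y < \<infinity>" using bound by auto
    show "AE y in lebesgue. enn2real (g y) powr ?r \<le> (c * M') powr ?r * enn2real (g2 y) powr ?r" using bound by auto
    have "(\<integral>\<^sup>+y. ennreal ((c * M') powr ?r * enn2real (g2 y) powr ?r) \<partial>lebesgue) =
       ennreal ((c * M') powr ?r) * (\<integral>\<^sup>+y. ennreal (enn2real (g2 y) powr ?r) \<partial>lebesgue)"
      by (subst nn_integral_cmult[symmetric], measurable) (simp add: ennreal_mult)
    also have "\<dots> < \<infinity>" using g2 p by (simp add: in_Lp_def ennreal_mult_less_top)
    finally show "(\<integral>\<^sup>+y. ennreal ((c * M') powr ?r * enn2real (g2 y) powr ?r) \<partial>lebesgue) < \<infinity>" .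
  qed
qed

theorem in_Lp_holder:
  assumes p: "1 \<le> p" "1 \<le> p1" "1 \<le> p2" and e: "1 / p1 + 1 / p2 = 1 / p"
    and g1: "in_Lp p1 g1" and g2: "in_Lp p2 g2"
    and c: "0 \<le> c" and m: "g \<in> borel_measurable lebesgue" and le: "\<And>y. g y \<le> ennreal c * (g1 y * g2 y)"
  shows "in_Lp p g"
proof -
  have inf: "q = \<infinity>" if "1 / q = 0" "1 \<le> q" for q :: ennreal
    using that inverse_exponent[of q] by (cases "q = \<infinity>") auto
  have eq: "q = q'" if q: "1 / q = 1 / q'" "1 \<le> q" "1 \<le> q'" for q q' :: ennreal
  proof (cases "q = \<infinity> \<or> q' = \<infinity>")
    case True
    then show ?thesis using inf[of q] inf[of q'] q by auto
  next
    case False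
    then have "ennreal (1 / enn2real q) = ennreal (1 / enn2real q')" "1 \<le> enn2real q" "1 \<le> enn2real q'"
      using q inverse_exponent[of q] inverse_exponent[of q'] by auto
    then have "enn2real q = enn2real q'" by (simp add: ennreal_inj)
    then show ?thesis using False by (metis ennreal_enn2real_if infinity_ennreal_def)
  qed
  consider (i) "p1 = \<infinity>" "p2 = \<infinity>" | (ii) "p1 = \<infinity>" "p2 \<noteq> \<infinity>" | (iii) "p1 \<noteq> \<infinity>" "p2 = \<infinity>"
    | (iv) "p1 \<noteq> \<infinity>" "p2 \<noteq> \<infinity>" by blast
  then show ?thesis
  proof cases
    case i
    then have pinf: "p = \<infinity>" using e p inf[of p] by simp
    obtain M1 where M1: "AE y in lebesgue. g1 y \<le> ennreal M1" using g1 i(1) in_Lp_top_iff by blast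
    obtain M2 where M2: "AE y in lebesgue. g2 y \<le> ennreal M2" using g2 i(2) in_Lp_top_iff by blast
    have "AE y in lebesgue. g y \<le> ennreal (c * (max 0 M1 * max 0 M2))"
      using M1 M2
    proof eventually_elim
      case (elim y)
      have "g y \<le> ennreal c * (ennreal (max 0 M1) * ennreal (max 0 M2))"
        using elim by (intro order_trans[OF le] mult_left_mono mult_mono) (auto intro: order_trans ennreal_leI)
      then show ?case using c by (simp add: ennreal_mult)
    qed
    then show ?thesis unfolding pinf in_Lp_top_iff using m by blast
  next
    case ii
    then have "p = p2" using e p eq[of p2 p] by simp
    then show ?thesis using in_Lp_holder_one_sided[OF _ p(1) _ _ c m le] g1 g2 ii by simp
  next
    case iii
    then have "p = p1" using e p eq[of p1 p] by simp
    moreover have "g y \<le> ennreal c * (g2 y * g1 y)" for y using le[of y] by (simp add: mult.commute)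
    ultimately show ?thesis using in_Lp_holder_one_sided[OF _ p(1) _ _ c m] g1 g2 iii by simp
  next
    case iv
    have pfin: "p \<noteq> \<infinity>"
      using e inverse_exponent[OF p(2) iv(1)] inverse_exponent[OF p(3) iv(2)] by auto
    let ?r = "enn2real p" and ?r1 = "enn2real p1" and ?r2 = "enn2real p2"
    note r = inverse_exponent(1)[OF p(1) pfin] inverse_exponent(1)[OF p(2) iv(1)] inverse_exponent(1)[OF p(3) iv(2)]
    have "ennreal (1 / ?r1 + 1 / ?r2) = ennreal (1 / ?r)"
      using e r inverse_exponent(2)[OF p(1) pfin] inverse_exponent(2)[OF p(2) iv(1)] inverse_exponent(2)[OF p(3) iv(2)]
      by simp
    then have er: "1 / ?r1 + 1 / ?r2 = 1 / ?r" using r by (subst (asm) ennreal_inj) auto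
    note [measurable] = in_Lp_measurable[OF g1] in_Lp_measurable[OF g2]
    let ?h = "\<lambda>y. c powr ?r * (enn2real (g1 y) powr ?r1 + enn2real (g2 y) powr ?r2)"
    have bound: "AE y in lebesgue. g y < \<infinity> \<and> enn2real (g y) powr ?r \<le> ?h y"
      using in_Lp_AE_finite[OF g1] in_Lp_AE_finite[OF g2]
    proof eventually_elim
      case (elim y)
      define a b where "a = enn2real (g1 y)" and "b = enn2real (g2 y)"
      have ab: "g1 y = ennreal a" "g2 y = ennreal b" "0 \<le> a" "0 \<le> b" using elim by (simp_all add: a_def b_def)
      have *: "g y \<le> ennreal (c * (a * b))" using le[of y] ab c by (simp add: ennreal_mult)
      then have "enn2real (g y) \<le> c * (a * b)" using ab c by (intro enn2real_leI) auto
      then have "enn2real (g y) powr ?r \<le> (c * (a * b)) powr ?r" using r by (intro powr_mono2) auto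
      also have "\<dots> = c powr ?r * (a powr ?r * b powr ?r)" using ab c by (simp add: powr_mult)
      also have "\<dots> \<le> c powr ?r * (a powr ?r1 + b powr ?r2)"
        using r by (intro mult_left_mono powr_product_le_sum ab er) auto
      finally show ?case using le_less_trans[OF *] by (simp add: a_def b_def)
    qed
    show ?thesis
    proof (rule in_Lp_finiteI[OF pfin m])
      show "AE y in lebesgue. g y < \<infinity>" using bound by auto
      show "AE y in lebesgue. enn2real (g y) powr ?r \<le> ?h y" using bound by auto
      have "(\<integral>\<^sup>+y. ennreal (?h y) \<partial>lebesgue) = (\<integral>\<^sup>+y. ennreal (c powr ?r) *
          (ennreal (enn2real (g1 y) powr ?r1) + ennreal (enn2real (g2 y) powr ?r2)) \<partial>lebesgue)"
        by (intro nn_integral_cong) (simp add: ennreal_mult)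
      also have "\<dots> = ennreal (c powr ?r) * ((\<integral>\<^sup>+y. ennreal (enn2real (g1 y) powr ?r1) \<partial>lebesgue) + (\<integral>\<^sup>+y. ennreal (enn2real (g2 y) powr ?r2) \<partial>lebesgue))"
        by (subst nn_integral_cmult, measurable, subst nn_integral_add, measurable)
      also have "\<dots> < \<infinity>" using g1 g2 iv by (simp add: in_Lp_def ennreal_mult_less_top)
      finally show "(\<integral>\<^sup>+y. ennreal (?h y) \<partial>lebesgue) < \<infinity>" .
    qed
  qed
qed

section \<open>Products of local Lebesgue-type spaces\<close>

lemma Bp_space_energy_finite:
  assumes k: "k \<in> K_pol" and u: "u \<in> distributions" and \<theta>: "\<theta> \<in> test_functions" "\<theta> \<noteq> (\<lambda>x. 0)"
    and L: "in_Lp p (\<lambda>y. B_norm k (localize (translate y \<theta>) u))" and \<psi>: "\<psi> \<in> test_functions"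
  shows "energy k (loc_ft u \<psi>) < \<infinity>"
proof (rule energy_finite_everywhere[OF k u \<theta> _ \<psi>])
  show "AE y in lebesgue. energy k (loc_ft u (translate y \<theta>)) < \<infinity>"
    using in_Lp_AE_finite[OF L]
    by eventually_elim (simp add: B_norm_squared[OF k u test_translate[OF \<theta>(1)], symmetric] power_less_top_ennreal)
qed

theorem corollary4p2:
  fixes k k1 k2 :: "real^'n::finite \<Rightarrow> real"
    and p p1 p2 :: ennreal
    and C :: real
  assumes "k \<in> K_pol" and "k1 \<in> K_pol" and "k2 \<in> K_pol"
    and "C > 0"
    and "\<And>\<xi>. nn_conv (\<lambda>\<eta>. ennreal (1 / (k1 \<eta>)\<^sup>2)) (\<lambda>\<eta>. ennreal (1 / (k2 \<eta>)\<^sup>2)) \<xi>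
            \<le> ennreal (C\<^sup>2 / (k \<xi>)\<^sup>2)"
    and "1 \<le> p" and "1 \<le> p1" and "1 \<le> p2"
    and "1 / p1 + 1 / p2 = 1 / p"
  shows "{dist_product u1 u2 | u1 u2. u1 \<in> Bp_space k1 p1 \<and> u2 \<in> Bp_space k2 p2} \<subseteq> Bp_space k p"
proof (safe)
  fix u1 u2 assume "u1 \<in> Bp_space k1 p1" "u2 \<in> Bp_space k2 p2"
  then obtain \<theta>1 \<theta>2 where u: "u1 \<in> distributions" "u2 \<in> distributions"
    and \<theta>1: "\<theta>1 \<in> test_functions" "\<theta>1 \<noteq> (\<lambda>x. 0)" and \<theta>2: "\<theta>2 \<in> test_functions" "\<theta>2 \<noteq> (\<lambda>x. 0)"
    and L1: "in_Lp p1 (\<lambda>y. B_norm k1 (localize (translate y \<theta>1) u1))"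
    and L2: "in_Lp p2 (\<lambda>y. B_norm k2 (localize (translate y \<theta>2) u2))"
    unfolding Bp_space_def by blast
  interpret product_setting k k1 k2 C u1 u2
    by unfold_locales
       (use assms(1-3,5) u Bp_space_energy_finite[OF assms(2) u(1) \<theta>1 L1] Bp_space_energy_finite[OF assms(3) u(2) \<theta>2 L2]
        in blast)+
  let ?w = "dist_product u1 u2"
  have w: "?w \<in> distributions" unfolding dist_product_eq by (rule local_product_distribution)
  obtain x1 x2 where x: "\<theta>1 x1 \<noteq> 0" "\<theta>2 x2 \<noteq> 0" using \<theta>1(2) \<theta>2(2) by blast
  \<comment> \<open>for this translation \<open>\<theta>1\<close> and the translate of \<open>\<theta>2\<close> are both nonzero at \<open>x1\<close>\<close>
  define a where "a = x1 - x2"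
  define \<theta> where "\<theta> = (\<lambda>x. \<theta>1 x * translate a \<theta>2 x)"
  have \<theta>: "\<theta> \<in> test_functions"
    unfolding \<theta>_def by (intro test_mult \<theta>1 test_smooth test_translate \<theta>2)
  have "\<theta> x1 \<noteq> 0" using x by (simp add: \<theta>_def translate_def a_def)
  then have \<theta>0: "\<theta> \<noteq> (\<lambda>x. 0)" by auto
  have \<theta>y: "translate y \<theta> = (\<lambda>x. translate y \<theta>1 x * translate (y + a) \<theta>2 x)" for y
    by (simp add: \<theta>_def translate_def diff_diff_eq)
  have le: "B_norm k (localize (translate y \<theta>) ?w) \<le>
      ennreal C * (B_norm k1 (localize (translate y \<theta>1) u1) * B_norm k2 (localize (translate (y + a) \<theta>2) u2))" for y
  proof (rule ennreal_power2_le)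
    note t = test_translate[OF \<theta>1(1), of y] test_translate[OF \<theta>2(1), of "y + a"]
    have "(B_norm k (localize (translate y \<theta>) ?w))\<^sup>2 = energy k (loc_ft ?w (translate y \<theta>))"
      by (rule B_norm_squared[OF assms(1) w test_translate[OF \<theta>]])
    also have "\<dots> \<le> ennreal (C\<^sup>2) * (energy k1 (loc_ft u1 (translate y \<theta>1)) * energy k2 (loc_ft u2 (translate (y + a) \<theta>2)))"
      unfolding \<theta>y dist_product_eq by (rule energy_local_product[OF t])
    also have "\<dots> = (ennreal C * (B_norm k1 (localize (translate y \<theta>1) u1) * B_norm k2 (localize (translate (y + a) \<theta>2) u2)))\<^sup>2"
      using assms(4)
      by (simp add: power_mult_distrib ennreal_power B_norm_squared[OF assms(2) u(1) t(1)] B_norm_squared[OF assms(3) u(2) t(2)])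
    finally show "(B_norm k (localize (translate y \<theta>) ?w))\<^sup>2 \<le>
      (ennreal C * (B_norm k1 (localize (translate y \<theta>1) u1) * B_norm k2 (localize (translate (y + a) \<theta>2) u2)))\<^sup>2" .
  qed
  have "in_Lp p (\<lambda>y. B_norm k (localize (translate y \<theta>) ?w))"
    by (rule in_Lp_holder[OF assms(6-9) L1 in_Lp_translate[OF L2, of a] _ B_norm_translate_measurable[OF assms(1) w \<theta>] le])
       (use assms(4) in simp)
  then show "?w \<in> Bp_space k p"
    unfolding Bp_space_def using w \<theta> \<theta>0 by blast
qed

end
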